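(* Let $-\infty<a<b<\infty$, let $k>0$, and let $A$ be the self-adjoint operator in $L^2[a,b]$ given by $Af=-f''+kf$ on the domain $$\mathcal{D}(A)=\{f:[a,b]\to\mathbb{C}\mid f,f'\in AC[a,b];\ f''\in L^2[a,b];\ f(a)=-f(b);\ f'(a)=-f'(b)\}.$$ Then the domain of the positive square root $A^{1/2}$ of $A$ is $$\mathcal{D}(A^{1/2})=\{f:[a,b]\to\mathbb{C}\mid f\in AC[a,b];\ f(a)=-f(b);\ f'\in L^2[a,b]\}.$$
   Context: $L^2[a,b]$ is the complex Hilbert space with $(f,g)_{L^2[a,b]}=\int_a^b f(x)\overline{g}(x)\,dx$; $AC[a,b]$ denotes the complex-valued absolutely continuous functions on $[a,b]$; functions are identified with their classes in $L^2[a,b]$. The operator $A$ is self-adjoint and bounded below by $kI$ in $L^2[a,b]$, and $A^{1/2}$ is its unique positive self-adjoint square root. *)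

theory Defs
  imports "HOL-Analysis.Analysis"
begin

definition L2_fun :: "'a measure \<Rightarrow> ('a \<Rightarrow> complex) set" where
  "L2_fun M = {f \<in> borel_measurable M. integrable M (\<lambda>x. (cmod (f x))\<^sup>2)}"

definition L2_class :: "'a measure \<Rightarrow> ('a \<Rightarrow> complex) \<Rightarrow> ('a \<Rightarrow> complex) set" where
  "L2_class M f = {g \<in> borel_measurable M. AE x in M. g x = f x}"

definition L2 :: "'a measure \<Rightarrow> ('a \<Rightarrow> complex) set set" where
  "L2 M = L2_class M ` L2_fun M"

definition L2_rep :: "('a \<Rightarrow> complex) set \<Rightarrow> 'a \<Rightarrow> complex" where
  "L2_rep u = (SOME f. f \<in> u)"

definition L2_add :: "'a measure \<Rightarrow> ('a \<Rightarrow> complex) set \<Rightarrow> ('a \<Rightarrow> complex) set \<Rightarrow> ('a \<Rightarrow> complex) set" where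
  "L2_add M u v = L2_class M (\<lambda>x. L2_rep u x + L2_rep v x)"

definition L2_scale :: "'a measure \<Rightarrow> complex \<Rightarrow> ('a \<Rightarrow> complex) set \<Rightarrow> ('a \<Rightarrow> complex) set" where
  "L2_scale M c u = L2_class M (\<lambda>x. c * L2_rep u x)"

definition L2_inner :: "'a measure \<Rightarrow> ('a \<Rightarrow> complex) set \<Rightarrow> ('a \<Rightarrow> complex) set \<Rightarrow> complex" where
  "L2_inner M u v = (LINT x|M. L2_rep u x * cnj (L2_rep v x))"

definition L2_norm :: "'a measure \<Rightarrow> ('a \<Rightarrow> complex) set \<Rightarrow> real" where
  "L2_norm M u = sqrt (Re (L2_inner M u u))"

text \<open>An operator is a partial map on classes; its domain is the library's \<^const>\<open>dom\<close>, and
  \<^const>\<open>map_comp\<close> is composition on the natural domain (all \<open>u\<close> in the domain of the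
  inner operator whose image lies in the domain of the outer one).\<close>

type_synonym 'a L2_op = "('a \<Rightarrow> complex) set \<rightharpoonup> ('a \<Rightarrow> complex) set"

definition L2_linear :: "'a measure \<Rightarrow> 'a L2_op \<Rightarrow> bool" where
  "L2_linear M T \<longleftrightarrow>
     dom T \<subseteq> L2 M \<and> ran T \<subseteq> L2 M \<and>
     (\<forall>u\<in>dom T. \<forall>v\<in>dom T. T (L2_add M u v) = Some (L2_add M (the (T u)) (the (T v)))) \<and>
     (\<forall>c. \<forall>u\<in>dom T. T (L2_scale M c u) = Some (L2_scale M c (the (T u))))"

definition L2_densely_defined :: "'a measure \<Rightarrow> 'a L2_op \<Rightarrow> bool" where
  "L2_densely_defined M T \<longleftrightarrow>
     (\<forall>u\<in>L2 M. \<forall>e>0. \<exists>v\<in>dom T. L2_norm M (L2_add M u (L2_scale M (-1) v)) < e)"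

text \<open>The adjoint is meaningful only for densely defined \<open>T\<close>, where \<open>w\<close> below is unique.\<close>

definition L2_adjoint :: "'a measure \<Rightarrow> 'a L2_op \<Rightarrow> 'a L2_op" where
  "L2_adjoint M T = (\<lambda>v.
     if v \<in> L2 M \<and> (\<exists>w\<in>L2 M. \<forall>u\<in>dom T. L2_inner M (the (T u)) v = L2_inner M u w)
     then Some (THE w. w \<in> L2 M \<and> (\<forall>u\<in>dom T. L2_inner M (the (T u)) v = L2_inner M u w))
     else None)"

definition L2_self_adjoint :: "'a measure \<Rightarrow> 'a L2_op \<Rightarrow> bool" where
  "L2_self_adjoint M T \<longleftrightarrow>
     L2_linear M T \<and> L2_densely_defined M T \<and> L2_adjoint M T = T"

definition L2_positive :: "'a measure \<Rightarrow> 'a L2_op \<Rightarrow> bool" where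
  "L2_positive M T \<longleftrightarrow>
     (\<forall>u\<in>dom T. L2_inner M (the (T u)) u \<in> \<real> \<and> 0 \<le> Re (L2_inner M (the (T u)) u))"

definition L2_sqrt :: "'a measure \<Rightarrow> 'a L2_op \<Rightarrow> 'a L2_op" where
  "L2_sqrt M A = (THE S. L2_self_adjoint M S \<and> L2_positive M S \<and> S \<circ>\<^sub>m S = A)"

definition AC :: "real \<Rightarrow> real \<Rightarrow> (real \<Rightarrow> complex) set" where
  "AC a b = {f. \<forall>e>0. \<exists>d>0. \<forall>(n::nat) l r.
     (\<forall>i<n. a \<le> l i \<and> l i \<le> r i \<and> r i \<le> b) \<and>
     disjoint_family_on (\<lambda>i. {l i<..<r i}) {..<n} \<and>
     (\<Sum>i<n. r i - l i) < d
     \<longrightarrow> (\<Sum>i<n. cmod (f (r i) - f (l i))) < e}"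

text \<open>Functions on \<open>[a,b]\<close> are total functions whose values outside \<open>[a,b]\<close> are ignored
  everywhere below. The derivative is one-sided at the endpoints; at points of
  non-differentiability its value is arbitrary, which for the derivative of an absolutely
  continuous function affects only a null set.\<close>

definition deriv_on :: "real \<Rightarrow> real \<Rightarrow> (real \<Rightarrow> complex) \<Rightarrow> real \<Rightarrow> complex" where
  "deriv_on a b f x = vector_derivative f (at x within {a..b})"

definition antiper_domain :: "real \<Rightarrow> real \<Rightarrow> (real \<Rightarrow> complex) set" where
  "antiper_domain a b = {f.
     f \<in> AC a b \<and>
     (\<forall>x\<in>{a..b}. f differentiable (at x within {a..b})) \<and>
     deriv_on a b f \<in> AC a b \<and>
     deriv_on a b (deriv_on a b f) \<in> L2_fun (lebesgue_on {a..b}) \<and>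
     f a = - f b \<and>
     deriv_on a b f a = - deriv_on a b f b}"

text \<open>A class contains at most one element of \<^const>\<open>antiper_domain\<close> up to values outside
  \<open>[a,b]\<close>, so the choice below is immaterial.\<close>

definition antiper_op :: "real \<Rightarrow> real \<Rightarrow> real \<Rightarrow> real L2_op" where
  "antiper_op a b k = (\<lambda>u.
     if u \<in> L2_class (lebesgue_on {a..b}) ` antiper_domain a b
     then (let f = (SOME f. f \<in> antiper_domain a b \<and> L2_class (lebesgue_on {a..b}) f = u)
           in Some (L2_class (lebesgue_on {a..b})
                (\<lambda>x. - deriv_on a b (deriv_on a b f) x + complex_of_real k * f x)))
     else None)"

end

theory Submission
  imports Defs
begin

text \<open>The antiperiodic exponentials with frequencies \<open>\<omega> = (2m+1) \<pi> / (b-a)\<close> form an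
  orthonormal basis of \<open>L\<^sup>2[a,b]\<close>. Integration by parts, whose boundary terms cancel by
  antiperiodicity, multiplies the coefficient of an absolutely continuous \<open>f\<close> by \<open>i \<omega>\<close> when \<open>f\<close> is
  replaced by \<open>f'\<close>; since \<open>\<omega> \<noteq> 0\<close>, a function whose coefficients are divided by \<open>i \<omega>\<close> is
  conversely recovered as an antiperiodic primitive. Hence the operator is diagonal with
  eigenvalues \<open>\<omega>\<^sup>2 + k\<close>. A positive self-adjoint square root commutes with it, positivity forces it
  to act on each basis vector as \<open>(\<omega>\<^sup>2 + k)\<^sup>1\<^sup>/\<^sup>2\<close>, and self-adjointness then determines it
  completely. Its domain is given by \<open>\<Sum> (\<omega>\<^sup>2 + k) |c|\<^sup>2 < \<infinity>\<close>, that is, by \<open>f' \<in> L\<^sup>2\<close>.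
  Absolutely continuous functions are indefinite integrals by Radon-Nikodym applied to their
  variation; indefinite integrals are differentiable almost everywhere by the Henstock lemma
  and the Vitali covering theorem.\<close>

section \<open>The Lebesgue differentiation theorem\<close>

text \<open>The square root is defined by \<open>THE\<close>, so exhibiting a candidate is not
  enough: uniqueness has to be shown among all positive self-adjoint \<open>S\<close>, whose domains
  are unknown beforehand. This becomes elementary because each basis vector lies in the domain of
  \<open>S\<close> composed with itself: if the eigenvalue there is the square of \<open>s\<close>,
  then \<open>S + s\<close> annihilates the vector \<open>S e - s e\<close>. Operators are compared
  through their graphs, written in coordinates, so that equality of domains comes along with
  equality of values. On the function side the obstacle is that \<open>AC\<close> is an
  epsilon-delta notion, the domains speak of pointwise derivatives, and coefficients see only
  integrals. Hence both directions of the fundamental theorem are required: an \<open>AC\<close>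
  function is the integral of its \<open>deriv_on\<close>, and a primitive of a square-integrable
  function is \<open>AC\<close> with that derivative almost everywhere. Passing to primitives also
  reduces completeness of the exponentials to continuous antiperiodic functions, for which uniform
  approximation suffices.\<close>

lemma negligible_of_thin_intervals:
  fixes E :: "real set"
  assumes B: "\<And>e. e > 0 \<Longrightarrow> \<exists>\<I>. (\<forall>(l,r)\<in>\<I>. l < r) \<and>
      (\<forall>x\<in>E. \<forall>d>0. \<exists>(l,r)\<in>\<I>. x \<in> {l..r} \<and> r - l < d) \<and>
      (\<forall>F. finite F \<and> F \<subseteq> \<I> \<and> pairwise (\<lambda>i j. disjnt {fst i..snd i} {fst j..snd j}) F
           \<longrightarrow> (\<Sum>i\<in>F. snd i - fst i) \<le> e)"
  shows "negligible E"
  unfolding negligible_outer_le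
proof (intro allI impI)
  fix e :: real assume "e > 0"
  obtain \<I> where I0: "\<forall>(l,r)\<in>\<I>. l < r"
    and cov0: "\<forall>x\<in>E. \<forall>d>0. \<exists>(l,r)\<in>\<I>. x \<in> {l..r} \<and> r - l < d"
    and bnd: "\<forall>F. finite F \<and> F \<subseteq> \<I> \<and> pairwise (\<lambda>i j. disjnt {fst i..snd i} {fst j..snd j}) F
           \<longrightarrow> (\<Sum>i\<in>F. snd i - fst i) \<le> e"
    using B[OF \<open>e > 0\<close>] by (elim exE conjE)
  have I: "fst i < snd i" if "i \<in> \<I>" for i
    using I0 that by (auto simp: case_prod_unfold)
  have cov: "\<exists>i\<in>\<I>. x \<in> {fst i..snd i} \<and> snd i - fst i < d" if "x \<in> E" "d > 0" for x d
    using cov0 that by (simp add: case_prod_unfold)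
  \<comment> \<open>Centre and half-length present each closed interval as a \<open>cball\<close>,
    the form in which the Vitali theorem is applied.\<close>
  define c where "c i = (fst i + snd i) / 2" for i :: "real \<times> real"
  define \<rho> where "\<rho> i = (snd i - fst i) / 2" for i :: "real \<times> real"
  have cb: "cball (c i) (\<rho> i) = {fst i..snd i}" for i
    by (auto simp: c_def \<rho>_def dist_real_def field_simps)
  obtain C where C: "countable C" "C \<subseteq> \<I>"
     "pairwise (\<lambda>i j. disjnt {fst i..snd i} {fst j..snd j}) C"
     "negligible(E - (\<Union>i \<in> C. {fst i..snd i}))"
  proof (rule Vitali_covering_theorem_cballs[of \<I> \<rho> E c, unfolded cb])
    show "0 < \<rho> i" if "i \<in> \<I>" for i using I[OF that] by (simp add: \<rho>_def)
    show "\<exists>i. i \<in> \<I> \<and> x \<in> {fst i..snd i} \<and> \<rho> i < d" if x: "x \<in> E" "0 < d" for x d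
    proof -
      obtain i where "i \<in> \<I>" "x \<in> {fst i..snd i}" "snd i - fst i < d"
        using cov[OF x] by blast
      then show ?thesis using I[of i] by (intro exI[of _ i]) (auto simp: \<rho>_def)
    qed
  qed blast
  let ?T = "\<Union>i \<in> C. {fst i..snd i}"
  \<comment> \<open>The hypothesis controls finite disjoint families only; a uniform bound on finite
    subunions passes to the countable union that Vitali produces.\<close>
  have fin: "measure lebesgue (\<Union>i \<in> F. {fst i..snd i}) \<le> e" if "finite F" "F \<subseteq> C" for F
  proof -
    have "measure lebesgue (\<Union>i \<in> F. {fst i..snd i}) \<le> (\<Sum>i\<in>F. measure lebesgue {fst i..snd i})"
      using that by (intro measure_UNION_le) auto
    also have "\<dots> = (\<Sum>i\<in>F. snd i - fst i)"
      using that C(2) I by (intro sum.cong) (auto simp: subset_iff less_imp_le)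
    also have "\<dots> \<le> e"
      using that C(2,3) by (intro bnd[rule_format] conjI) (auto intro: pairwise_subset)
    finally show ?thesis .
  qed
  have T: "?T \<in> lmeasurable" "measure lebesgue ?T \<le> e"
    using fmeasurable_UN_bound[OF C(1) _ fin] measure_UN_bound[OF C(1) _ fin] by simp_all
  let ?N = "E - ?T"
  show "\<exists>T. E \<subseteq> T \<and> T \<in> lmeasurable \<and> measure lebesgue T \<le> e"
  proof (intro exI conjI)
    show "E \<subseteq> ?T \<union> ?N" by blast
    have N: "?N \<in> lmeasurable" "measure lebesgue ?N = 0"
      using C(4) by (auto simp: negligible_iff_measure)
    then show "?T \<union> ?N \<in> lmeasurable" using T by (intro fmeasurable.Un)
    show "measure lebesgue (?T \<union> ?N) \<le> e"
      using measure_Un_le[OF fmeasurableD[OF T(1)] fmeasurableD[OF N(1)]] T(2) N(2) by linarith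
  qed
qed

text \<open>\<open>E e\<close> collects the points where difference quotients miss
  \<open>g x\<close> by more than \<open>e\<close> at arbitrarily small scales. Each such failure is
  an interval tagged at \<open>x\<close> whose Henstock error exceeds \<open>e\<close> times its
  length. Henstock bounds the total error of a disjoint family, hence its total length, and
  \<open>E e\<close> is negligible.\<close>

lemma indefinite_integral_has_vector_derivative_AE:
  fixes g :: "real \<Rightarrow> 'a::euclidean_space"
  assumes g: "g integrable_on {a..b}"
  obtains N where "negligible N"
    "\<And>x. x \<in> {a..b} - N \<Longrightarrow>
       ((\<lambda>u. integral {a..u} g) has_vector_derivative g x) (at x within {a..b})"
proof -
  define P where "P e x y \<longleftrightarrow> y \<in> {a..b} \<and>
      norm (integral {a..y} g - integral {a..x} g - (y - x) *\<^sub>R g x) > e * \<bar>y - x\<bar>" for e x y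
  define E where "E e = {x\<in>{a..b}. \<forall>d>0. \<exists>y. P e x y \<and> \<bar>y - x\<bar> < d}" for e
  have neg: "negligible (E e)" if e: "e > 0" for e
  proof (rule negligible_of_thin_intervals)
    fix h :: real assume "h > 0"
    \<comment> \<open>An error budget of \<open>h * e\<close> becomes the length bound
      \<open>h\<close> after division by \<open>e\<close>.\<close>
    then have "h * e > 0" using e by simp
    obtain \<gamma> where \<gamma>: "gauge \<gamma>"
      and H: "\<And>p. \<lbrakk>p tagged_partial_division_of {a..b}; \<gamma> fine p\<rbrakk> \<Longrightarrow>
             sum (\<lambda>(x,K). norm(measure lborel K *\<^sub>R g x - integral K g)) p < h * e"
      by (rule Henstock_lemma[of g a b "h * e", unfolded cbox_interval, OF g \<open>h * e > 0\<close>]) (rule that; blast)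
    define Q where "Q l r x \<longleftrightarrow> l < r \<and> x \<in> {l..r} \<and> {l..r} \<subseteq> {a..b} \<and> {l..r} \<subseteq> \<gamma> x \<and>
       norm(measure lborel {l..r} *\<^sub>R g x - integral {l..r} g) > e * (r - l)" for l r x
    define \<I> where "\<I> = {(l,r). \<exists>x. Q l r x}"
    have cov: "\<exists>(l,r)\<in>\<I>. x \<in> {l..r} \<and> r - l < d" if x: "x \<in> E e" and d: "d > 0" for x d
    proof -
      obtain \<delta> where \<delta>: "\<delta> > 0" "ball x \<delta> \<subseteq> \<gamma> x"
        using \<gamma> unfolding gauge_def by (meson openE)
      have "min d \<delta> > 0" using d \<delta>(1) by simp
      then obtain y where y: "P e x y" "\<bar>y - x\<bar> < min d \<delta>"
        using x unfolding E_def by blast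
      have xab: "x \<in> {a..b}" using x by (simp add: E_def)
      have "x \<noteq> y" using y by (auto simp: P_def)
      \<comment> \<open>The tag \<open>x\<close> may be either endpoint; taking min and max treats
        both signs of \<open>y - x\<close> at once.\<close>
      let ?l = "min x y" and ?r = "max x y"
      have comb: "integral {a..?r} g - integral {a..?l} g = integral {?l..?r} g"
        using y(1) xab Henstock_Kurzweil_Integration.integral_combine[of a ?l ?r g] integrable_subinterval_real[OF g, of a ?r]
        by (auto simp: P_def algebra_simps)
      have "norm(measure lborel {?l..?r} *\<^sub>R g x - integral {?l..?r} g) =
         norm (integral {a..y} g - integral {a..x} g - (y - x) *\<^sub>R g x)"
      proof (cases "x \<le> y")
        case True
        then show ?thesis using comb by (simp add: norm_minus_commute max_def min_def)
      next
        case False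
        then have "measure lborel {?l..?r} *\<^sub>R g x - integral {?l..?r} g
            = integral {a..y} g - integral {a..x} g - (y - x) *\<^sub>R g x"
          using comb by (simp add: max_def min_def algebra_simps)
        then show ?thesis by simp
      qed
      moreover have "{?l..?r} \<subseteq> \<gamma> x"
        using \<delta>(2) y(2) by (force simp: dist_real_def subset_iff)
      ultimately have "Q ?l ?r x"
        using y(1) xab \<open>x \<noteq> y\<close> unfolding Q_def P_def by (auto simp: abs_if max_def min_def)
      then have "(?l,?r) \<in> \<I>" "x \<in> {?l..?r}" "?r - ?l < d"
        using y(2) by (auto simp: \<I>_def)
      then show ?thesis by blast
    qed
    have bnd: "(\<Sum>i\<in>F. snd i - fst i) \<le> h" if F: "finite F" "F \<subseteq> \<I>"
        "pairwise (\<lambda>i j. disjnt {fst i..snd i} {fst j..snd j}) F" for F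
    proof -
      define t where "t i = (SOME x. Q (fst i) (snd i) x)" for i
      have Q: "Q (fst i) (snd i) (t i)" if "i \<in> F" for i
      proof -
        have "\<exists>x. Q (fst i) (snd i) x" using that F(2) by (force simp: \<I>_def)
        then show ?thesis unfolding t_def by (rule someI_ex)
      qed
      define p where "p = (\<lambda>i. (t i, {fst i..snd i})) ` F"
      \<comment> \<open>Disjoint intervals give distinct tagged pairs, so the Henstock sum over
        \<open>p\<close> can be rewritten as a sum over \<open>F\<close>.\<close>
      have inj: "inj_on (\<lambda>i. (t i, {fst i..snd i})) F"
      proof (rule inj_onI)
        fix i j assume ij: "i \<in> F" "j \<in> F" "(t i, {fst i..snd i}) = (t j, {fst j..snd j})"
        show "i = j"
        proof (rule ccontr)
          assume "i \<noteq> j"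
          then have "disjnt {fst i..snd i} {fst j..snd j}" using F(3) ij by (auto simp: pairwise_def)
          moreover have "t i \<in> {fst i..snd i}" using Q ij unfolding Q_def by blast
          ultimately show False using ij by (auto simp: disjnt_def)
        qed
      qed
      have "p tagged_partial_division_of {a..b}"
        unfolding tagged_partial_division_of_def
      proof (intro conjI allI impI)
        show "finite p" using F by (simp add: p_def)
        fix x K assume xK: "(x, K) \<in> p"
        then obtain i where i: "i \<in> F" "x = t i" "K = {fst i..snd i}" by (auto simp: p_def)
        show "x \<in> K" "K \<subseteq> {a..b}" "\<exists>a b. K = cbox a b"
          using Q[OF i(1)] i unfolding Q_def by auto
      next
        fix x K y L assume "(x, K) \<in> p \<and> (y, L) \<in> p \<and> (x, K) \<noteq> (y, L)"
        then have xK: "(x, K) \<in> p" and yL: "(y, L) \<in> p" and ne: "(x, K) \<noteq> (y, L)" by auto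
        from xK obtain i where i: "i \<in> F" "x = t i" "K = {fst i..snd i}" by (auto simp: p_def)
        from yL obtain j where j: "j \<in> F" "y = t j" "L = {fst j..snd j}" by (auto simp: p_def)
        then have "disjnt K L" using ne i F(3) by (auto simp: pairwise_def)
        then show "interior K \<inter> interior L = {}"
          using interior_subset by (fastforce simp: disjnt_def)
      qed
      moreover have "\<gamma> fine p" using Q by (auto simp: fine_def p_def Q_def)
      ultimately have "sum (\<lambda>(x,K). norm(measure lborel K *\<^sub>R g x - integral K g)) p < h * e" by (rule H)
      also have "sum (\<lambda>(x,K). norm(measure lborel K *\<^sub>R g x - integral K g)) p =
         (\<Sum>i\<in>F. norm (measure lborel {fst i..snd i} *\<^sub>R g (t i) - integral {fst i..snd i} g))"
        unfolding p_def by (subst sum.reindex[OF inj]) simp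
      finally have "(\<Sum>i\<in>F. norm (measure lborel {fst i..snd i} *\<^sub>R g (t i) - integral {fst i..snd i} g)) < h * e" .
      moreover have "(\<Sum>i\<in>F. e * (snd i - fst i)) \<le>
         (\<Sum>i\<in>F. norm (measure lborel {fst i..snd i} *\<^sub>R g (t i) - integral {fst i..snd i} g))"
        using Q unfolding Q_def by (intro sum_mono less_imp_le) blast
      ultimately have "(\<Sum>i\<in>F. snd i - fst i) * e < h * e" 
        by (simp add: sum_distrib_left mult.commute)
      then show ?thesis using e by simp
    qed
    show "\<exists>\<I>. (\<forall>(l,r)\<in>\<I>. l < r) \<and>
      (\<forall>x\<in>E e. \<forall>d>0. \<exists>(l,r)\<in>\<I>. x \<in> {l..r} \<and> r - l < d) \<and>
      (\<forall>F. finite F \<and> F \<subseteq> \<I> \<and> pairwise (\<lambda>i j. disjnt {fst i..snd i} {fst j..snd j}) F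
           \<longrightarrow> (\<Sum>i\<in>F. snd i - fst i) \<le> h)"
      using cov bnd by (intro exI[of _ \<I>]) (auto simp: \<I>_def Q_def)
  qed
  show thesis
  proof
    \<comment> \<open>Only the countably many tolerances 1/(n+1) are used, so the exceptional set
      stays negligible.\<close>
    show "negligible (\<Union>n. E (1 / real (Suc n)))"
      by (intro negligible_countable_Union) (auto simp: neg)
    fix x assume x: "x \<in> {a..b} - (\<Union>n. E (1 / real (Suc n)))"
    show "((\<lambda>u. integral {a..u} g) has_vector_derivative g x) (at x within {a..b})"
      unfolding has_vector_derivative_def has_derivative_within_alt
    proof (intro conjI allI impI)
      show "bounded_linear (\<lambda>h. h *\<^sub>R g x)" by (rule bounded_linear_scaleR_left)
      fix e :: real assume "e > 0"
      then obtain n where n: "1 / real (Suc n) < e" by (meson nat_approx_posE)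
      then obtain d where d: "d > 0" and nP: "\<And>y. \<bar>y - x\<bar> < d \<Longrightarrow> \<not> P (1 / real (Suc n)) x y"
        using x unfolding E_def by blast
      show "\<exists>d>0. \<forall>y\<in>{a..b}. norm (y - x) < d \<longrightarrow>
          norm (integral {a..y} g - integral {a..x} g - (y - x) *\<^sub>R g x) \<le> e * norm (y - x)"
      proof (intro exI[of _ d] conjI ballI impI d)
        fix y assume y: "y \<in> {a..b}" "norm (y - x) < d"
        then have "norm (integral {a..y} g - integral {a..x} g - (y - x) *\<^sub>R g x) \<le> 1 / real (Suc n) * \<bar>y - x\<bar>"
          using nP[of y] by (auto simp: P_def not_less)
        also have "\<dots> \<le> e * norm (y - x)" unfolding real_norm_def by (rule mult_right_mono) (use n in auto)
        finally show "norm (integral {a..y} g - integral {a..x} g - (y - x) *\<^sub>R g x) \<le> e * norm (y - x)" .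
      qed
    qed
  qed
qed

section \<open>Absolutely continuous functions\<close>

lemma sum_lengths_le_measure:
  fixes l r :: "'i \<Rightarrow> real"
  assumes "finite I" "\<And>i. i \<in> I \<Longrightarrow> l i \<le> r i"
    and disj: "disjoint_family_on (\<lambda>i. {l i<..<r i}) I"
    and sub: "\<And>i. i \<in> I \<Longrightarrow> {l i<..<r i} \<subseteq> T" and T: "T \<in> lmeasurable"
  shows "(\<Sum>i\<in>I. r i - l i) \<le> measure lebesgue T"
proof -
  have "(\<Sum>i\<in>I. r i - l i) = (\<Sum>i\<in>I. measure lebesgue {l i<..<r i})"
    using assms(2) by (intro sum.cong) auto
  also have "\<dots> = measure lebesgue (\<Union>i\<in>I. {l i<..<r i})"
    using assms(1) disj by (intro measure_finite_Union[symmetric]) (use assms(2) in auto)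
  also have "\<dots> \<le> measure lebesgue T"
    using sub T assms(1) by (intro measure_mono_fmeasurable) auto
  finally show ?thesis .
qed

text \<open>\<open>AC\<close> quantifies over families indexed by initial segments of the naturals.
  A bijection transfers it to any finite index set, as is needed later for families indexed by pairs
  and by the intervals themselves.\<close>

lemma AC_finite_family:
  assumes "f \<in> AC a b" "e > 0"
  obtains d where "d > 0"
    "\<And>(I::'i set) l r. finite I \<Longrightarrow> (\<And>i. i \<in> I \<Longrightarrow> a \<le> l i \<and> l i \<le> r i \<and> r i \<le> b) \<Longrightarrow>
       disjoint_family_on (\<lambda>i. {l i<..<r i}) I \<Longrightarrow> (\<Sum>i\<in>I. r i - l i) < d \<Longrightarrow>
       (\<Sum>i\<in>I. cmod (f (r i) - f (l i))) < e"
proof -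
  obtain d where d: "d > 0" and D0: "\<forall>(n::nat) l r.
     (\<forall>i<n. a \<le> l i \<and> l i \<le> r i \<and> r i \<le> b) \<and>
     disjoint_family_on (\<lambda>i. {l i<..<r i}) {..<n} \<and>
     (\<Sum>i<n. r i - l i) < d
     \<longrightarrow> (\<Sum>i<n. cmod (f (r i) - f (l i))) < e"
    using assms(1)[unfolded AC_def, THEN CollectD, THEN spec, THEN mp, OF assms(2)] by (elim exE conjE)
  have D: "(\<Sum>i<n. cmod (f (r i) - f (l i))) < e" if "\<forall>i<n. a \<le> l i \<and> l i \<le> r i \<and> r i \<le> b"
    "disjoint_family_on (\<lambda>i. {l i<..<r i}) {..<n}" "(\<Sum>i<n. r i - l i) < d" for n :: nat and l r
    using D0 that by simp
  show thesis
  proof (rule that[OF d])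
    fix I :: "'i set" and l r
    assume I: "finite I" "\<And>i. i \<in> I \<Longrightarrow> a \<le> l i \<and> l i \<le> r i \<and> r i \<le> b"
      and disj: "disjoint_family_on (\<lambda>i. {l i<..<r i}) I" and sm: "(\<Sum>i\<in>I. r i - l i) < d"
    obtain \<pi> where \<pi>: "bij_betw \<pi> {..<card I} I"
      using ex_bij_betw_nat_finite[OF I(1)] by (auto simp: atLeast0LessThan)
    have mem: "\<pi> i \<in> I" if "i < card I" for i using \<pi> that by (auto simp: bij_betw_def)
    have "(\<Sum>i<card I. cmod (f (r (\<pi> i)) - f (l (\<pi> i)))) < e"
    proof (rule D)
      show "\<forall>i<card I. a \<le> l (\<pi> i) \<and> l (\<pi> i) \<le> r (\<pi> i) \<and> r (\<pi> i) \<le> b"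
        using I(2) mem by blast
      show "disjoint_family_on (\<lambda>i. {l (\<pi> i)<..<r (\<pi> i)}) {..<card I}"
        unfolding disjoint_family_on_def
      proof (intro ballI impI)
        fix m n assume mn: "m \<in> {..<card I}" "n \<in> {..<card I}" "m \<noteq> n"
        then have "\<pi> m \<noteq> \<pi> n" using \<pi> by (auto simp: bij_betw_def inj_on_def)
        then show "{l (\<pi> m)<..<r (\<pi> m)} \<inter> {l (\<pi> n)<..<r (\<pi> n)} = {}"
          using disj mem mn unfolding disjoint_family_on_def by blast
      qed
      show "(\<Sum>i<card I. r (\<pi> i) - l (\<pi> i)) < d"
        using sm sum.reindex_bij_betw[OF \<pi>, of "\<lambda>i. r i - l i"] by simp
    qed
    then show "(\<Sum>i\<in>I. cmod (f (r i) - f (l i))) < e"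
      using sum.reindex_bij_betw[OF \<pi>, of "\<lambda>i. cmod (f (r i) - f (l i))"] by simp
  qed
qed

lemma AC_continuous_on:
  assumes "f \<in> AC a b"
  shows "continuous_on {a..b} f"
  unfolding continuous_on_iff
proof (intro ballI allI impI)
  fix x and e :: real assume x: "x \<in> {a..b}" and e: "e > 0"
  obtain d where d: "d > 0"
    "\<And>(I::nat set) l r. finite I \<Longrightarrow> (\<And>i. i \<in> I \<Longrightarrow> a \<le> l i \<and> l i \<le> r i \<and> r i \<le> b) \<Longrightarrow>
       disjoint_family_on (\<lambda>i. {l i<..<r i}) I \<Longrightarrow> (\<Sum>i\<in>I. r i - l i) < d \<Longrightarrow>
       (\<Sum>i\<in>I. cmod (f (r i) - f (l i))) < e"
    by (rule AC_finite_family[OF assms e]) blast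
  show "\<exists>d>0. \<forall>x'\<in>{a..b}. dist x' x < d \<longrightarrow> dist (f x') (f x) < e"
  proof (intro exI[of _ d] conjI ballI impI d(1))
    fix y assume y: "y \<in> {a..b}" "dist y x < d"
    have "(\<Sum>i\<in>{0::nat}. cmod (f (max x y) - f (min x y))) < e"
      using x y by (intro d(2)) (auto simp: dist_real_def disjoint_family_on_def)
    then show "dist (f y) (f x) < e"
      by (cases "x \<le> y") (auto simp: dist_norm max_def min_def norm_minus_commute)
  qed
qed

lemma AC_add:
  assumes f: "f \<in> AC a b" and g: "g \<in> AC a b"
  shows "(\<lambda>x. f x + g x) \<in> AC a b"
  unfolding AC_def
proof (intro CollectI allI impI)
  fix e :: real assume "e > 0"
  then have e2: "e / 2 > 0" by simp
  obtain d1 where d1: "d1 > 0"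
    "\<And>(I::nat set) l r. finite I \<Longrightarrow> (\<And>i. i \<in> I \<Longrightarrow> a \<le> l i \<and> l i \<le> r i \<and> r i \<le> b) \<Longrightarrow>
       disjoint_family_on (\<lambda>i. {l i<..<r i}) I \<Longrightarrow> (\<Sum>i\<in>I. r i - l i) < d1 \<Longrightarrow>
       (\<Sum>i\<in>I. cmod (f (r i) - f (l i))) < e / 2"
    by (rule AC_finite_family[OF f e2]) blast
  obtain d2 where d2: "d2 > 0"
    "\<And>(I::nat set) l r. finite I \<Longrightarrow> (\<And>i. i \<in> I \<Longrightarrow> a \<le> l i \<and> l i \<le> r i \<and> r i \<le> b) \<Longrightarrow>
       disjoint_family_on (\<lambda>i. {l i<..<r i}) I \<Longrightarrow> (\<Sum>i\<in>I. r i - l i) < d2 \<Longrightarrow>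
       (\<Sum>i\<in>I. cmod (g (r i) - g (l i))) < e / 2"
    by (rule AC_finite_family[OF g e2]) blast
  show "\<exists>d>0. \<forall>(n::nat) l r.
     (\<forall>i<n. a \<le> l i \<and> l i \<le> r i \<and> r i \<le> b) \<and>
     disjoint_family_on (\<lambda>i. {l i<..<r i}) {..<n} \<and>
     (\<Sum>i<n. r i - l i) < d
     \<longrightarrow> (\<Sum>i<n. cmod (f (r i) + g (r i) - (f (l i) + g (l i)))) < e"
  proof (intro exI[of _ "min d1 d2"] conjI allI impI)
    show "min d1 d2 > 0" using d1 d2 by simp
    fix n :: nat and l r
    assume A: "(\<forall>i<n. a \<le> l i \<and> l i \<le> r i \<and> r i \<le> b) \<and>
     disjoint_family_on (\<lambda>i. {l i<..<r i}) {..<n} \<and> (\<Sum>i<n. r i - l i) < min d1 d2"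
    have "(\<Sum>i<n. cmod (f (r i) + g (r i) - (f (l i) + g (l i))))
        \<le> (\<Sum>i<n. cmod (f (r i) - f (l i)) + cmod (g (r i) - g (l i)))"
    proof (intro sum_mono)
      fix i
      show "cmod (f (r i) + g (r i) - (f (l i) + g (l i))) \<le> cmod (f (r i) - f (l i)) + cmod (g (r i) - g (l i))"
        using norm_triangle_ineq[of "f (r i) - f (l i)" "g (r i) - g (l i)"] by (simp add: algebra_simps)
    qed
    also have "\<dots> < e"
      using d1(2)[of "{..<n}" l r] d2(2)[of "{..<n}" l r] A by (simp add: sum.distrib)
    finally show "(\<Sum>i<n. cmod (f (r i) + g (r i) - (f (l i) + g (l i)))) < e" .
  qed
qed

text \<open>A comparison criterion. The length term \<open>y - x\<close> absorbs Lipschitz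
  contributions, so one lemma covers products with Lipschitz functions, the exponentials and passage
  to a component of \<open>f\<close>.\<close>

lemma AC_dominated:
  assumes f: "f \<in> AC a b" and K: "K > 0"
    and le: "\<And>x y. a \<le> x \<Longrightarrow> x \<le> y \<Longrightarrow> y \<le> b \<Longrightarrow> cmod (g y - g x) \<le> K * (cmod (f y - f x) + (y - x))"
  shows "g \<in> AC a b"
  unfolding AC_def
proof (intro CollectI allI impI)
  fix e :: real assume "e > 0"
  then have e2: "e / (2 * K) > 0" using K by simp
  obtain d where d: "d > 0"
    "\<And>(I::nat set) l r. finite I \<Longrightarrow> (\<And>i. i \<in> I \<Longrightarrow> a \<le> l i \<and> l i \<le> r i \<and> r i \<le> b) \<Longrightarrow>
       disjoint_family_on (\<lambda>i. {l i<..<r i}) I \<Longrightarrow> (\<Sum>i\<in>I. r i - l i) < d \<Longrightarrow>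
       (\<Sum>i\<in>I. cmod (f (r i) - f (l i))) < e / (2 * K)"
    by (rule AC_finite_family[OF f e2]) blast
  show "\<exists>d>0. \<forall>(n::nat) l r.
     (\<forall>i<n. a \<le> l i \<and> l i \<le> r i \<and> r i \<le> b) \<and>
     disjoint_family_on (\<lambda>i. {l i<..<r i}) {..<n} \<and>
     (\<Sum>i<n. r i - l i) < d
     \<longrightarrow> (\<Sum>i<n. cmod (g (r i) - g (l i))) < e"
  \<comment> \<open>The total length enters the bound directly, so it too must stay below half of
    the budget \<open>e / K\<close>.\<close>
  proof (intro exI[of _ "min d (e / (2 * K))"] conjI allI impI)
    show "min d (e / (2 * K)) > 0" using d e2 by simp
    fix n :: nat and l r
    assume A: "(\<forall>i<n. a \<le> l i \<and> l i \<le> r i \<and> r i \<le> b) \<and>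
     disjoint_family_on (\<lambda>i. {l i<..<r i}) {..<n} \<and> (\<Sum>i<n. r i - l i) < min d (e / (2 * K))"
    have "(\<Sum>i<n. cmod (g (r i) - g (l i)))
        \<le> (\<Sum>i<n. K * (cmod (f (r i) - f (l i)) + (r i - l i)))"
      using A by (intro sum_mono le) auto
    also have "\<dots> = K * ((\<Sum>i<n. cmod (f (r i) - f (l i))) + (\<Sum>i<n. r i - l i))"
      by (simp add: sum_distrib_left sum.distrib distrib_left)
    also have "\<dots> < K * (e / (2 * K) + e / (2 * K))"
      using d(2)[of "{..<n}" l r] A K by (intro mult_strict_left_mono add_strict_mono) auto
    also have "\<dots> = e" using K by simp
    finally show "(\<Sum>i<n. cmod (g (r i) - g (l i))) < e" .
  qed
qed

section \<open>Total variation of absolutely continuous functions\<close>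

text \<open>Disjoint families replace partitions, to match the shape of \<open>AC\<close>. Gaps and
  degenerate intervals are allowed, so families can be cut, extended and merged freely.\<close>

definition variation_sums :: "(real \<Rightarrow> complex) \<Rightarrow> real \<Rightarrow> real \<Rightarrow> real set" where
  "variation_sums f x y = {s. \<exists>(n::nat) l r. s = (\<Sum>i<n. cmod (f (r i) - f (l i))) \<and>
     (\<forall>i<n. x \<le> l i \<and> l i \<le> r i \<and> r i \<le> y) \<and> disjoint_family_on (\<lambda>i. {l i<..<r i}) {..<n}}"

definition variation :: "(real \<Rightarrow> complex) \<Rightarrow> real \<Rightarrow> real \<Rightarrow> real" where
  "variation f x y = Sup (variation_sums f x y)"

lemma variation_sumsE:
  assumes "s \<in> variation_sums f x y"
  obtains n :: nat and l r where "s = (\<Sum>i<n. cmod (f (r i) - f (l i)))"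
    "\<forall>i<n. x \<le> l i \<and> l i \<le> r i \<and> r i \<le> y" "disjoint_family_on (\<lambda>i. {l i<..<r i}) {..<n}"
  using assms unfolding variation_sums_def by blast

lemma variation_sums_eq_0:
  assumes "s \<in> variation_sums f x y" "y \<le> x"
  shows "s = 0"
proof -
  obtain n l r where n: "s = (\<Sum>i<n::nat. cmod (f (r i) - f (l i)))"
     and lr: "\<forall>i<n. x \<le> l i \<and> l i \<le> r i \<and> r i \<le> y"
    using assms(1) by (rule variation_sumsE)
  have "l i = r i" if "i < n" for i using lr[rule_format, OF that] assms(2) by simp
  then show ?thesis unfolding n by (intro sum.neutral) auto
qed

lemma disjoint_family_on_smaller:
  "disjoint_family_on A I \<Longrightarrow> (\<And>i. i \<in> I \<Longrightarrow> B i \<subseteq> A i) \<Longrightarrow> disjoint_family_on B I"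
  unfolding disjoint_family_on_def by blast

lemma zero_in_variation_sums: "0 \<in> variation_sums f x y"
  unfolding variation_sums_def by (intro CollectI exI[of _ 0]) (auto simp: disjoint_family_on_def)

lemma variation_sums_split:
  assumes s: "s \<in> variation_sums f x z" and y: "x \<le> y" "y \<le> z"
  obtains s1 s2 where "s1 \<in> variation_sums f x y" "s2 \<in> variation_sums f y z" "s \<le> s1 + s2"
proof -
  obtain n l r where n: "s = (\<Sum>i<n::nat. cmod (f (r i) - f (l i)))"
     and lr: "\<forall>i<n. x \<le> l i \<and> l i \<le> r i \<and> r i \<le> z" and disj: "disjoint_family_on (\<lambda>i. {l i<..<r i}) {..<n}"
    using s by (rule variation_sumsE)
  \<comment> \<open>Each interval is clipped at \<open>y\<close> on both sides. An interval lying
    entirely on one side leaves a degenerate one on the other, which contributes zero.\<close>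
  let ?s1 = "\<Sum>i<n. cmod (f (min (r i) y) - f (min (l i) y))"
  let ?s2 = "\<Sum>i<n. cmod (f (max (r i) y) - f (max (l i) y))"
  have "?s1 \<in> variation_sums f x y"
    unfolding variation_sums_def
  proof (intro CollectI exI conjI)
    show "?s1 = (\<Sum>i<n. cmod (f (min (r i) y) - f (min (l i) y)))" ..
    show "\<forall>i<n. x \<le> min (l i) y \<and> min (l i) y \<le> min (r i) y \<and> min (r i) y \<le> y"
      using lr y by (fastforce simp: min_def)
    show "disjoint_family_on (\<lambda>i. {min (l i) y<..<min (r i) y}) {..<n}"
      by (rule disjoint_family_on_smaller[OF disj]) (auto simp: min_def max_def split: if_splits)
  qed
  moreover have "?s2 \<in> variation_sums f y z"
    unfolding variation_sums_def
  proof (intro CollectI exI conjI)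
    show "?s2 = (\<Sum>i<n. cmod (f (max (r i) y) - f (max (l i) y)))" ..
    show "\<forall>i<n. y \<le> max (l i) y \<and> max (l i) y \<le> max (r i) y \<and> max (r i) y \<le> z"
      using lr y by (fastforce simp: max_def)
    show "disjoint_family_on (\<lambda>i. {max (l i) y<..<max (r i) y}) {..<n}"
      by (rule disjoint_family_on_smaller[OF disj]) (auto simp: min_def max_def split: if_splits)
  qed
  moreover have "s \<le> ?s1 + ?s2"
    unfolding n sum.distrib[symmetric]
  proof (rule sum_mono)
    fix i
    have eq: "f (r i) - f (l i) = (f (min (r i) y) - f (min (l i) y)) + (f (max (r i) y) - f (max (l i) y))"
      by (simp add: min_def max_def)
    show "cmod (f (r i) - f (l i)) \<le> cmod (f (min (r i) y) - f (min (l i) y)) + cmod (f (max (r i) y) - f (max (l i) y))"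
      by (subst eq) (rule norm_triangle_ineq)
  qed
  ultimately show thesis by (rule that)
qed

text \<open>Absolute continuity with tolerance 1 bounds every sum over an interval shorter than
  \<open>d\<close> by 1, and finitely many such intervals cover the whole range.\<close>

lemma bdd_above_variation_sums:
  assumes f: "f \<in> AC a b" and xy: "a \<le> x" "y \<le> b"
  shows "bdd_above (variation_sums f x y)"
proof -
  obtain d where d: "d > 0"
    "\<And>(I::nat set) l r. finite I \<Longrightarrow> (\<And>i. i \<in> I \<Longrightarrow> a \<le> l i \<and> l i \<le> r i \<and> r i \<le> b) \<Longrightarrow>
       disjoint_family_on (\<lambda>i. {l i<..<r i}) I \<Longrightarrow> (\<Sum>i\<in>I. r i - l i) < d \<Longrightarrow>
       (\<Sum>i\<in>I. cmod (f (r i) - f (l i))) < 1"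
    by (rule AC_finite_family[OF f zero_less_one]) blast
  have small: "s \<le> 1" if "s \<in> variation_sums f u v" "a \<le> u" "v \<le> b" "v - u < d" for s u v
  proof (cases "u \<le> v")
    case True
    obtain n l r where n: "s = (\<Sum>i<n::nat. cmod (f (r i) - f (l i)))"
       and lr: "\<forall>i<n. u \<le> l i \<and> l i \<le> r i \<and> r i \<le> v" and disj: "disjoint_family_on (\<lambda>i. {l i<..<r i}) {..<n}"
      using \<open>s \<in> variation_sums f u v\<close> by (rule variation_sumsE)
    have "(\<Sum>i<n. r i - l i) \<le> measure lebesgue {u..v}"
      using lr disj by (intro sum_lengths_le_measure) auto
    then have "(\<Sum>i<n. r i - l i) < d" using that True by simp
    then have "s < 1" unfolding n using lr that disj by (intro d(2)) (auto intro: order_trans)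
    then show ?thesis by simp
  next
    case False
    then show ?thesis using variation_sums_eq_0[OF that(1)] by simp
  qed
  \<comment> \<open>Induction on the number of blocks of length \<open>d / 2\<close>; the halving
    keeps each block strictly shorter than \<open>d\<close>, and each adds at most 1.\<close>
  have bd: "s \<le> real m" if "s \<in> variation_sums f x v" "v \<le> b" "v \<le> x + real m * (d / 2)" "x \<le> v" for s v m
    using that
  proof (induction m arbitrary: s v)
    case 0
    then show ?case using variation_sums_eq_0[of s f x v] by simp
  next
    case (Suc m)
    show ?case
    proof (cases "v \<le> x + real m * (d / 2)")
      case True
      then show ?thesis using Suc.IH[OF Suc.prems(1,2) True] Suc.prems by simp
    next
      case False
      define w where "w = x + real m * (d / 2)"
      have "v - w \<le> d / 2" using Suc.prems(3) by (simp add: w_def algebra_simps add_divide_distrib)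
      then have w: "x \<le> w" "w \<le> v" "v - w < d" using False d(1) by (auto simp: w_def)
      obtain s1 s2 where s: "s1 \<in> variation_sums f x w" "s2 \<in> variation_sums f w v" "s \<le> s1 + s2"
        by (rule variation_sums_split[OF Suc.prems(1) w(1,2)])
      have "s1 \<le> real m" using Suc.IH[OF s(1)] w Suc.prems by (simp add: w_def)
      moreover have "s2 \<le> 1" using small[OF s(2)] w Suc.prems xy by simp
      ultimately show ?thesis using s(3) by simp
    qed
  qed
  show ?thesis
  proof (cases "x \<le> y")
    case True
    obtain m where "(y - x) / (d / 2) \<le> real m" using real_arch_simple by blast
    then have "y \<le> x + real m * (d / 2)" using d(1) by (simp add: field_simps)
    then show ?thesis using bd[of _ y m] True xy by (auto simp: bdd_above_def)
  next
    case False
    then have "s = 0" if "s \<in> variation_sums f x y" for s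
      using variation_sums_eq_0[OF that] by simp
    then show ?thesis by (auto simp: bdd_above_def)
  qed
qed

lemma variation_subadditive:
  assumes f: "f \<in> AC a b" and "a \<le> x" "x \<le> y" "y \<le> z" "z \<le> b"
  shows "variation f x z \<le> variation f x y + variation f y z"
  unfolding variation_def[of f x z]
proof (rule cSup_least)
  show "variation_sums f x z \<noteq> {}" using zero_in_variation_sums by blast
  fix s assume "s \<in> variation_sums f x z"
  then obtain s1 s2 where s: "s1 \<in> variation_sums f x y" "s2 \<in> variation_sums f y z" "s \<le> s1 + s2"
    by (rule variation_sums_split[OF _ assms(3,4)])
  have "s1 \<le> variation f x y" unfolding variation_def
    using s assms by (intro cSup_upper bdd_above_variation_sums[OF f]) auto
  moreover have "s2 \<le> variation f y z" unfolding variation_def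
    using s assms by (intro cSup_upper bdd_above_variation_sums[OF f]) auto
  ultimately show "s \<le> variation f x y + variation f y z" using s by simp
qed

text \<open>A family in \<open>[a,x]\<close> can be extended by the interval \<open>[x,y]\<close>.
  The inequality makes the variation nondecreasing, and also makes nondecreasing its sum with the
  real or imaginary part of \<open>f\<close>.\<close>

lemma increment_le_variation:
  assumes f: "f \<in> AC a b" and xy: "a \<le> x" "x \<le> y" "y \<le> b"
  shows "cmod (f y - f x) \<le> variation f a y - variation f a x"
proof -
  have "variation f a x \<le> variation f a y - cmod (f y - f x)"
    unfolding variation_def[of f a x]
  proof (rule cSup_least)
    show "variation_sums f a x \<noteq> {}" using zero_in_variation_sums by blast
    fix s assume "s \<in> variation_sums f a x"
    then obtain n l r where n: "s = (\<Sum>i<n::nat. cmod (f (r i) - f (l i)))"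
       and lr: "\<forall>i<n. a \<le> l i \<and> l i \<le> r i \<and> r i \<le> x" and disj: "disjoint_family_on (\<lambda>i. {l i<..<r i}) {..<n}"
      by (rule variation_sumsE)
    have "s + cmod (f y - f x) \<in> variation_sums f a y"
      unfolding variation_sums_def
    proof (intro CollectI exI conjI)
      \<comment> \<open>The additional interval occupies the free index \<open>n\<close>.\<close>
      let ?l = "l(n := x)" and ?r = "r(n := y)"
      show "s + cmod (f y - f x) = (\<Sum>i<Suc n. cmod (f (?r i) - f (?l i)))" by (simp add: n)
      show "\<forall>i<Suc n. a \<le> ?l i \<and> ?l i \<le> ?r i \<and> ?r i \<le> y"
        using lr xy by (force simp: less_Suc_eq)
      show "disjoint_family_on (\<lambda>i. {?l i<..<?r i}) {..<Suc n}"
        unfolding disjoint_family_on_def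
      proof (intro ballI impI)
        fix i j assume "i \<in> {..<Suc n}" "j \<in> {..<Suc n}" "i \<noteq> j"
        then consider "i < n" "j < n" | "i = n" "j < n" | "i < n" "j = n" by fastforce
        then show "{?l i<..<?r i} \<inter> {?l j<..<?r j} = {}"
        proof cases
          case 1 then show ?thesis using disj \<open>i \<noteq> j\<close> by (auto simp: disjoint_family_on_def)
        next
          case 2 then have "r j \<le> x" using lr by blast
          then show ?thesis using 2 by auto
        next
          case 3 then have "r i \<le> x" using lr by blast
          then show ?thesis using 3 by auto
        qed
      qed
    qed
    then have "s + cmod (f y - f x) \<le> variation f a y"
      unfolding variation_def using xy by (intro cSup_upper bdd_above_variation_sums[OF f]) auto
    then show "s \<le> variation f a y - cmod (f y - f x)" by simp
  qed
  then show ?thesis by simp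
qed

text \<open>Inside each interval a family nearly attaining its variation is selected. All of them
  together still form a disjoint family of no greater total length, so the \<open>d\<close>
  belonging to \<open>f\<close> also serves its variation.\<close>

lemma AC_variation:
  assumes f: "f \<in> AC a b"
  shows "(\<lambda>x. complex_of_real (variation f a x)) \<in> AC a b"
  unfolding AC_def
proof (intro CollectI allI impI)
  fix e :: real assume "e > 0"
  \<comment> \<open>Passing to suprema weakens the strict inequality, so half of \<open>e\<close> is
    held back.\<close>
  then have e2: "e / 2 > 0" by simp
  obtain d where d: "d > 0"
    "\<And>(I::(nat\<times>nat) set) l r. finite I \<Longrightarrow> (\<And>i. i \<in> I \<Longrightarrow> a \<le> l i \<and> l i \<le> r i \<and> r i \<le> b) \<Longrightarrow>
       disjoint_family_on (\<lambda>i. {l i<..<r i}) I \<Longrightarrow> (\<Sum>i\<in>I. r i - l i) < d \<Longrightarrow>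
       (\<Sum>i\<in>I. cmod (f (r i) - f (l i))) < e / 2"
    by (rule AC_finite_family[OF f e2]) blast
  show "\<exists>d>0. \<forall>(n::nat) l r.
     (\<forall>i<n. a \<le> l i \<and> l i \<le> r i \<and> r i \<le> b) \<and>
     disjoint_family_on (\<lambda>i. {l i<..<r i}) {..<n} \<and>
     (\<Sum>i<n. r i - l i) < d
     \<longrightarrow> (\<Sum>i<n. cmod (complex_of_real (variation f a (r i)) - complex_of_real (variation f a (l i)))) < e"
  proof (intro exI[of _ d] conjI allI impI d(1))
    fix n :: nat and l r
    assume A: "(\<forall>i<n. a \<le> l i \<and> l i \<le> r i \<and> r i \<le> b) \<and>
     disjoint_family_on (\<lambda>i. {l i<..<r i}) {..<n} \<and> (\<Sum>i<n. r i - l i) < d"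
    have V: "(\<Sum>i<n. variation f (l i) (r i)) \<le> e / 2"
    proof (rule field_le_epsilon)
      fix h :: real assume h: "h > 0"
      \<comment> \<open>The defect per interval; \<open>n\<close> of them cost at most
        \<open>h\<close>, and the denominator is positive also for \<open>n = 0\<close>.\<close>
      define \<eta> where "\<eta> = h / (real n + 1)"
      have \<eta>: "\<eta> > 0" "real n * \<eta> \<le> h" using h by (auto simp: \<eta>_def field_simps)
      define Q where "Q i m L R \<longleftrightarrow> variation f (l i) (r i) - \<eta> \<le> (\<Sum>j<m::nat. cmod (f (R j) - f (L j))) \<and>
         (\<forall>j<m. l i \<le> L j \<and> L j \<le> R j \<and> R j \<le> r i) \<and> disjoint_family_on (\<lambda>j. {L j<..<R j}) {..<m}"
         for i m L R
      have "\<exists>m L R. Q i m L R" for i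
      proof -
        have "\<exists>s\<in>variation_sums f (l i) (r i). variation f (l i) (r i) - \<eta> < s"
          unfolding variation_def using \<eta>(1) zero_in_variation_sums
          by (intro less_cSupD) auto
        then obtain s where s: "s \<in> variation_sums f (l i) (r i)" "variation f (l i) (r i) - \<eta> < s" by blast
        from s(1) obtain m L R where "s = (\<Sum>i<m::nat. cmod (f (R i) - f (L i)))"
           "\<forall>j<m. l i \<le> L j \<and> L j \<le> R j \<and> R j \<le> r i" "disjoint_family_on (\<lambda>i. {L i<..<R i}) {..<m}"
          by (rule variation_sumsE)
        then have "Q i m L R" using s(2) by (simp add: Q_def)
        then show ?thesis by blast
      qed
      then obtain m L R where mLR: "\<And>i. Q i (m i) (L i) (R i)" by metis
      have m1: "variation f (l i) (r i) - \<eta> \<le> (\<Sum>j<m i. cmod (f (R i j) - f (L i j)))" for i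
        using mLR[of i] unfolding Q_def by (elim conjE)
      have m2: "l i \<le> L i j \<and> L i j \<le> R i j \<and> R i j \<le> r i" if "j < m i" for i j
        using mLR[of i] that unfolding Q_def by blast
      have m3: "disjoint_family_on (\<lambda>j. {L i j<..<R i j}) {..<m i}" for i
        using mLR[of i] unfolding Q_def by (elim conjE)
      let ?I = "Sigma {..<n} (\<lambda>i. {..<m i})"
      have "(\<Sum>p\<in>?I. cmod (f (R (fst p) (snd p)) - f (L (fst p) (snd p)))) < e / 2"
      proof (rule d(2))
        show "finite ?I" by simp
        show "a \<le> L (fst p) (snd p) \<and> L (fst p) (snd p) \<le> R (fst p) (snd p) \<and> R (fst p) (snd p) \<le> b"
          if "p \<in> ?I" for p using that m2[of "snd p" "fst p"] A by fastforce
        show "disjoint_family_on (\<lambda>p. {L (fst p) (snd p)<..<R (fst p) (snd p)}) ?I"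
          unfolding disjoint_family_on_def
        proof (intro ballI impI)
          fix p q assume pq: "p \<in> ?I" "q \<in> ?I" "p \<noteq> q"
          show "{L (fst p) (snd p)<..<R (fst p) (snd p)} \<inter> {L (fst q) (snd q)<..<R (fst q) (snd q)} = {}"
          proof (cases "fst p = fst q")
            case True
            then have "snd p \<noteq> snd q" using pq by (metis prod_eqI)
            then show ?thesis using m3[of "fst q"] pq True by (auto simp: disjoint_family_on_def)
          next
            case False
            then have "{l (fst p)<..<r (fst p)} \<inter> {l (fst q)<..<r (fst q)} = {}"
              using A pq unfolding disjoint_family_on_def by (metis SigmaE2 prod.collapse)
            moreover have "{L (fst p) (snd p)<..<R (fst p) (snd p)} \<subseteq> {l (fst p)<..<r (fst p)}"
              using m2[of "snd p" "fst p"] pq by auto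
            moreover have "{L (fst q) (snd q)<..<R (fst q) (snd q)} \<subseteq> {l (fst q)<..<r (fst q)}"
              using m2[of "snd q" "fst q"] pq by auto
            ultimately show ?thesis by blast
          qed
        qed
        have "(\<Sum>p\<in>?I. R (fst p) (snd p) - L (fst p) (snd p)) = (\<Sum>i<n. \<Sum>j<m i. R i j - L i j)"
          by (simp add: sum.Sigma case_prod_unfold)
        also have "\<dots> \<le> (\<Sum>i<n. measure lebesgue {l i..r i})"
        proof (rule sum_mono)
          fix i
          show "(\<Sum>j<m i. R i j - L i j) \<le> measure lebesgue {l i..r i}"
          proof (rule sum_lengths_le_measure)
            fix j assume "j \<in> {..<m i}"
            then show "L i j \<le> R i j" "{L i j<..<R i j} \<subseteq> {l i..r i}" using m2[of j i] by auto
          qed (use m3 in auto)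
        qed
        also have "\<dots> = (\<Sum>i<n. r i - l i)" using A by (intro sum.cong) auto
        also have "\<dots> < d" using A by blast
        finally show "(\<Sum>p\<in>?I. R (fst p) (snd p) - L (fst p) (snd p)) < d" .
      qed
      also have "(\<Sum>p\<in>?I. cmod (f (R (fst p) (snd p)) - f (L (fst p) (snd p)))) =
         (\<Sum>i<n. \<Sum>j<m i. cmod (f (R i j) - f (L i j)))"
        by (simp add: sum.Sigma case_prod_unfold)
      finally have "(\<Sum>i<n. \<Sum>j<m i. cmod (f (R i j) - f (L i j))) < e / 2" .
      moreover have "(\<Sum>i<n. variation f (l i) (r i) - \<eta>) \<le> (\<Sum>i<n. \<Sum>j<m i. cmod (f (R i j) - f (L i j)))"
        by (intro sum_mono m1)
      ultimately show "(\<Sum>i<n. variation f (l i) (r i)) \<le> e / 2 + h"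
        using \<eta>(2) by (simp add: sum_subtractf)
    qed
    have "(\<Sum>i<n. cmod (complex_of_real (variation f a (r i)) - complex_of_real (variation f a (l i))))
       \<le> (\<Sum>i<n. variation f (l i) (r i))"
    proof (rule sum_mono)
      fix i assume "i \<in> {..<n}"
      then have i: "a \<le> l i" "l i \<le> r i" "r i \<le> b" using A by auto
      have "0 \<le> variation f a (r i) - variation f a (l i)"
        using increment_le_variation[OF f i] norm_ge_zero order_trans by blast
      moreover have "variation f a (r i) \<le> variation f a (l i) + variation f (l i) (r i)"
        using i by (intro variation_subadditive[OF f]) auto
      ultimately show "cmod (complex_of_real (variation f a (r i)) - complex_of_real (variation f a (l i))) \<le> variation f (l i) (r i)"
        by (simp flip: of_real_diff)
    qed
    then show "(\<Sum>i<n. cmod (complex_of_real (variation f a (r i)) - complex_of_real (variation f a (l i)))) < e"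
      using V \<open>e > 0\<close> by linarith
  qed
qed

text \<open>Absolute continuity makes the Lebesgue-Stieltjes measure of \<open>G\<close> absolutely continuous with
  respect to Lebesgue measure, so Radon-Nikodym applies.\<close>

lemma AC_mono_has_density:
  fixes G :: "real \<Rightarrow> real"
  assumes AC: "(\<lambda>x. complex_of_real (G x)) \<in> AC a b" and ab: "a \<le> b"
    and mono: "\<And>x y. a \<le> x \<Longrightarrow> x \<le> y \<Longrightarrow> y \<le> b \<Longrightarrow> G x \<le> G y"
  obtains h where "\<And>x. x \<in> {a..b} \<Longrightarrow> (h has_integral (G x - G a)) {a..x}"
proof -
  \<comment> \<open>\<open>G\<close> is frozen outside \<open>[a,b]\<close>, so that it is monotone
    and continuous on the whole line, as the interval measure requires.\<close>
  define H where "H x = G (max a (min b x))" for x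
  have H_eq: "H x = G x" if "x \<in> {a..b}" for x using that by (simp add: H_def max_absorb2 min_absorb2)
  have H_mono: "H x \<le> H y" if "x \<le> y" for x y
    unfolding H_def using that ab by (intro mono) auto
  have cG: "continuous_on {a..b} G"
    using continuous_on_Re[OF AC_continuous_on[OF AC]] by simp
  have H_cont: "continuous_on UNIV H"
    unfolding H_def
  proof (rule continuous_on_compose2[OF cG])
    show "continuous_on UNIV (\<lambda>x. max a (min b x))" by (intro continuous_intros)
  qed (use ab in auto)
  define \<mu> where "\<mu> = interval_measure H"
  \<comment> \<open>Continuity excludes atoms, so a closed interval has exactly the increment as its
    mass.\<close>
  have Icc: "emeasure \<mu> {x..y} = ennreal (H y - H x)" if "x \<le> y" for x y
    unfolding \<mu>_def by (rule emeasure_interval_measure_Icc[OF that H_mono H_cont])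
  have sets_\<mu>: "sets \<mu> = sets borel" by (simp add: \<mu>_def)
  \<comment> \<open>Restriction to \<open>[a,b]\<close> confines the null-set argument to intervals
    on which absolute continuity is assumed.\<close>
  define \<nu> where "\<nu> = density \<mu> (indicator {a..b})"
  have \<nu>: "emeasure \<nu> A = emeasure \<mu> ({a..b} \<inter> A)" if "A \<in> sets borel" for A
    unfolding \<nu>_def using that by (intro emeasure_restricted) (auto simp: sets_\<mu>)
  have null: "emeasure \<mu> N = 0" if N: "N \<in> sets borel" "N \<subseteq> {a..b}" "emeasure lborel N = 0" for N
  proof -
    have le: "emeasure \<mu> N \<le> ennreal e" if "e > 0" for e
    proof -
      obtain d where d: "d > 0"
        "\<And>(I::real set set) l r. finite I \<Longrightarrow> (\<And>i. i \<in> I \<Longrightarrow> a \<le> l i \<and> l i \<le> r i \<and> r i \<le> b) \<Longrightarrow>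
           disjoint_family_on (\<lambda>i. {l i<..<r i}) I \<Longrightarrow> (\<Sum>i\<in>I. r i - l i) < d \<Longrightarrow>
           (\<Sum>i\<in>I. cmod (complex_of_real (G (r i)) - complex_of_real (G (l i)))) < e"
        by (rule AC_finite_family[OF AC \<open>e > 0\<close>]) blast
      have "N \<in> null_sets lebesgue" using N by (simp add: null_sets_def)
      then have N_leb: "N \<in> lmeasurable" "measure lebesgue N = 0"
        using negligible_iff_measure negligible_iff_null_sets by blast+
      have "d / 2 > 0" using d(1) by simp
      \<comment> \<open>Since \<open>N\<close> has measure zero, the slack \<open>d / 2\<close>
        bounds the whole length of a non-overlapping cover. The intervals serve as their own indices
        when absolute continuity is applied to finite subfamilies.\<close>
      obtain \<D> where \<D>: "countable \<D>"
        "\<And>K. K \<in> \<D> \<Longrightarrow> K \<subseteq> cbox a b \<and> K \<noteq> {} \<and> (\<exists>c d. K = cbox c d)"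
        "pairwise (\<lambda>A B. interior A \<inter> interior B = {}) \<D>"
        "N \<subseteq> \<Union>\<D>" "\<Union>\<D> \<in> lmeasurable" "measure lebesgue (\<Union>\<D>) \<le> measure lebesgue N + d / 2"
        by (rule measurable_outer_intervals_bounded[OF N_leb(1) _ \<open>d / 2 > 0\<close>, of a b]) (use N(2) in auto)
      have K: "Inf K \<le> Sup K" "K = {Inf K..Sup K}" "a \<le> Inf K" "Sup K \<le> b" if "K \<in> \<D>" for K
      proof -
        obtain c d where "K = {c..d}" "c \<le> d" using \<D>(2)[OF \<open>K \<in> \<D>\<close>] by auto
        then show "Inf K \<le> Sup K" "K = {Inf K..Sup K}" "a \<le> Inf K" "Sup K \<le> b"
          using \<D>(2)[OF \<open>K \<in> \<D>\<close>] by auto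
      qed
      have fm: "K \<in> fmeasurable \<mu>" "measure \<mu> K = H (Sup K) - H (Inf K)" if "K \<in> \<D>" for K
      proof -
        have "emeasure \<mu> K = ennreal (H (Sup K) - H (Inf K))"
          by (subst K(2)[OF that]) (rule Icc[OF K(1)[OF that]])
        moreover have "K \<in> sets \<mu>" by (subst K(2)[OF that]) (simp add: sets_\<mu>)
        ultimately show "K \<in> fmeasurable \<mu>" "measure \<mu> K = H (Sup K) - H (Inf K)"
          using H_mono[OF K(1)[OF that]] by (auto simp: fmeasurable_def measure_def)
      qed
      have fin: "measure \<mu> (\<Union>F) \<le> e" if F: "F \<subseteq> \<D>" "finite F" for F
      proof -
        have "measure \<mu> (\<Union>F) = measure \<mu> (\<Union>K\<in>F. K)" by simp
        also have "\<dots> \<le> (\<Sum>K\<in>F. measure \<mu> K)"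
          using F fm by (intro measure_UNION_le) (auto dest: fmeasurableD)
        also have "\<dots> = (\<Sum>K\<in>F. cmod (complex_of_real (G (Sup K)) - complex_of_real (G (Inf K))))"
        proof (rule sum.cong[OF refl])
          fix K assume "K \<in> F"
          then have k: "K \<in> \<D>" using F by blast
          have "measure \<mu> K = G (Sup K) - G (Inf K)"
            using fm(2)[OF k] K(1,3,4)[OF k] by (simp add: H_eq)
          moreover have "G (Inf K) \<le> G (Sup K)" using K(1,3,4)[OF k] by (intro mono)
          ultimately show "measure \<mu> K = cmod (complex_of_real (G (Sup K)) - complex_of_real (G (Inf K)))"
            by (simp flip: of_real_diff)
        qed
        also have "\<dots> < e"
        proof (rule d(2)[OF F(2)])
          show "a \<le> Inf K \<and> Inf K \<le> Sup K \<and> Sup K \<le> b" if "K \<in> F" for K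
            using K[of K] that F by blast
          have Ioo: "{Inf K<..<Sup K} = interior K" if "K \<in> F" for K
            by (subst (3) K(2)) (use that F in auto)
          show disj: "disjoint_family_on (\<lambda>K. {Inf K<..<Sup K}) F"
            unfolding disjoint_family_on_def
          proof (intro ballI impI)
            fix K L assume "K \<in> F" "L \<in> F" "K \<noteq> L"
            then show "{Inf K<..<Sup K} \<inter> {Inf L<..<Sup L} = {}"
              using \<D>(3) F Ioo by (auto simp: pairwise_def)
          qed
          have "(\<Sum>K\<in>F. Sup K - Inf K) \<le> measure lebesgue (\<Union>\<D>)"
          proof (rule sum_lengths_le_measure[OF F(2) _ disj _ \<D>(5)])
            show "Inf K \<le> Sup K" if "K \<in> F" for K using K[of K] that F by blast
            show "{Inf K<..<Sup K} \<subseteq> \<Union>\<D>" if "K \<in> F" for K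
              unfolding Ioo[OF that] using that F interior_subset[of K] by blast
          qed
          then show "(\<Sum>K\<in>F. Sup K - Inf K) < d" using \<D>(6) N_leb d(1) by simp
        qed
        finally show ?thesis by simp
      qed
      have U: "\<Union>\<D> \<in> fmeasurable \<mu>" "measure \<mu> (\<Union>\<D>) \<le> e"
        using fmeasurable_Union_bound[OF \<D>(1) fm(1) fin] measure_Union_bound[OF \<D>(1) fm(1) fin] by auto
      have "emeasure \<mu> N \<le> emeasure \<mu> (\<Union>\<D>)"
        using \<D>(4) U(1) by (intro emeasure_mono fmeasurableD)
      also have "\<dots> = ennreal (measure \<mu> (\<Union>\<D>))" by (rule emeasure_eq_measure2[OF U(1)])
      also have "\<dots> \<le> ennreal e" using U(2) by (rule ennreal_leI)
      finally show ?thesis .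
    qed
    have "emeasure \<mu> N \<le> 0"
      by (rule ennreal_le_epsilon) (use le in auto)
    then show ?thesis by simp
  qed
  have abs: "absolutely_continuous (lborel :: real measure) \<nu>"
    unfolding absolutely_continuous_def
  proof
    fix N assume "N \<in> null_sets (lborel :: real measure)"
    then have N: "N \<in> sets borel" "emeasure lborel N = 0" by (auto simp: null_sets_def)
    have "emeasure lborel ({a..b} \<inter> N) \<le> emeasure lborel N" using N by (intro emeasure_mono) auto
    then have "emeasure \<mu> ({a..b} \<inter> N) = 0" using N by (intro null) auto
    then show "N \<in> null_sets \<nu>" using N \<nu>[OF N(1)] by (auto simp: null_sets_def \<nu>_def sets_\<mu>)
  qed
  then obtain g where g: "g \<in> borel_measurable lborel" "density lborel g = \<nu>"
    using sigma_finite_measure.Radon_Nikodym[OF sigma_finite_lborel abs] by (auto simp: \<nu>_def sets_\<mu>)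
  have gm [measurable]: "g \<in> borel_measurable borel" using g(1) by simp
  have gint: "(\<integral>\<^sup>+t. g t * indicator {a..x} t \<partial>lborel) = ennreal (G x - G a)" if x: "x \<in> {a..b}" for x
  proof -
    have "(\<integral>\<^sup>+t. g t * indicator {a..x} t \<partial>lborel) = emeasure \<nu> {a..x}"
      unfolding g(2)[symmetric] by (simp add: emeasure_density)
    also have "\<dots> = emeasure \<mu> {a..x}" using x by (subst \<nu>) (auto intro!: arg_cong[of _ _ "emeasure \<mu>"])
    also have "\<dots> = ennreal (G x - G a)" using x Icc[of a x] H_eq[of x] H_eq[of a] by auto
    finally show ?thesis .
  qed
  \<comment> \<open>The density may be infinite, but only on a null set, so replacing it by
    \<open>enn2real\<close> does not alter the integrals.\<close>
  have fin: "AE t in lborel. g t * indicator {a..b} t \<noteq> \<infinity>"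
    using gint[of b] ab by (intro nn_integral_PInf_AE) auto
  show thesis
  proof (rule that)
    fix x assume x: "x \<in> {a..b}"
    have "((\<lambda>t. enn2real (g t) * indicator {a..x} t) has_integral (G x - G a)) UNIV"
    proof (rule nn_integral_has_integral)
      have "(\<integral>\<^sup>+t. ennreal (enn2real (g t) * indicator {a..x} t) \<partial>lborel) = (\<integral>\<^sup>+t. g t * indicator {a..x} t \<partial>lborel)"
      proof (rule nn_integral_cong_AE)
        show "AE t in lborel. ennreal (enn2real (g t) * indicator {a..x} t) = g t * indicator {a..x} t"
          using fin by eventually_elim (use x in \<open>auto simp: indicator_def top.not_eq_extremum\<close>)
      qed
      then show "(\<integral>\<^sup>+t. ennreal (enn2real (g t) * indicator {a..x} t) \<partial>lborel) = ennreal (G x - G a)"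
        using gint[OF x] by simp
      show "0 \<le> G x - G a" using mono[of a x] x by auto
    qed auto
    then show "((\<lambda>t. enn2real (g t)) has_integral (G x - G a)) {a..x}"
      by (subst has_integral_restrict_UNIV[symmetric]) (simp add: indicator_def of_bool_def if_distrib cong: if_cong)
  qed
qed

section \<open>The fundamental theorem for absolutely continuous functions\<close>

text \<open>Jordan decomposition: a real component \<open>p\<close> of \<open>f\<close> is the
  difference of the nondecreasing functions \<open>p + V\<close> and \<open>V\<close>, both
  absolutely continuous, so each has a density. The argument is run once for an abstract
  \<open>p\<close> and used for \<open>Re\<close> and \<open>Im\<close>.\<close>

lemma AC_eq_indefinite_integral:
  assumes f: "f \<in> AC a b" and ab: "a \<le> b"
  obtains h where "\<And>x. x \<in> {a..b} \<Longrightarrow> (h has_integral (f x - f a)) {a..x}"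
proof -
  define V where "V = variation f a"
  have V: "(\<lambda>x. complex_of_real (V x)) \<in> AC a b" unfolding V_def by (rule AC_variation[OF f])
  have inc: "cmod (f y - f x) \<le> V y - V x" if "a \<le> x" "x \<le> y" "y \<le> b" for x y
    unfolding V_def by (rule increment_le_variation[OF f that])
  have dens: "\<exists>h. \<forall>x\<in>{a..b}. (h has_integral (p (f x) - p (f a))) {a..x}"
    if p: "\<And>z w. p (z - w) = p z - p w" "\<And>z. \<bar>p z\<bar> \<le> cmod z" for p :: "complex \<Rightarrow> real"
  proof -
    have V0: "V x \<le> V y" if "a \<le> x" "x \<le> y" "y \<le> b" for x y
      using inc[OF that] norm_ge_zero[of "f y - f x"] by linarith
    obtain h1 where h1: "\<And>x. x \<in> {a..b} \<Longrightarrow> (h1 has_integral (V x - V a)) {a..x}"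
      using AC_mono_has_density[OF V ab V0] by blast
    have "(\<lambda>x. complex_of_real (p (f x))) \<in> AC a b"
    proof (rule AC_dominated[OF f zero_less_one])
      fix x y assume "a \<le> x" "x \<le> y" "y \<le> b"
      then show "cmod (complex_of_real (p (f y)) - complex_of_real (p (f x))) \<le> 1 * (cmod (f y - f x) + (y - x))"
        using p(2)[of "f y - f x"] by (simp add: p(1) flip: of_real_diff)
    qed
    from AC_add[OF this V] have ac: "(\<lambda>x. complex_of_real (p (f x) + V x)) \<in> AC a b" by simp
    have mono: "p (f x) + V x \<le> p (f y) + V y" if "a \<le> x" "x \<le> y" "y \<le> b" for x y
      using inc[OF that] p(2)[of "f y - f x"] by (simp add: p(1))
    obtain h2 where h2: "\<And>x. x \<in> {a..b} \<Longrightarrow> (h2 has_integral (p (f x) + V x - (p (f a) + V a))) {a..x}"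
      using AC_mono_has_density[OF ac ab mono] by blast
    have "((\<lambda>t. h2 t - h1 t) has_integral (p (f x) - p (f a))) {a..x}" if "x \<in> {a..b}" for x
      using has_integral_diff[OF h2[OF that] h1[OF that]] by (simp add: algebra_simps)
    then show ?thesis by blast
  qed
  obtain h1 where h1: "\<And>x. x \<in> {a..b} \<Longrightarrow> (h1 has_integral (Re (f x) - Re (f a))) {a..x}"
    using dens[of Re, OF minus_complex.sel(1) abs_Re_le_cmod] by blast
  obtain h2 where h2: "\<And>x. x \<in> {a..b} \<Longrightarrow> (h2 has_integral (Im (f x) - Im (f a))) {a..x}"
    using dens[of Im, OF minus_complex.sel(2) abs_Im_le_cmod] by blast
  show thesis
  proof (rule that)
    fix x assume x: "x \<in> {a..b}"
    have "((\<lambda>t. complex_of_real (h1 t) + \<i> * complex_of_real (h2 t)) has_integral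
        (complex_of_real (Re (f x) - Re (f a)) + \<i> * complex_of_real (Im (f x) - Im (f a)))) {a..x}"
      using h1[OF x] h2[OF x]
      by (intro has_integral_add has_integral_mult_right has_integral_of_real)
    also have "complex_of_real (Re (f x) - Re (f a)) + \<i> * complex_of_real (Im (f x) - Im (f a)) = f x - f a"
      by (simp add: complex_eq_iff)
    finally show "((\<lambda>t. complex_of_real (h1 t) + \<i> * complex_of_real (h2 t)) has_integral (f x - f a)) {a..x}" .
  qed
qed

text \<open>The density \<open>h\<close> is recovered almost everywhere as a derivative by Lebesgue
  differentiation. Hence \<open>deriv_on\<close> differs from \<open>h\<close> only on a null set,
  and its arbitrary values there do not affect the integral.\<close>

theorem AC_fundamental_theorem:
  assumes f: "f \<in> AC a b" and ab: "a < b"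
  obtains N where "negligible N"
    "\<And>x. x \<in> {a..b} - N \<Longrightarrow> (f has_vector_derivative deriv_on a b f x) (at x within {a..b})"
    "\<And>x. x \<in> {a..b} \<Longrightarrow> (deriv_on a b f has_integral (f x - f a)) {a..x}"
proof -
  obtain h where h: "\<And>x. x \<in> {a..b} \<Longrightarrow> (h has_integral (f x - f a)) {a..x}"
    using AC_eq_indefinite_integral[OF f less_imp_le[OF ab]] by blast
  have "h integrable_on {a..b}" using h[of b] ab by (auto intro: has_integral_integrable)
  then obtain N where N: "negligible N"
    "\<And>x. x \<in> {a..b} - N \<Longrightarrow>
       ((\<lambda>u. integral {a..u} h) has_vector_derivative h x) (at x within {a..b})"
    by (rule indefinite_integral_has_vector_derivative_AE) blast
  have der: "(f has_vector_derivative h x) (at x within {a..b})" if x: "x \<in> {a..b} - N" for x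
  proof (rule has_vector_derivative_transform)
    show "((\<lambda>u. f a + integral {a..u} h) has_vector_derivative h x) (at x within {a..b})"
      using has_vector_derivative_add[OF has_vector_derivative_const[of "f a"] N(2)[OF x]] by simp
    show "f u = f a + integral {a..u} h" if "u \<in> {a..b}" for u
      using integral_unique[OF h[OF that]] by simp
  qed (use x in auto)
  have deriv: "deriv_on a b f x = h x" if x: "x \<in> {a..b} - N" for x
    using vector_derivative_within_cbox[of a b x f "h x"] ab x der[OF x] by (simp add: deriv_on_def)
  show thesis
  proof (rule that[OF N(1)])
    fix x assume "x \<in> {a..b} - N"
    then show "(f has_vector_derivative deriv_on a b f x) (at x within {a..b})"
      using der deriv by simp
  next
    fix x assume x: "x \<in> {a..b}"
    show "(deriv_on a b f has_integral (f x - f a)) {a..x}"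
      by (rule has_integral_spike[OF N(1) _ h[OF x]]) (use deriv x in auto)
  qed
qed

lemma AC_mult_lipschitz:
  assumes f: "f \<in> AC a b" and B: "B \<ge> 0"
    and bd: "\<And>x. cmod (\<phi> x) \<le> B" and lip: "\<And>x y. x \<le> y \<Longrightarrow> cmod (\<phi> y - \<phi> x) \<le> B * (y - x)"
  shows "(\<lambda>x. f x * \<phi> x) \<in> AC a b"
proof -
  have "bounded (f ` {a..b})"
    by (intro compact_imp_bounded compact_continuous_image AC_continuous_on[OF f]) auto
  then obtain C where C: "C > 0" "\<And>x. x \<in> {a..b} \<Longrightarrow> cmod (f x) \<le> C" by (auto simp: bounded_pos)
  show ?thesis
  \<comment> \<open>The product rule for increments costs \<open>B\<close> on the increment of
    \<open>f\<close> and \<open>C * B\<close> on the length; the sum dominates both, and the extra 1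
    makes it positive.\<close>
  proof (rule AC_dominated[OF f, of "B + C * B + 1"])
    show "B + C * B + 1 > 0" using B C by (simp add: add_nonneg_pos)
    fix x y assume xy: "a \<le> x" "x \<le> y" "y \<le> b"
    have "cmod (f y * \<phi> y - f x * \<phi> x) = cmod ((f y - f x) * \<phi> y + f x * (\<phi> y - \<phi> x))"
      by (simp add: algebra_simps)
    also have "\<dots> \<le> cmod (f y - f x) * cmod (\<phi> y) + cmod (f x) * cmod (\<phi> y - \<phi> x)"
      by (rule order_trans[OF norm_triangle_ineq]) (simp add: norm_mult)
    also have "\<dots> \<le> cmod (f y - f x) * B + C * (B * (y - x))"
      using C(2)[of x] xy lip[OF xy(2)] bd[of y] C(1) by (intro add_mono mult_mono) auto
    also have "\<dots> \<le> (B + C * B + 1) * (cmod (f y - f x) + (y - x))"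
    proof -
      have "0 \<le> (C * B + 1) * cmod (f y - f x) + (B + 1) * (y - x)"
        using B C xy by (intro add_nonneg_nonneg mult_nonneg_nonneg) auto
      then show ?thesis by (simp add: algebra_simps)
    qed
    finally show "cmod (f y * \<phi> y - f x * \<phi> x) \<le> (B + C * B + 1) * (cmod (f y - f x) + (y - x))" .
  qed
qed

text \<open>The product is again absolutely continuous, so the fundamental theorem applies to it.
  Off the two exceptional null sets its derivative is given by the product rule.\<close>

lemma AC_integration_by_parts:
  assumes f: "f \<in> AC a b" and ab: "a < b" and B: "B \<ge> 0"
    and bd: "\<And>x. cmod (\<phi> x) \<le> B" and lip: "\<And>x y. x \<le> y \<Longrightarrow> cmod (\<phi> y - \<phi> x) \<le> B * (y - x)"
    and der: "\<And>x. (\<phi> has_vector_derivative \<phi>' x) (at x)"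
  shows "((\<lambda>x. deriv_on a b f x * \<phi> x + f x * \<phi>' x) has_integral (f b * \<phi> b - f a * \<phi> a)) {a..b}"
proof -
  have "(\<lambda>x. f x * \<phi> x) \<in> AC a b" by (rule AC_mult_lipschitz[OF f B bd lip])
  then obtain N where N: "negligible N"
    "\<And>x. x \<in> {a..b} - N \<Longrightarrow> ((\<lambda>x. f x * \<phi> x) has_vector_derivative deriv_on a b (\<lambda>x. f x * \<phi> x) x) (at x within {a..b})"
    "\<And>x. x \<in> {a..b} \<Longrightarrow> (deriv_on a b (\<lambda>x. f x * \<phi> x) has_integral (f x * \<phi> x - f a * \<phi> a)) {a..x}"
    by (rule AC_fundamental_theorem[OF _ ab]) blast
  obtain N' where N': "negligible N'"
    "\<And>x. x \<in> {a..b} - N' \<Longrightarrow> (f has_vector_derivative deriv_on a b f x) (at x within {a..b})"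
    by (rule AC_fundamental_theorem[OF f ab]) blast
  have "deriv_on a b (\<lambda>x. f x * \<phi> x) x = deriv_on a b f x * \<phi> x + f x * \<phi>' x" if x: "x \<in> {a..b} - (N \<union> N')" for x
  proof -
    have "((\<lambda>x. f x * \<phi> x) has_vector_derivative f x * \<phi>' x + deriv_on a b f x * \<phi> x) (at x within {a..b})"
      using x by (intro has_vector_derivative_mult[OF N'(2) has_vector_derivative_at_within[OF der]]) auto
    then show ?thesis
      using vector_derivative_within_cbox[of a b x "\<lambda>x. f x * \<phi> x"] ab x by (simp add: deriv_on_def add.commute)
  qed
  note eq = this
  have "negligible (N \<union> N')" using N N' by simp
  then show ?thesis
    by (rule has_integral_spike[OF _ _ N(3)[of b]]) (use eq ab in auto)
qed

lemma L2_fun_lebesgue_on_integrable: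
  assumes "g \<in> L2_fun (lebesgue_on {a..b::real})"
  shows "integrable (lebesgue_on {a..b}) g" "g integrable_on {a..b}" "(\<lambda>x. (cmod (g x))\<^sup>2) integrable_on {a..b}"
proof -
  have m: "g \<in> borel_measurable (lebesgue_on {a..b})" and i: "integrable (lebesgue_on {a..b}) (\<lambda>x. (cmod (g x))\<^sup>2)"
    using assms by (auto simp: L2_fun_def)
  show g: "integrable (lebesgue_on {a..b}) g"
  proof (rule Bochner_Integration.integrable_bound[OF _ m])
    show "integrable (lebesgue_on {a..b}) (\<lambda>x. 1 + (cmod (g x))\<^sup>2)"
      using i by (intro Bochner_Integration.integrable_add) (auto intro: finite_measure.integrable_const finite_measure_lebesgue_on)
    \<comment> \<open>On a set of finite measure this elementary bound turns square-integrability
      into integrability.\<close>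
    have "cmod z \<le> 1 + (cmod z)\<^sup>2" for z
      using sum_power2_ge_zero[of "cmod z - 1" 0] by (simp add: power2_eq_square algebra_simps) (smt (verit) norm_ge_zero)
    then show "AE x in lebesgue_on {a..b}. cmod (g x) \<le> norm (1 + (cmod (g x))\<^sup>2)"
      by (intro AE_I2) simp
  qed
  show "g integrable_on {a..b}"
    by (rule integrable_on_lebesgue_on[OF g]) auto
  show "(\<lambda>x. (cmod (g x))\<^sup>2) integrable_on {a..b}"
    by (rule integrable_on_lebesgue_on[OF i]) auto
qed

text \<open>Pointwise, \<open>|g|\<close> is at most \<open>t/2 |g|^2 + 1/(2t)\<close>. A small
  \<open>t\<close> controls the first term through the total energy \<open>W\<close>, and a total
  length below \<open>t * e\<close> controls the second. The free constant \<open>c\<close> is later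
  chosen to enforce antiperiodicity.\<close>

lemma AC_indefinite_integral_L2:
  assumes g: "g \<in> L2_fun (lebesgue_on {a..b})"
  shows "(\<lambda>x. c + integral {a..x} g) \<in> AC a b"
  unfolding AC_def
proof (intro CollectI allI impI)
  fix e :: real assume e: "e > 0"
  let ?w = "\<lambda>x. (cmod (g x))\<^sup>2"
  note int = L2_fun_lebesgue_on_integrable[OF g]
  define W where "W = integral {a..b} ?w"
  have W: "W \<ge> 0" unfolding W_def by (intro integral_nonneg int) auto
  \<comment> \<open>Dividing by \<open>W + 1\<close> rather than \<open>W\<close> covers the case
    \<open>W = 0\<close>.\<close>
  define t where "t = e / (2 * (W + 1))"
  have t: "t > 0" "t * W < e"
    using e W by (auto simp: t_def field_simps intro: add_nonneg_pos)
  show "\<exists>d>0. \<forall>(n::nat) l r.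
     (\<forall>i<n. a \<le> l i \<and> l i \<le> r i \<and> r i \<le> b) \<and>
     disjoint_family_on (\<lambda>i. {l i<..<r i}) {..<n} \<and>
     (\<Sum>i<n. r i - l i) < d
     \<longrightarrow> (\<Sum>i<n. cmod (c + integral {a..r i} g - (c + integral {a..l i} g))) < e"
  proof (intro exI[of _ "t * e"] conjI allI impI)
    show "t * e > 0" using t e by simp
    fix n :: nat and l r
    assume A: "(\<forall>i<n. a \<le> l i \<and> l i \<le> r i \<and> r i \<le> b) \<and>
     disjoint_family_on (\<lambda>i. {l i<..<r i}) {..<n} \<and> (\<Sum>i<n. r i - l i) < t * e"
    have sub: "{l i..r i} \<subseteq> {a..b}" if "i < n" for i using A that by auto
    have wi: "?w integrable_on {l i..r i}" if "i < n" for i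
      by (rule integrable_subinterval_real[OF int(3) sub[OF that]])
    have "(\<Sum>i<n. integral {l i..r i} ?w) \<le> W"
    proof (rule has_integral_subset_le)
      show "(?w has_integral (\<Sum>i<n. integral {l i..r i} ?w)) (\<Union>i<n. {l i<..<r i})"
      proof (rule has_integral_UN)
        show "(?w has_integral integral {l i..r i} ?w) {l i<..<r i}" if "i \<in> {..<n}" for i
          using integrable_integral[OF wi[of i]] that has_integral_Icc_iff_Ioo by auto
        show "pairwise (\<lambda>i i'. negligible ({l i<..<r i} \<inter> {l i'<..<r i'})) {..<n}"
          using A by (auto simp: pairwise_def disjoint_family_on_def)
      qed auto
      show "(?w has_integral W) {a..b}" unfolding W_def using int(3) by (rule integrable_integral)
      show "(\<Union>i<n. {l i<..<r i}) \<subseteq> {a..b}" using sub by fastforce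
    qed auto
    note W_le = this
    have each: "cmod (c + integral {a..r i} g - (c + integral {a..l i} g))
        \<le> t / 2 * integral {l i..r i} ?w + (r i - l i) / (2 * t)" if i: "i < n" for i
    proof -
      have li: "a \<le> l i" "l i \<le> r i" "r i \<le> b" using A i by auto
      have "integral {a..l i} g + integral {l i..r i} g = integral {a..r i} g"
        using li by (intro Henstock_Kurzweil_Integration.integral_combine integrable_subinterval_real[OF int(2)]) auto
      then have "c + integral {a..r i} g - (c + integral {a..l i} g) = integral {l i..r i} g"
        by (metis add_diff_cancel_left add_diff_cancel_left')
      then have "cmod (c + integral {a..r i} g - (c + integral {a..l i} g)) = cmod (integral {l i..r i} g)"
        by simp
      also have "\<dots> \<le> integral {l i..r i} (\<lambda>x. t / 2 * ?w x + 1 / (2 * t))"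
      proof (rule integral_norm_bound_integral)
        show "g integrable_on {l i..r i}" by (rule integrable_subinterval_real[OF int(2) sub[OF i]])
        show "(\<lambda>x. t / 2 * ?w x + 1 / (2 * t)) integrable_on {l i..r i}"
          by (intro integrable_add integrable_on_mult_right wi i) auto
        fix x
        \<comment> \<open>The weighted mean inequality, written as a square over
          \<open>2 * t\<close>.\<close>
        have "0 \<le> (t * cmod (g x) - 1)\<^sup>2 / (2 * t)" using t by simp
        also have "\<dots> = t / 2 * ?w x + 1 / (2 * t) - cmod (g x)"
          using t by (simp add: field_simps power2_eq_square)
        finally show "cmod (g x) \<le> t / 2 * ?w x + 1 / (2 * t)" by simp
      qed
      also have "\<dots> = t / 2 * integral {l i..r i} ?w + (r i - l i) / (2 * t)"
        using li by (subst integral_add) (auto intro!: integrable_on_mult_right wi i)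
      finally show ?thesis .
    qed
    have "(\<Sum>i<n. cmod (c + integral {a..r i} g - (c + integral {a..l i} g)))
      \<le> (\<Sum>i<n. t / 2 * integral {l i..r i} ?w + (r i - l i) / (2 * t))"
      by (intro sum_mono each) auto
    also have "\<dots> = t / 2 * (\<Sum>i<n. integral {l i..r i} ?w) + (\<Sum>i<n. r i - l i) / (2 * t)"
      by (simp add: sum.distrib sum_distrib_left sum_divide_distrib)
    also have "\<dots> \<le> t / 2 * W + (\<Sum>i<n. r i - l i) / (2 * t)"
      using W_le t by simp
    also have "\<dots> < e / 2 + e / 2"
    proof (rule add_strict_mono)
      show "t / 2 * W < e / 2" using t by simp
      have "(\<Sum>i<n. r i - l i) < t * e" using A by blast
      then show "(\<Sum>i<n. r i - l i) / (2 * t) < e / 2" using t by (simp add: field_simps)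
    qed
    finally show "(\<Sum>i<n. cmod (c + integral {a..r i} g - (c + integral {a..l i} g))) < e" by simp
  qed
qed

section \<open>Square-integrable functions and orthonormal bases\<close>

text \<open>\<open>L2_inner\<close> of two classes is this form on their chosen representatives;
  working with functions postpones the choice.\<close>

definition L2_ip :: "'a measure \<Rightarrow> ('a \<Rightarrow> complex) \<Rightarrow> ('a \<Rightarrow> complex) \<Rightarrow> complex" where
  "L2_ip M f g = (LINT x|M. f x * cnj (g x))"

definition L2_sqnorm :: "'a measure \<Rightarrow> ('a \<Rightarrow> complex) \<Rightarrow> real" where
  "L2_sqnorm M f = (LINT x|M. (cmod (f x))\<^sup>2)"

lemma L2_funD [dest]:
  "f \<in> L2_fun M \<Longrightarrow> f \<in> borel_measurable M"
  "f \<in> L2_fun M \<Longrightarrow> integrable M (\<lambda>x. (cmod (f x))\<^sup>2)"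
  by (auto simp: L2_fun_def)

lemma cmod_add_square_le: "(cmod (z + w))\<^sup>2 \<le> 2 * (cmod z)\<^sup>2 + 2 * (cmod w)\<^sup>2"
proof -
  have "(cmod (z + w))\<^sup>2 \<le> (cmod z + cmod w)\<^sup>2" by (intro power_mono norm_triangle_ineq) auto
  also have "\<dots> \<le> 2 * (cmod z)\<^sup>2 + 2 * (cmod w)\<^sup>2"
    using zero_le_power2[of "cmod z - cmod w"] by (simp add: power2_eq_square algebra_simps)
  finally show ?thesis .
qed

lemma L2_fun_bounded:
  assumes "f \<in> borel_measurable M" "integrable M w" "AE x in M. (cmod (f x))\<^sup>2 \<le> w x"
  shows "f \<in> L2_fun M"
proof -
  have "integrable M (\<lambda>x. (cmod (f x))\<^sup>2)"
  proof (rule Bochner_Integration.integrable_bound[OF assms(2)])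
    show "(\<lambda>x. (cmod (f x))\<^sup>2) \<in> borel_measurable M" using assms(1) by measurable
    show "AE x in M. norm ((cmod (f x))\<^sup>2) \<le> norm (w x)" using assms(3) by eventually_elim auto
  qed
  then show ?thesis using assms(1) by (simp add: L2_fun_def)
qed

lemma L2_fun_AE_cong:
  assumes "f \<in> L2_fun M" "g \<in> borel_measurable M" "AE x in M. g x = f x"
  shows "g \<in> L2_fun M"
  using assms by (intro L2_fun_bounded[of _ _ "\<lambda>x. (cmod (f x))\<^sup>2"]) auto

lemma L2_fun_add [intro]:
  assumes "f \<in> L2_fun M" "g \<in> L2_fun M" shows "(\<lambda>x. f x + g x) \<in> L2_fun M"
proof (rule L2_fun_bounded)
  show "(\<lambda>x. f x + g x) \<in> borel_measurable M"
    using L2_funD(1)[OF assms(1)] L2_funD(1)[OF assms(2)] by measurable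
  show "integrable M (\<lambda>x. 2 * (cmod (f x))\<^sup>2 + 2 * (cmod (g x))\<^sup>2)"
    using L2_funD(2)[OF assms(1)] L2_funD(2)[OF assms(2)] by auto
qed (auto simp: cmod_add_square_le)

lemma L2_fun_scale [intro]:
  assumes "f \<in> L2_fun M" shows "(\<lambda>x. c * f x) \<in> L2_fun M"
proof (rule L2_fun_bounded)
  show "(\<lambda>x. c * f x) \<in> borel_measurable M" using L2_funD(1)[OF assms] by measurable
  show "integrable M (\<lambda>x. (cmod c)\<^sup>2 * (cmod (f x))\<^sup>2)" using L2_funD(2)[OF assms] by auto
qed (auto simp: norm_mult power_mult_distrib)

lemma L2_fun_zero [intro]: "(\<lambda>x. 0) \<in> L2_fun M"
  by (simp add: L2_fun_def)

lemma L2_fun_diff [intro]: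
  assumes "f \<in> L2_fun M" "g \<in> L2_fun M" shows "(\<lambda>x. f x - g x) \<in> L2_fun M"
  using L2_fun_add[OF assms(1) L2_fun_scale[OF assms(2), of "-1"]] by simp

lemma L2_fun_sum [intro]:
  "finite I \<Longrightarrow> (\<And>i. i \<in> I \<Longrightarrow> f i \<in> L2_fun M) \<Longrightarrow> (\<lambda>x. \<Sum>i\<in>I. f i x) \<in> L2_fun M"
  by (induction I rule: finite_induct) auto

lemma integrable_L2_ip:
  assumes "f \<in> L2_fun M" "g \<in> L2_fun M"
  shows "integrable M (\<lambda>x. f x * cnj (g x))"
proof (rule Bochner_Integration.integrable_bound)
  show "integrable M (\<lambda>x. (cmod (f x))\<^sup>2 + (cmod (g x))\<^sup>2)"
    using L2_funD(2)[OF assms(1)] L2_funD(2)[OF assms(2)] by auto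
  show "(\<lambda>x. f x * cnj (g x)) \<in> borel_measurable M"
    using L2_funD(1)[OF assms(1)] L2_funD(1)[OF assms(2)] borel_measurable_continuous_onI[OF continuous_on_cnj[OF continuous_on_id]]
    by measurable
  have "s * t \<le> s\<^sup>2 + t\<^sup>2" if "s \<ge> 0" "t \<ge> 0" for s t :: real
    using sum_squares_bound[of s t] mult_nonneg_nonneg[OF that] by simp
  then show "AE x in M. norm (f x * cnj (g x)) \<le> norm ((cmod (f x))\<^sup>2 + (cmod (g x))\<^sup>2)"
    by (intro AE_I2) (simp add: norm_mult)
qed

lemma L2_ip_add_left:
  assumes "f \<in> L2_fun M" "g \<in> L2_fun M" "h \<in> L2_fun M"
  shows "L2_ip M (\<lambda>x. f x + g x) h = L2_ip M f h + L2_ip M g h"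
  using integrable_L2_ip[OF assms(1,3)] integrable_L2_ip[OF assms(2,3)]
  unfolding L2_ip_def by (simp add: distrib_right)

lemma L2_ip_diff_left:
  assumes "f \<in> L2_fun M" "g \<in> L2_fun M" "h \<in> L2_fun M"
  shows "L2_ip M (\<lambda>x. f x - g x) h = L2_ip M f h - L2_ip M g h"
  using integrable_L2_ip[OF assms(1,3)] integrable_L2_ip[OF assms(2,3)]
  unfolding L2_ip_def by (simp add: left_diff_distrib)

lemma L2_ip_scale_left: "L2_ip M (\<lambda>x. c * f x) h = c * L2_ip M f h"
  unfolding L2_ip_def by (simp add: mult.assoc)

lemma L2_ip_sum_left:
  assumes "finite I" "\<And>i. i \<in> I \<Longrightarrow> f i \<in> L2_fun M" "h \<in> L2_fun M"
  shows "L2_ip M (\<lambda>x. \<Sum>i\<in>I. f i x) h = (\<Sum>i\<in>I. L2_ip M (f i) h)"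
  using assms integrable_L2_ip[OF assms(2,3)] unfolding L2_ip_def
  by (simp add: sum_distrib_right)

lemma L2_ip_cnj: "L2_ip M g f = cnj (L2_ip M f g)"
  unfolding L2_ip_def Bochner_Integration.integral_cnj[symmetric] by (simp add: mult.commute)

lemma L2_ip_self: "L2_ip M f f = complex_of_real (L2_sqnorm M f)"
  unfolding L2_ip_def L2_sqnorm_def by (simp flip: complex_norm_square of_real_power)

lemma L2_ip_cong_AE:
  assumes "AE x in M. f x = f' x" "AE x in M. g x = g' x"
    "f \<in> borel_measurable M" "f' \<in> borel_measurable M" "g \<in> borel_measurable M" "g' \<in> borel_measurable M"
  shows "L2_ip M f g = L2_ip M f' g'"
  unfolding L2_ip_def
proof (rule integral_cong_AE)
  note [measurable] = assms(3-6) borel_measurable_continuous_onI[OF continuous_on_cnj[OF continuous_on_id]]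
  show "(\<lambda>x. f x * cnj (g x)) \<in> borel_measurable M" "(\<lambda>x. f' x * cnj (g' x)) \<in> borel_measurable M"
    by measurable
  show "AE x in M. f x * cnj (g x) = f' x * cnj (g' x)"
    using assms(1,2) by eventually_elim simp
qed

lemma L2_sqnorm_nonneg: "L2_sqnorm M f \<ge> 0"
  unfolding L2_sqnorm_def by simp

lemma L2_sqnorm_eq_0_iff:
  assumes "f \<in> L2_fun M"
  shows "L2_sqnorm M f = 0 \<longleftrightarrow> (AE x in M. f x = 0)"
  unfolding L2_sqnorm_def using integral_nonneg_eq_0_iff_AE[OF L2_funD(2)[OF assms]] by simp

lemma L2_sqnorm_diff_scale:
  assumes f: "f \<in> L2_fun M" and g: "g \<in> L2_fun M"
  shows "L2_sqnorm M (\<lambda>x. f x - c * g x) = L2_sqnorm M f - 2 * Re (cnj c * L2_ip M f g) + (cmod c)\<^sup>2 * L2_sqnorm M g"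
proof -
  have cg: "(\<lambda>x. c * g x) \<in> L2_fun M" using g by auto
  have d: "(\<lambda>x. f x - c * g x) \<in> L2_fun M" using f cg by auto
  let ?d = "\<lambda>x. f x - c * g x"
  have "L2_ip M ?d ?d = L2_ip M f ?d - c * L2_ip M g ?d"
    by (simp add: L2_ip_diff_left[OF f cg d] L2_ip_scale_left)
  also have "L2_ip M f ?d = complex_of_real (L2_sqnorm M f) - cnj c * L2_ip M f g"
    by (subst L2_ip_cnj) (simp add: L2_ip_diff_left[OF f cg f] L2_ip_scale_left L2_ip_self L2_ip_cnj[of M g f])
  also have "L2_ip M g ?d = cnj (L2_ip M f g) - cnj c * complex_of_real (L2_sqnorm M g)"
    by (subst L2_ip_cnj) (simp add: L2_ip_diff_left[OF f cg g] L2_ip_scale_left L2_ip_self)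
  finally have "complex_of_real (L2_sqnorm M ?d) = complex_of_real (L2_sqnorm M f) - cnj c * L2_ip M f g
      - c * cnj (L2_ip M f g) + (c * cnj c) * complex_of_real (L2_sqnorm M g)"
    by (simp add: L2_ip_self algebra_simps)
  then have "L2_sqnorm M ?d = Re (complex_of_real (L2_sqnorm M f) - cnj c * L2_ip M f g
      - c * cnj (L2_ip M f g) + (c * cnj c) * complex_of_real (L2_sqnorm M g))"
    by (metis Re_complex_of_real)
  then show ?thesis by (simp add: complex_mult_cnj cmod_power2)
qed

lemma L2_ip_Cauchy_Schwarz:
  assumes f: "f \<in> L2_fun M" and g: "g \<in> L2_fun M"
  shows "(cmod (L2_ip M f g))\<^sup>2 \<le> L2_sqnorm M f * L2_sqnorm M g"
proof (cases "L2_sqnorm M g = 0")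
  case True
  then have "AE x in M. g x = 0" using L2_sqnorm_eq_0_iff[OF g] by simp
  then have "L2_ip M f g = L2_ip M f (\<lambda>x. 0)"
    using f g by (intro L2_ip_cong_AE) auto
  then have "L2_ip M f g = 0" by (simp add: L2_ip_def)
  then show ?thesis using True by simp
next
  case False
  then have pos: "L2_sqnorm M g > 0" using L2_sqnorm_nonneg[of M g] by simp
  \<comment> \<open>The coefficient of the orthogonal projection of \<open>f\<close> onto
    \<open>g\<close>, which minimises the distance.\<close>
  define c where "c = L2_ip M f g / complex_of_real (L2_sqnorm M g)"
  have "0 \<le> L2_sqnorm M f - 2 * Re (cnj c * L2_ip M f g) + (cmod c)\<^sup>2 * L2_sqnorm M g"
    using L2_sqnorm_nonneg L2_sqnorm_diff_scale[OF f g, of c] by metis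
  also have "cnj c * L2_ip M f g = complex_of_real ((cmod (L2_ip M f g))\<^sup>2 / L2_sqnorm M g)"
    unfolding of_real_divide complex_norm_square by (simp add: c_def mult.commute)
  also have "(cmod c)\<^sup>2 * L2_sqnorm M g = (cmod (L2_ip M f g))\<^sup>2 / L2_sqnorm M g"
    using pos by (simp add: c_def norm_divide power_divide power2_eq_square)
  finally show ?thesis using pos by (simp add: field_simps)
qed

text \<open>The weight \<open>2 ^ k\<close> keeps the sum of squared increments integrable, while the
  Cauchy-Schwarz inequality turns it into a pointwise bound on the tails.\<close>

lemma L2_fast_Cauchy_converges:
  assumes F: "\<And>k. F k \<in> L2_fun M" and fast: "\<And>k. L2_sqnorm M (\<lambda>x. F (Suc k) x - F k x) \<le> (1/4)^k"
  obtains f where "f \<in> L2_fun M" "(\<lambda>k. L2_sqnorm M (\<lambda>x. F k x - f x)) \<longlonglongrightarrow> 0"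
proof -
  note [measurable] = L2_funD(1)[OF F]
  define d where "d k x = 2^k * (cmod (F (Suc k) x - F k x))\<^sup>2" for k x
  have d_int: "integrable M (d k)" for k
    unfolding d_def using L2_funD(2)[OF L2_fun_diff[OF F F]] by auto
  have d0: "d k x \<ge> 0" for k x by (simp add: d_def)
  have [measurable]: "d k \<in> borel_measurable M" for k using d_int by auto
  define We where "We x = (\<Sum>k. ennreal (d k x))" for x
  have [measurable]: "We \<in> borel_measurable M" unfolding We_def by measurable
  have "(\<integral>\<^sup>+x. We x \<partial>M) = (\<Sum>k. \<integral>\<^sup>+x. ennreal (d k x) \<partial>M)"
    unfolding We_def by (rule nn_integral_suminf) measurable
  also have "\<dots> \<le> (\<Sum>k. ennreal ((1/2)^k))"
  proof (intro suminf_le)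
    fix k
    have "(\<integral>\<^sup>+x. ennreal (d k x) \<partial>M) = ennreal (LINT x|M. d k x)"
      by (intro nn_integral_eq_integral d_int) (simp add: d0)
    also have "(LINT x|M. d k x) = 2^k * L2_sqnorm M (\<lambda>x. F (Suc k) x - F k x)"
      by (simp add: d_def L2_sqnorm_def)
    also have "\<dots> \<le> 2^k * (1/4)^k" using fast by (intro mult_left_mono) auto
    also have "\<dots> = (1/2::real)^k" by (simp flip: power_mult_distrib)
    finally show "(\<integral>\<^sup>+x. ennreal (d k x) \<partial>M) \<le> ennreal ((1/2)^k)" by (simp add: ennreal_leI)
  qed auto
  also have "\<dots> = ennreal (\<Sum>k. (1/2)^k)"
    by (intro suminf_ennreal2) (auto simp: summable_geometric)
  finally have We_fin: "(\<integral>\<^sup>+x. We x \<partial>M) < \<infinity>" 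
    by (metis ennreal_less_top infinity_ennreal_def order_le_less_trans)
  then have AE_fin: "AE x in M. We x \<noteq> \<infinity>"
    by (intro nn_integral_PInf_AE) auto
  define W where "W x = enn2real (We x)" for x
  have W_int: "integrable M W"
  proof (rule integrableI_bounded)
    show "W \<in> borel_measurable M" unfolding W_def by measurable
    have "(\<integral>\<^sup>+x. ennreal (norm (W x)) \<partial>M) \<le> (\<integral>\<^sup>+x. We x \<partial>M)"
      by (intro nn_integral_mono) (simp add: W_def enn2real_nonneg ennreal_enn2real_if)
    then show "(\<integral>\<^sup>+x. ennreal (norm (W x)) \<partial>M) < \<infinity>" using We_fin by simp
  qed
  have tail: "(cmod (F m x - F k x))\<^sup>2 \<le> 2 * (1/2)^k * W x" if x: "We x \<noteq> \<infinity>" and km: "k \<le> m" for x k m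
  proof -
    have sumW: "(\<Sum>j\<in>{k..<m}. d j x) \<le> W x"
    proof -
      have "ennreal (\<Sum>j\<in>{k..<m}. d j x) = (\<Sum>j\<in>{k..<m}. ennreal (d j x))"
        by (simp add: sum_ennreal d0)
      also have "\<dots> \<le> We x" unfolding We_def by (intro sum_le_suminf) auto
      also have "\<dots> = ennreal (W x)" using x by (simp add: W_def ennreal_enn2real_if)
      finally show ?thesis by (simp add: W_def)
    qed
    have "F m x - F k x = (\<Sum>j\<in>{k..<m}. F (Suc j) x - F j x)"
      using sum_Suc_diff'[OF km, of "\<lambda>j. F j x"] by simp
    then have "cmod (F m x - F k x) \<le> (\<Sum>j\<in>{k..<m}. cmod (F (Suc j) x - F j x))"
      by (simp add: sum_norm_le)
    \<comment> \<open>Each increment is split into a geometric weight and the weighted increment, to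
      which Cauchy-Schwarz for finite sums applies; the weights add up to at most
      \<open>2 * (1/2)^k\<close>.\<close>
    also have "\<dots> = (\<Sum>j\<in>{k..<m}. sqrt ((1/2)^j) * sqrt (d j x))"
      by (intro sum.cong) (auto simp: d_def real_sqrt_mult real_sqrt_divide power_divide simp flip: real_sqrt_power)
    finally have "(cmod (F m x - F k x))\<^sup>2 \<le> (\<Sum>j\<in>{k..<m}. sqrt ((1/2)^j) * sqrt (d j x))\<^sup>2"
      by (intro power_mono) auto
    also have "\<dots> \<le> (\<Sum>j\<in>{k..<m}. (sqrt ((1/2)^j))\<^sup>2) * (\<Sum>j\<in>{k..<m}. (sqrt (d j x))\<^sup>2)"
      by (rule Cauchy_Schwarz_ineq_sum)
    also have "\<dots> = (\<Sum>j\<in>{k..<m}. (1/2)^j) * (\<Sum>j\<in>{k..<m}. d j x)"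
      using d0 by simp
    also have "\<dots> \<le> (2 * (1/2)^k) * W x"
    proof (intro mult_mono sumW)
      have "(\<Sum>j\<in>{k..<m}. (1/2)^j) = 2 * (1/2)^k - 2 * (1/2::real)^m"
        using km by (induction m rule: dec_induct) simp_all
      then show "(\<Sum>j\<in>{k..<m}. (1/2::real)^j) \<le> 2 * (1/2)^k" by simp
    qed (auto intro: sum_nonneg d0)
    finally show ?thesis .
  qed
  \<comment> \<open>Where the sequence diverges \<open>lim\<close> is an arbitrary value; this can
    happen only where \<open>We\<close> is infinite, a null set.\<close>
  define f where "f x = lim (\<lambda>k. F k x)" for x
  have f_meas [measurable]: "f \<in> borel_measurable M"
    unfolding f_def by measurable
  have lim: "(\<lambda>m. F m x) \<longlonglongrightarrow> f x" if x: "We x \<noteq> \<infinity>" for x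
  proof -
    have z: "(\<lambda>k. sqrt (2 * (1/2)^k * W x)) \<longlonglongrightarrow> sqrt (2 * 0 * W x)"
      by (intro tendsto_intros LIMSEQ_power_zero) auto
    have "Cauchy (\<lambda>m. F m x)"
    proof (rule metric_CauchyI)
      fix e :: real assume "e > 0"
      then obtain k where k: "sqrt (2 * (1/2)^k * W x) < e / 2"
        using order_tendstoD(2)[OF z, of "e/2"] by (auto simp: eventually_sequentially)
      have near: "cmod (F m x - F k x) < e / 2" if "m \<ge> k" for m
        using tail[OF x that] k real_le_rsqrt by (meson le_less_trans)
      show "\<exists>K. \<forall>m\<ge>K. \<forall>n\<ge>K. dist (F m x) (F n x) < e"
      proof (intro exI[of _ k] allI impI)
        fix m n assume "m \<ge> k" "n \<ge> k"
        then show "dist (F m x) (F n x) < e"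
          by (rule dist_triangle_half_l[of _ "F k x", unfolded dist_norm[of _ "F k x"], OF near near])
      qed
    qed
    then show ?thesis unfolding f_def by (simp add: Cauchy_convergent_iff convergent_LIMSEQ_iff)
  qed
  \<comment> \<open>The tail bound is uniform in \<open>m\<close>, so it survives the limit and
    supplies one integrable majorant for all \<open>k\<close>.\<close>
  have bound: "(cmod (F k x - f x))\<^sup>2 \<le> 2 * (1/2)^k * W x" if x: "We x \<noteq> \<infinity>" for x k
  proof (rule tendsto_upperbound)
    show "(\<lambda>m. (cmod (F k x - F m x))\<^sup>2) \<longlonglongrightarrow> (cmod (F k x - f x))\<^sup>2"
      by (intro tendsto_intros lim x)
    show "\<forall>\<^sub>F m in sequentially. (cmod (F k x - F m x))\<^sup>2 \<le> 2 * (1/2)^k * W x"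
      using eventually_ge_at_top[of k]
      by eventually_elim (subst norm_minus_commute, rule tail[OF x])
  qed simp
  have AEb: "AE x in M. (cmod (F k x - f x))\<^sup>2 \<le> 2 * (1/2)^k * W x" for k
    using AE_fin by eventually_elim (rule bound)
  have dL2: "(\<lambda>x. F k x - f x) \<in> L2_fun M" for k
    using W_int by (intro L2_fun_bounded[OF _ _ AEb]) auto
  show thesis
  proof (rule that)
    show "f \<in> L2_fun M" using L2_fun_diff[OF F[of 0] dL2[of 0]] by simp
    show "(\<lambda>k. L2_sqnorm M (\<lambda>x. F k x - f x)) \<longlonglongrightarrow> 0"
    proof (rule tendsto_sandwich)
      show "\<forall>\<^sub>F k in sequentially. 0 \<le> L2_sqnorm M (\<lambda>x. F k x - f x)" by (simp add: L2_sqnorm_nonneg)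
      show "\<forall>\<^sub>F k in sequentially. L2_sqnorm M (\<lambda>x. F k x - f x) \<le> (LINT x|M. 2 * (1/2)^k * W x)"
        unfolding L2_sqnorm_def using W_int by (intro always_eventually allI integral_mono_AE AEb L2_funD(2)[OF dL2]) auto
      have "(\<lambda>k. 2 * (1/2)^k * (LINT x|M. W x)) \<longlonglongrightarrow> 2 * 0 * (LINT x|M. W x)"
        by (intro tendsto_intros LIMSEQ_power_zero) auto
      then show "(\<lambda>k. LINT x|M. 2 * (1/2)^k * W x) \<longlonglongrightarrow> 0" by simp
    qed auto
  qed
qed

lemma L2_ip_tendsto:
  assumes F: "\<And>k. F k \<in> L2_fun M" and f: "f \<in> L2_fun M" and g: "g \<in> L2_fun M"
    and lim: "(\<lambda>k. L2_sqnorm M (\<lambda>x. F k x - f x)) \<longlonglongrightarrow> 0"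
  shows "(\<lambda>k. L2_ip M (F k) g) \<longlonglongrightarrow> L2_ip M f g"
proof -
  have "(\<lambda>k. (cmod (L2_ip M (F k) g - L2_ip M f g))\<^sup>2) \<longlonglongrightarrow> 0"
  proof (rule tendsto_sandwich)
    show "\<forall>\<^sub>F k in sequentially. 0 \<le> (cmod (L2_ip M (F k) g - L2_ip M f g))\<^sup>2" by simp
    show "\<forall>\<^sub>F k in sequentially. (cmod (L2_ip M (F k) g - L2_ip M f g))\<^sup>2 \<le> L2_sqnorm M (\<lambda>x. F k x - f x) * L2_sqnorm M g"
    proof (intro always_eventually allI)
      fix k
      show "(cmod (L2_ip M (F k) g - L2_ip M f g))\<^sup>2 \<le> L2_sqnorm M (\<lambda>x. F k x - f x) * L2_sqnorm M g"
        unfolding L2_ip_diff_left[OF F f g, symmetric]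
        by (intro L2_ip_Cauchy_Schwarz L2_fun_diff F f g)
    qed
    show "(\<lambda>k. L2_sqnorm M (\<lambda>x. F k x - f x) * L2_sqnorm M g) \<longlonglongrightarrow> 0"
      using tendsto_mult_right[OF lim, of "L2_sqnorm M g"] by simp
  qed auto
  then have "(\<lambda>k. sqrt ((cmod (L2_ip M (F k) g - L2_ip M f g))\<^sup>2)) \<longlonglongrightarrow> sqrt 0"
    by (rule tendsto_real_sqrt)
  then have "(\<lambda>k. cmod (L2_ip M (F k) g - L2_ip M f g)) \<longlonglongrightarrow> 0" by simp
  then show ?thesis by (simp add: tendsto_norm_zero_iff LIM_zero_iff)
qed

section \<open>Orthonormal bases, Riesz-Fischer and Parseval\<close>

text \<open>Completeness is stated as triviality of the orthogonal complement, the form that can be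
  verified for the exponentials. That expansions converge is then derived.\<close>

locale L2_basis =
  fixes M :: "'a measure" and e :: "nat \<Rightarrow> 'a \<Rightarrow> complex"
  assumes e_L2: "\<And>n. e n \<in> L2_fun M"
    and orthonormal: "\<And>m n. L2_ip M (e m) (e n) = (if m = n then 1 else 0)"
    and complete: "\<And>f. f \<in> L2_fun M \<Longrightarrow> (\<And>n. L2_ip M f (e n) = 0) \<Longrightarrow> AE x in M. f x = 0"
begin

definition coeff :: "('a \<Rightarrow> complex) \<Rightarrow> nat \<Rightarrow> complex" where
  "coeff f n = L2_ip M f (e n)"

definition partial :: "(nat \<Rightarrow> complex) \<Rightarrow> nat set \<Rightarrow> 'a \<Rightarrow> complex" where
  "partial c I x = (\<Sum>n\<in>I. c n * e n x)"

lemma partial_L2 [intro]: "finite I \<Longrightarrow> partial c I \<in> L2_fun M"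
  unfolding partial_def [abs_def] by (intro L2_fun_sum L2_fun_scale e_L2)

lemma L2_ip_partial:
  assumes "finite I" "g \<in> L2_fun M"
  shows "L2_ip M (partial c I) g = (\<Sum>n\<in>I. c n * cnj (coeff g n))"
proof -
  have "L2_ip M (partial c I) g = (\<Sum>n\<in>I. L2_ip M (\<lambda>x. c n * e n x) g)"
    unfolding partial_def [abs_def] by (intro L2_ip_sum_left assms L2_fun_scale e_L2)
  then show ?thesis by (simp add: L2_ip_scale_left coeff_def L2_ip_cnj[of M "e _" g])
qed

lemma coeff_partial:
  assumes "finite I"
  shows "coeff (partial c I) n = (if n \<in> I then c n else 0)"
proof -
  have "coeff (partial c I) n = (\<Sum>m\<in>I. c m * (if n = m then 1 else 0))"
    unfolding coeff_def L2_ip_partial[OF assms e_L2]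
    by (intro sum.cong) (auto simp: coeff_def orthonormal)
  then show ?thesis using assms by (simp add: if_distrib cong: if_cong)
qed

lemma L2_sqnorm_partial:
  assumes "finite I"
  shows "L2_sqnorm M (partial c I) = (\<Sum>n\<in>I. (cmod (c n))\<^sup>2)"
proof -
  have "complex_of_real (L2_sqnorm M (partial c I)) = (\<Sum>n\<in>I. c n * cnj (coeff (partial c I) n))"
    unfolding L2_ip_self[symmetric] by (rule L2_ip_partial) (use assms in auto)
  also have "\<dots> = complex_of_real (\<Sum>n\<in>I. (cmod (c n))\<^sup>2)"
    unfolding of_real_sum by (intro sum.cong) (auto simp: coeff_partial[OF assms] simp flip: complex_norm_square)
  finally show ?thesis by (simp only: of_real_eq_iff)
qed

lemma Bessel:
  assumes f: "f \<in> L2_fun M"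
  shows "summable (\<lambda>n. (cmod (coeff f n))\<^sup>2)"
proof (rule bounded_imp_summable)
  show "(\<Sum>n\<le>N. (cmod (coeff f n))\<^sup>2) \<le> L2_sqnorm M f" for N
  proof -
    let ?p = "partial (coeff f) {..N}"
    \<comment> \<open>The partial sum is the orthogonal projection of \<open>f\<close>, so
      subtracting it lowers the squared norm by exactly its own.\<close>
    have ip: "L2_ip M ?p f = complex_of_real (L2_sqnorm M ?p)"
      by (simp add: L2_ip_partial f L2_sqnorm_partial flip: complex_norm_square)
    have "0 \<le> L2_sqnorm M (\<lambda>x. f x - 1 * ?p x)" by (rule L2_sqnorm_nonneg)
    also have "\<dots> = L2_sqnorm M f - L2_sqnorm M ?p"
      by (subst L2_sqnorm_diff_scale) (auto simp: f L2_ip_cnj[of M f] ip)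
    finally show ?thesis by (simp add: L2_sqnorm_partial)
  qed
qed auto

lemma coeff_cong_AE:
  assumes "AE x in M. f x = g x" "f \<in> borel_measurable M" "g \<in> borel_measurable M"
  shows "coeff f = coeff g"
proof
  fix n show "coeff f n = coeff g n"
    unfolding coeff_def using assms L2_funD(1)[OF e_L2] by (intro L2_ip_cong_AE) auto
qed

lemma coeff_eq_imp_AE_eq:
  assumes "f \<in> L2_fun M" "g \<in> L2_fun M" "coeff f = coeff g"
  shows "AE x in M. f x = g x"
proof -
  have "AE x in M. f x - g x = 0"
  proof (rule complete)
    show "L2_ip M (\<lambda>x. f x - g x) (e n) = 0" for n
      unfolding L2_ip_diff_left[OF assms(1,2) e_L2] using fun_cong[OF assms(3), of n] by (simp add: coeff_def)
  qed (use assms in auto)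
  then show ?thesis by simp
qed

text \<open>Convergence is only needed along a subsequence of the partial sums, on which the
  increments decay geometrically.\<close>

lemma Riesz_Fischer_subseq:
  assumes c: "summable (\<lambda>n. (cmod (c n))\<^sup>2)"
  obtains f N where "f \<in> L2_fun M" "coeff f = c" "strict_mono (N :: nat \<Rightarrow> nat)"
    "(\<lambda>k. L2_sqnorm M (\<lambda>x. partial c {..<N k} x - f x)) \<longlonglongrightarrow> 0"
proof -
  have "\<exists>n. \<forall>p\<ge>n. \<forall>q. (\<Sum>j\<in>{p..<q}. (cmod (c j))\<^sup>2) \<le> (1/4)^k" for k
  proof -
    obtain n where "\<And>p q. p \<ge> n \<Longrightarrow> norm (\<Sum>j\<in>{p..<q}. (cmod (c j))\<^sup>2) < (1/4)^k"
      using c[unfolded summable_Cauchy] by (meson zero_less_power zero_less_divide_1_iff zero_less_numeral)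
    then have "(\<Sum>j\<in>{p..<q}. (cmod (c j))\<^sup>2) \<le> (1/4)^k" if "p \<ge> n" for p q
      using that by (smt (verit) real_norm_def)
    then show ?thesis by blast
  qed
  then obtain n where n: "\<And>k p q. p \<ge> n k \<Longrightarrow> (\<Sum>j\<in>{p..<q}. (cmod (c j))\<^sup>2) \<le> (1/4)^k"
    by metis
  \<comment> \<open>Cumulative sums of \<open>Suc (n j)\<close> are strictly increasing and stay
    above the Cauchy thresholds \<open>n k\<close>.\<close>
  define N where "N k = (\<Sum>j\<le>k. Suc (n j))" for k
  have N_ge: "N k \<ge> n k" for k unfolding N_def by (cases k) auto
  have N_mono: "strict_mono N" unfolding strict_mono_Suc_iff N_def by simp
  let ?F = "\<lambda>k. partial c {..<N k}"
  have F: "?F k \<in> L2_fun M" for k by auto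
  have diff: "(\<lambda>x. ?F (Suc k) x - ?F k x) = partial c {N k..<N (Suc k)}" for k
  proof
    fix x
    have "N k \<le> N (Suc k)" using N_mono by (simp add: strict_mono_less_eq)
    then show "?F (Suc k) x - ?F k x = partial c {N k..<N (Suc k)} x"
      unfolding partial_def using sum_diff_nat_ivl[of 0 "N k" "N (Suc k)" "\<lambda>n. c n * e n x"]
      by (simp add: atLeast0LessThan)
  qed
  have fast: "L2_sqnorm M (\<lambda>x. ?F (Suc k) x - ?F k x) \<le> (1/4)^k" for k
    unfolding diff using n[OF N_ge[of k]] by (simp add: L2_sqnorm_partial)
  obtain f where f: "f \<in> L2_fun M" "(\<lambda>k. L2_sqnorm M (\<lambda>x. ?F k x - f x)) \<longlonglongrightarrow> 0"
    using L2_fast_Cauchy_converges[of ?F M] F fast by blast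
  have "coeff f = c"
  proof
    fix m
    have "(\<lambda>k. coeff (?F k) m) \<longlonglongrightarrow> coeff f m"
      unfolding coeff_def using f by (intro L2_ip_tendsto F e_L2)
    moreover have "\<forall>\<^sub>F k in sequentially. coeff (?F k) m = c m"
      using eventually_gt_at_top[of m]
    proof eventually_elim
      case (elim k)
      then have "m < N k" using seq_suble[OF N_mono, of k] by simp
      then show ?case by (simp add: coeff_partial)
    qed
    ultimately show "coeff f m = c m"
      using tendsto_unique[OF sequentially_bot _ tendsto_eventually] by blast
  qed
  then show thesis using that f N_mono by blast
qed

lemma Riesz_Fischer:
  assumes "summable (\<lambda>n. (cmod (c n))\<^sup>2)"
  obtains f where "f \<in> L2_fun M" "coeff f = c"
  using Riesz_Fischer_subseq[OF assms] by blast

text \<open>Riesz-Fischer rebuilds a function with the coefficients of \<open>f\<close>, and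
  completeness identifies it with \<open>f\<close>. This yields the sum along a subsequence;
  absolute summability extends it to the whole series.\<close>

lemma Parseval:
  assumes f: "f \<in> L2_fun M" and g: "g \<in> L2_fun M"
  shows "(\<lambda>n. coeff f n * cnj (coeff g n)) sums L2_ip M f g"
proof -
  obtain h N where h: "h \<in> L2_fun M" "coeff h = coeff f" and N: "strict_mono (N :: nat \<Rightarrow> nat)"
    and lim: "(\<lambda>k. L2_sqnorm M (\<lambda>x. partial (coeff f) {..<N k} x - h x)) \<longlonglongrightarrow> 0"
    by (rule Riesz_Fischer_subseq[OF Bessel[OF f]])
  have "AE x in M. h x = f x" by (rule coeff_eq_imp_AE_eq[OF h(1) f h(2)])
  then have ip: "L2_ip M h g = L2_ip M f g"
    using h(1) f g by (intro L2_ip_cong_AE) auto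
  have "(\<lambda>k. L2_ip M (partial (coeff f) {..<N k}) g) \<longlonglongrightarrow> L2_ip M h g"
    by (intro L2_ip_tendsto lim h g) auto
  then have sub: "(\<lambda>k. \<Sum>n<N k. coeff f n * cnj (coeff g n)) \<longlonglongrightarrow> L2_ip M f g"
    by (simp add: L2_ip_partial g ip)
  have "summable (\<lambda>n. coeff f n * cnj (coeff g n))"
  proof (rule summable_comparison_test')
    show "summable (\<lambda>n. (cmod (coeff f n))\<^sup>2 + (cmod (coeff g n))\<^sup>2)"
      by (intro summable_add Bessel f g)
    fix n
    have "s * t \<le> s\<^sup>2 + t\<^sup>2" if "s \<ge> 0" "t \<ge> 0" for s t :: real
      using sum_squares_bound[of s t] mult_nonneg_nonneg[OF that] by simp
    then show "norm (coeff f n * cnj (coeff g n)) \<le> (cmod (coeff f n))\<^sup>2 + (cmod (coeff g n))\<^sup>2"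
      by (simp add: norm_mult)
  qed
  then have "(\<lambda>m. \<Sum>n<m. coeff f n * cnj (coeff g n)) \<longlonglongrightarrow> (\<Sum>n. coeff f n * cnj (coeff g n))"
    by (rule summable_LIMSEQ)
  from LIMSEQ_subseq_LIMSEQ[OF this N]
  have "(\<lambda>k. \<Sum>n<N k. coeff f n * cnj (coeff g n)) \<longlonglongrightarrow> (\<Sum>n. coeff f n * cnj (coeff g n))"
    by (simp add: o_def)
  then have "(\<Sum>n. coeff f n * cnj (coeff g n)) = L2_ip M f g"
    using sub LIMSEQ_unique by blast
  then show ?thesis
    using \<open>summable (\<lambda>n. coeff f n * cnj (coeff g n))\<close> by (simp add: sums_iff)
qed

end

section \<open>Diagonal operators and their square roots\<close>

lemma L2_class_cong:
  assumes "AE x in M. f x = g x"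
  shows "L2_class M f = L2_class M g"
proof -
  have "(AE x in M. h x = f x) \<longleftrightarrow> (AE x in M. h x = g x)" for h
  proof
    assume "AE x in M. h x = f x" then show "AE x in M. h x = g x"
      using assms by eventually_elim simp
  next
    assume "AE x in M. h x = g x" then show "AE x in M. h x = f x"
      using assms by eventually_elim simp
  qed
  then show ?thesis by (simp add: L2_class_def)
qed

lemma L2_rep_class:
  assumes "f \<in> borel_measurable M"
  shows "L2_rep (L2_class M f) \<in> borel_measurable M" "AE x in M. L2_rep (L2_class M f) x = f x"
proof -
  have "f \<in> L2_class M f" using assms by (simp add: L2_class_def)
  then have "L2_rep (L2_class M f) \<in> L2_class M f"
    unfolding L2_rep_def by (rule someI[where P = "\<lambda>h. h \<in> L2_class M f"])
  then show "L2_rep (L2_class M f) \<in> borel_measurable M" "AE x in M. L2_rep (L2_class M f) x = f x"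
    by (auto simp: L2_class_def)
qed

lemma L2_rep_class_L2_fun:
  assumes "f \<in> L2_fun M" shows "L2_rep (L2_class M f) \<in> L2_fun M"
  using L2_rep_class[OF L2_funD(1)[OF assms]] assms by (intro L2_fun_AE_cong[OF assms])

lemma L2_rep_L2:
  assumes "u \<in> L2 M"
  shows "L2_rep u \<in> L2_fun M" "L2_class M (L2_rep u) = u"
proof -
  obtain f where f: "f \<in> L2_fun M" "u = L2_class M f" using assms by (auto simp: L2_def)
  show "L2_rep u \<in> L2_fun M" unfolding f(2) by (rule L2_rep_class_L2_fun[OF f(1)])
  show "L2_class M (L2_rep u) = u"
    unfolding f(2) by (rule L2_class_cong[OF L2_rep_class(2)[OF L2_funD(1)[OF f(1)]]])
qed

lemma L2_class_in_L2 [intro]: "f \<in> L2_fun M \<Longrightarrow> L2_class M f \<in> L2 M"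
  by (auto simp: L2_def)

lemma L2_add_closed: "u \<in> L2 M \<Longrightarrow> v \<in> L2 M \<Longrightarrow> L2_add M u v \<in> L2 M"
  unfolding L2_add_def by (intro L2_class_in_L2 L2_fun_add L2_rep_L2)

lemma L2_scale_closed: "u \<in> L2 M \<Longrightarrow> L2_scale M c u \<in> L2 M"
  unfolding L2_scale_def by (intro L2_class_in_L2 L2_fun_scale L2_rep_L2)

text \<open>Comparing graphs settles domains and values of partial maps in one step.\<close>

lemma map_eqI:
  assumes "\<And>x y. f x = Some y \<longleftrightarrow> g x = Some y"
  shows "f = g"
proof
  fix x show "f x = g x" by (metis assms option.exhaust)
qed

context L2_basis
begin

definition class_coeff :: "('a \<Rightarrow> complex) set \<Rightarrow> nat \<Rightarrow> complex" where
  "class_coeff u = coeff (L2_rep u)"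

lemma class_coeff_class: "f \<in> L2_fun M \<Longrightarrow> class_coeff (L2_class M f) = coeff f"
  unfolding class_coeff_def by (intro coeff_cong_AE L2_rep_class L2_funD(1))

lemma class_coeff_summable: "u \<in> L2 M \<Longrightarrow> summable (\<lambda>n. (cmod (class_coeff u n))\<^sup>2)"
  unfolding class_coeff_def by (intro Bessel L2_rep_L2)

lemma class_coeff_inject:
  assumes "u \<in> L2 M" "v \<in> L2 M" "\<And>n. class_coeff u n = class_coeff v n"
  shows "u = v"
proof -
  have "AE x in M. L2_rep u x = L2_rep v x"
    using assms by (intro coeff_eq_imp_AE_eq L2_rep_L2) (auto simp: class_coeff_def)
  then have "L2_class M (L2_rep u) = L2_class M (L2_rep v)" by (rule L2_class_cong)
  then show ?thesis using assms by (simp add: L2_rep_L2)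
qed

lemma class_coeff_surj:
  assumes "summable (\<lambda>n. (cmod (c n))\<^sup>2)"
  obtains u where "u \<in> L2 M" "\<And>n. class_coeff u n = c n"
proof -
  obtain f where "f \<in> L2_fun M" "coeff f = c" by (rule Riesz_Fischer[OF assms])
  then show thesis using that[of "L2_class M f"] by (auto simp: class_coeff_class)
qed

lemma class_coeff_add: "u \<in> L2 M \<Longrightarrow> v \<in> L2 M \<Longrightarrow> class_coeff (L2_add M u v) n = class_coeff u n + class_coeff v n"
  unfolding L2_add_def
  by (subst class_coeff_class) (auto simp: class_coeff_def coeff_def L2_rep_L2 L2_ip_add_left e_L2)

lemma class_coeff_scale: "u \<in> L2 M \<Longrightarrow> class_coeff (L2_scale M c u) n = c * class_coeff u n"
  unfolding L2_scale_def
  by (subst class_coeff_class) (auto simp: class_coeff_def coeff_def L2_rep_L2 L2_ip_scale_left)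

lemma inner_sums:
  "u \<in> L2 M \<Longrightarrow> v \<in> L2 M \<Longrightarrow> (\<lambda>n. class_coeff u n * cnj (class_coeff v n)) sums L2_inner M u v"
  unfolding class_coeff_def L2_inner_def L2_ip_def[symmetric] by (intro Parseval L2_rep_L2)

definition basis_class :: "nat \<Rightarrow> ('a \<Rightarrow> complex) set" where
  "basis_class n = L2_class M (e n)"

lemma basis_class_L2: "basis_class n \<in> L2 M"
  unfolding basis_class_def by (intro L2_class_in_L2 e_L2)

lemma class_coeff_basis_class: "class_coeff (basis_class n) m = (if m = n then 1 else 0)"
  unfolding basis_class_def by (auto simp: class_coeff_class e_L2 coeff_def orthonormal)

lemma inner_scale_basis_class:
  assumes "u \<in> L2 M"
  shows "L2_inner M (L2_scale M c (basis_class n)) u = c * cnj (class_coeff u n)"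
proof -
  have "(\<lambda>m. class_coeff (L2_scale M c (basis_class n)) m * cnj (class_coeff u m)) = (\<lambda>m. if m = n then c * cnj (class_coeff u m) else 0)"
    by (auto simp: class_coeff_scale basis_class_L2 class_coeff_basis_class)
  then have "(\<lambda>m. if m = n then c * cnj (class_coeff u m) else 0) sums L2_inner M (L2_scale M c (basis_class n)) u"
    using inner_sums[OF L2_scale_closed[OF basis_class_L2] assms, of c n] by simp
  then show ?thesis using sums_single[of n "\<lambda>m. c * cnj (class_coeff u m)"] sums_unique2 by blast
qed

lemma inner_basis_class_left:
  assumes "u \<in> L2 M"
  shows "L2_inner M (basis_class n) u = cnj (class_coeff u n)"
proof -
  have "basis_class n = L2_scale M 1 (basis_class n)" by (intro class_coeff_inject basis_class_L2 L2_scale_closed) (simp add: class_coeff_scale basis_class_L2)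
  then show ?thesis using inner_scale_basis_class[OF assms, of 1 n] by simp
qed

lemma inner_self:
  assumes u: "u \<in> L2 M"
  shows "(\<lambda>n. (cmod (class_coeff u n))\<^sup>2) sums Re (L2_inner M u u)"
  using sums_Re[OF inner_sums[OF u u]] by (simp flip: complex_norm_square of_real_power)

text \<open>Multiplication by \<open>s\<close> in coordinates, on its maximal domain. Coordinates
  determine a class, so the choice of \<open>w\<close> is unique.\<close>

definition diag_op :: "(nat \<Rightarrow> real) \<Rightarrow> 'a L2_op" where
  "diag_op s u = (if u \<in> L2 M \<and> summable (\<lambda>n. (cmod (complex_of_real (s n) * class_coeff u n))\<^sup>2)
     then Some (SOME w. w \<in> L2 M \<and> (\<forall>n. class_coeff w n = complex_of_real (s n) * class_coeff u n)) else None)"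

text \<open>The graph description of a diagonal operator. The summability condition disappears
  because it is implied by \<open>w\<close> being a class in \<open>L2 M\<close>.\<close>

lemma diag_op_eq_Some_iff:
  "diag_op s u = Some w \<longleftrightarrow> u \<in> L2 M \<and> w \<in> L2 M \<and> (\<forall>n. class_coeff w n = complex_of_real (s n) * class_coeff u n)"
    (is "_ \<longleftrightarrow> ?R w")
proof (cases "u \<in> L2 M \<and> summable (\<lambda>n. (cmod (complex_of_real (s n) * class_coeff u n))\<^sup>2)")
  case True
  then have sm: "summable (\<lambda>n. (cmod (complex_of_real (s n) * class_coeff u n))\<^sup>2)" by blast
  obtain w' where w': "w' \<in> L2 M" "\<And>n. class_coeff w' n = complex_of_real (s n) * class_coeff u n"
    by (rule class_coeff_surj[OF sm]) blast
  define w0 where "w0 = (SOME w. w \<in> L2 M \<and> (\<forall>n. class_coeff w n = complex_of_real (s n) * class_coeff u n))"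
  have w0: "w0 \<in> L2 M \<and> (\<forall>n. class_coeff w0 n = complex_of_real (s n) * class_coeff u n)"
    unfolding w0_def using someI[of "\<lambda>w. w \<in> L2 M \<and> (\<forall>n. class_coeff w n = complex_of_real (s n) * class_coeff u n)" w'] w' by blast
  have "diag_op s u = Some w0" using True by (simp add: diag_op_def w0_def)
  moreover have "w0 = w" if "?R w" using that w0 by (intro class_coeff_inject) auto
  ultimately show ?thesis using True w0 by auto
next
  case False
  moreover have "\<not> ?R w"
  proof
    assume R: "?R w"
    then have "summable (\<lambda>n. (cmod (complex_of_real (s n) * class_coeff u n))\<^sup>2)"
      using class_coeff_summable[of w] by simp
    then show False using False R by blast
  qed
  ultimately show ?thesis by (auto simp: diag_op_def)
qed

lemma dom_diag_op:
  "dom (diag_op s) = {u \<in> L2 M. summable (\<lambda>n. (cmod (complex_of_real (s n) * class_coeff u n))\<^sup>2)}"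
  by (auto simp: diag_op_def dom_def)

lemma diag_op_basis_class: "diag_op s (basis_class n) = Some (L2_scale M (complex_of_real (s n)) (basis_class n))"
  by (auto simp: diag_op_eq_Some_iff basis_class_L2 L2_scale_closed class_coeff_scale class_coeff_basis_class)

lemma basis_class_dom_diag_op: "basis_class n \<in> dom (diag_op s)"
  using diag_op_basis_class by blast

text \<open>Testing against basis vectors reads off every coordinate of \<open>w\<close>, so the
  description inside \<open>THE\<close> is unique once the domain contains the basis.\<close>

lemma adjoint_eq_Some_iff:
  assumes basis_class: "\<And>n. basis_class n \<in> dom T"
  shows "L2_adjoint M T v = Some w \<longleftrightarrow>
    v \<in> L2 M \<and> w \<in> L2 M \<and> (\<forall>u\<in>dom T. L2_inner M (the (T u)) v = L2_inner M u w)"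
    (is "_ \<longleftrightarrow> v \<in> L2 M \<and> ?P w")
proof -
  have unique: "w1 = w2" if "?P w1" "?P w2" for w1 w2
  proof (rule class_coeff_inject)
    fix n
    have "L2_inner M (basis_class n) w1 = L2_inner M (basis_class n) w2"
      using that basis_class[of n] by metis
    then show "class_coeff w1 n = class_coeff w2 n" using that by (simp add: inner_basis_class_left)
  qed (use that in auto)
  show ?thesis
  proof (cases "v \<in> L2 M \<and> (\<exists>w. ?P w)")
    case True
    then obtain w' where w': "?P w'" by blast
    have "(THE w. ?P w) = w'"
    proof (rule the_equality)
      show "?P w'" by fact
      show "w = w'" if "?P w" for w using unique[OF that w'] .
    qed
    then have "L2_adjoint M T v = Some w'"
      using True unfolding L2_adjoint_def by (auto simp: Bex_def)
    then show ?thesis using True w' unique[of w w'] by auto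
  next
    case False
    then have "L2_adjoint M T v = None" unfolding L2_adjoint_def by auto
    then show ?thesis using False by auto
  qed
qed

lemma diag_op_symmetric:
  assumes "diag_op s u = Some u'" "diag_op s v = Some v'"
  shows "L2_inner M u' v = L2_inner M u v'"
proof -
  have "(\<lambda>n. class_coeff u' n * cnj (class_coeff v n)) sums L2_inner M u' v"
    using assms by (intro inner_sums) (auto simp: diag_op_eq_Some_iff)
  moreover have "(\<lambda>n. class_coeff u n * cnj (class_coeff v' n)) sums L2_inner M u v'"
    using assms by (intro inner_sums) (auto simp: diag_op_eq_Some_iff)
  moreover have "(\<lambda>n. class_coeff u' n * cnj (class_coeff v n)) = (\<lambda>n. class_coeff u n * cnj (class_coeff v' n))"
    using assms by (auto simp: diag_op_eq_Some_iff)
  ultimately show ?thesis by (metis sums_unique2)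
qed

lemma diag_op_linear: "L2_linear M (diag_op s)"
  unfolding L2_linear_def
proof (intro conjI ballI allI)
  show "dom (diag_op s) \<subseteq> L2 M" by (auto simp: dom_diag_op)
  show "ran (diag_op s) \<subseteq> L2 M" by (auto simp: ran_def diag_op_eq_Some_iff)
  fix u assume "u \<in> dom (diag_op s)"
  then obtain u' where u: "diag_op s u = Some u'" by blast
  show "diag_op s (L2_scale M c u) = Some (L2_scale M c (the (diag_op s u)))" for c
    unfolding u option.sel using u by (auto simp: diag_op_eq_Some_iff L2_scale_closed class_coeff_scale)
  fix v assume "v \<in> dom (diag_op s)"
  then obtain v' where v: "diag_op s v = Some v'" by blast
  show "diag_op s (L2_add M u v) = Some (L2_add M (the (diag_op s u)) (the (diag_op s v)))"
    unfolding u v option.sel using u v by (auto simp: diag_op_eq_Some_iff L2_add_closed class_coeff_add algebra_simps)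
qed

text \<open>Truncating the coordinates of \<open>u\<close> gives a finitely supported sequence,
  which lies in the domain of every diagonal operator; the error is a tail of a convergent
  series.\<close>

lemma diag_op_densely_defined: "L2_densely_defined M (diag_op s)"
  unfolding L2_densely_defined_def
proof (intro ballI allI impI)
  fix u and \<epsilon> :: real assume u: "u \<in> L2 M" and \<epsilon>: "\<epsilon> > 0"
  obtain N where N: "norm (\<Sum>i. (cmod (class_coeff u (i + N)))\<^sup>2) < \<epsilon>\<^sup>2"
    using suminf_exist_split[OF _ class_coeff_summable[OF u], of "\<epsilon>\<^sup>2"] \<epsilon> by auto
  obtain v where v: "v \<in> L2 M" "\<And>n. class_coeff v n = (if n < N then class_coeff u n else 0)"
  proof (rule class_coeff_surj)
    show "summable (\<lambda>n. (cmod (if n < N then class_coeff u n else 0))\<^sup>2)"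
      by (rule summable_finite[of "{..<N}"]) auto
  qed blast
  have "v \<in> dom (diag_op s)"
    unfolding dom_diag_op using v by (auto intro!: summable_finite[of "{..<N}"] split: if_splits)
  let ?d = "L2_add M u (L2_scale M (-1) v)"
  have d: "?d \<in> L2 M" using u v by (intro L2_add_closed L2_scale_closed)
  have cfd: "class_coeff ?d n = (if n < N then 0 else class_coeff u n)" for n
    using u v by (simp add: class_coeff_add class_coeff_scale L2_scale_closed)
  have "Re (L2_inner M ?d ?d) = (\<Sum>n. (cmod (class_coeff ?d n))\<^sup>2)"
    using inner_self[OF d] by (simp add: sums_iff)
  also have "\<dots> = (\<Sum>i. (cmod (class_coeff ?d (i + N)))\<^sup>2) + (\<Sum>i<N. (cmod (class_coeff ?d i))\<^sup>2)"
    by (rule suminf_split_initial_segment[OF class_coeff_summable[OF d]])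
  also have "\<dots> = (\<Sum>i. (cmod (class_coeff u (i + N)))\<^sup>2)" by (simp add: cfd)
  also have "\<dots> < \<epsilon>\<^sup>2" using N by simp
  finally have "L2_norm M ?d < \<epsilon>"
    unfolding L2_norm_def using \<epsilon> real_less_lsqrt[of \<epsilon>] by simp
  then show "\<exists>v\<in>dom (diag_op s). L2_norm M (L2_add M u (L2_scale M (-1) v)) < \<epsilon>"
    using \<open>v \<in> dom (diag_op s)\<close> by blast
qed

text \<open>The adjoint relation tested on basis vectors forces \<open>w\<close> to have coordinates
  \<open>s n\<close> times those of \<open>v\<close>. This places \<open>v\<close> in the maximal
  domain, so the adjoint is no larger than the operator.\<close>

lemma diag_op_self_adjoint: "L2_self_adjoint M (diag_op s)"
proof -
  have "L2_adjoint M (diag_op s) = diag_op s"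
  proof (rule map_eqI)
    fix v w
    have "diag_op s v = Some w" if vw: "v \<in> L2 M" "w \<in> L2 M"
      and adj: "\<forall>u\<in>dom (diag_op s). L2_inner M (the (diag_op s u)) v = L2_inner M u w"
    proof -
      have "class_coeff w n = complex_of_real (s n) * class_coeff v n" for n
      proof -
        have "L2_inner M (the (diag_op s (basis_class n))) v = L2_inner M (basis_class n) w"
          using adj basis_class_dom_diag_op by blast
        then have "complex_of_real (s n) * cnj (class_coeff v n) = cnj (class_coeff w n)"
          using vw by (simp add: diag_op_basis_class inner_scale_basis_class inner_basis_class_left)
        then have "cnj (class_coeff w n) = cnj (complex_of_real (s n) * class_coeff v n)" by simp
        then show ?thesis by (simp only: complex_cnj_cancel_iff)
      qed
      then show ?thesis using vw by (simp add: diag_op_eq_Some_iff)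
    qed
    moreover have "\<forall>u\<in>dom (diag_op s). L2_inner M (the (diag_op s u)) v = L2_inner M u w" if "diag_op s v = Some w"
      using diag_op_symmetric[OF _ that] by force
    ultimately show "L2_adjoint M (diag_op s) v = Some w \<longleftrightarrow> diag_op s v = Some w"
      unfolding adjoint_eq_Some_iff[OF basis_class_dom_diag_op] by (auto simp: diag_op_eq_Some_iff)
  qed
  then show ?thesis
    unfolding L2_self_adjoint_def using diag_op_linear diag_op_densely_defined by blast
qed

lemma diag_op_positive:
  assumes s: "\<And>n. s n \<ge> 0"
  shows "L2_positive M (diag_op s)"
  unfolding L2_positive_def
proof
  fix u assume "u \<in> dom (diag_op s)"
  then obtain w where w: "diag_op s u = Some w" by blast
  have "(\<lambda>n. class_coeff w n * cnj (class_coeff u n)) sums L2_inner M w u"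
    using w by (intro inner_sums) (auto simp: diag_op_eq_Some_iff)
  moreover have "class_coeff w n * cnj (class_coeff u n) = complex_of_real (s n * (cmod (class_coeff u n))\<^sup>2)" for n
    unfolding of_real_mult complex_norm_square using w by (simp add: diag_op_eq_Some_iff mult.assoc)
  ultimately have S: "(\<lambda>n. complex_of_real (s n * (cmod (class_coeff u n))\<^sup>2)) sums L2_inner M w u" by simp
  have "Im (L2_inner M w u) = 0" using sums_Im[OF S] by (simp add: sums_iff)
  moreover have re: "(\<lambda>n. s n * (cmod (class_coeff u n))\<^sup>2) sums Re (L2_inner M w u)" using sums_Re[OF S] by simp
  have nn: "0 \<le> s n * (cmod (class_coeff u n))\<^sup>2" for n using s by simp
  have "0 \<le> Re (L2_inner M w u)" by (rule sums_le[OF nn sums_zero re])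
  ultimately show "L2_inner M (the (diag_op s u)) u \<in> \<real> \<and> 0 \<le> Re (L2_inner M (the (diag_op s u)) u)"
    using w by (simp add: complex_is_Real_iff)
qed

lemma diag_op_square: "diag_op s \<circ>\<^sub>m diag_op s = diag_op (\<lambda>n. (s n)\<^sup>2)"
proof (rule map_eqI)
  fix u w
  have "\<exists>v. diag_op s u = Some v \<and> diag_op s v = Some w" if w: "diag_op (\<lambda>n. (s n)\<^sup>2) u = Some w"
  proof -
    have uw: "u \<in> L2 M" "w \<in> L2 M" "\<And>n. class_coeff w n = complex_of_real ((s n)\<^sup>2) * class_coeff u n"
      using w by (auto simp: diag_op_eq_Some_iff)
    have "summable (\<lambda>n. (cmod (complex_of_real (s n) * class_coeff u n))\<^sup>2)"
    proof (rule summable_comparison_test')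
      show "summable (\<lambda>n. (cmod (class_coeff u n))\<^sup>2 + (cmod (class_coeff w n))\<^sup>2)"
        by (intro summable_add class_coeff_summable uw)
      fix n
      \<comment> \<open>The instance \<open>t = (s n)^2\<close> of \<open>t <= 1 + t^2\<close>:
        membership in the domain of the square entails membership in the domain of the
        operator.\<close>
      have "(s n)\<^sup>2 \<le> 1 + ((s n)\<^sup>2)\<^sup>2"
        using zero_le_power2[of "(s n)\<^sup>2 - 1"] by (simp add: power2_diff)
           (smt (verit) zero_le_power2)
      then have "(s n)\<^sup>2 * (cmod (class_coeff u n))\<^sup>2 \<le> (1 + ((s n)\<^sup>2)\<^sup>2) * (cmod (class_coeff u n))\<^sup>2"
        by (intro mult_right_mono) auto
      then show "norm ((cmod (complex_of_real (s n) * class_coeff u n))\<^sup>2) \<le> (cmod (class_coeff u n))\<^sup>2 + (cmod (class_coeff w n))\<^sup>2"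
        by (simp add: uw(3) norm_mult norm_power power_mult_distrib algebra_simps)
    qed
    then obtain v where v: "diag_op s u = Some v" using uw(1) by (auto simp: diag_op_def)
    then have "diag_op s v = Some w" using uw by (auto simp: diag_op_eq_Some_iff power2_eq_square)
    then show ?thesis using v by blast
  qed
  moreover have "diag_op (\<lambda>n. (s n)\<^sup>2) u = Some w" if "diag_op s u = Some v" "diag_op s v = Some w" for v
    using that by (auto simp: diag_op_eq_Some_iff power2_eq_square)
  ultimately show "(diag_op s \<circ>\<^sub>m diag_op s) u = Some w \<longleftrightarrow> diag_op (\<lambda>n. (s n)\<^sup>2) u = Some w"
    unfolding map_comp_Some_iff by blast
qed

text \<open>Once \<open>S\<close> is known on the basis, its symmetry against basis vectors shows
  that \<open>diag_op s\<close> extends \<open>S\<close>. A symmetric extension of a self-adjoint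
  operator is contained in the adjoint, hence in the operator itself, so the two coincide.\<close>

lemma positive_sqrt_unique:
  assumes s: "\<And>n. s n > 0" and sa: "L2_self_adjoint M S" and pos: "L2_positive M S"
    and sq: "S \<circ>\<^sub>m S = diag_op (\<lambda>n. (s n)\<^sup>2)"
  shows "S = diag_op s"
proof -
  have lin: "L2_linear M S" and adj: "L2_adjoint M S = S" using sa by (auto simp: L2_self_adjoint_def)
  have S_L2: "u \<in> L2 M" "w \<in> L2 M" if "S u = Some w" for u w
    using lin domI[of S u w] ranI[of S u w] that unfolding L2_linear_def by blast+
  have S_add: "S (L2_add M u v) = Some (L2_add M u' v')" if "S u = Some u'" "S v = Some v'" for u v u' v'
  proof -
    have "u \<in> dom S" "v \<in> dom S" using that by auto
    then show ?thesis using lin that unfolding L2_linear_def by (metis option.sel)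
  qed
  have S_scale: "S (L2_scale M c u) = Some (L2_scale M c u')" if "S u = Some u'" for u u' c
  proof -
    have "u \<in> dom S" using that by auto
    then show ?thesis using lin that unfolding L2_linear_def by (metis option.sel)
  qed
  text \<open>On each eigenvector \<open>basis_class n\<close>, the component of \<open>S\<close> other than \<open>s n\<close> would be a negative
    eigenvalue \<open>- s n\<close>, which positivity excludes.\<close>
  have SE: "S (basis_class n) = Some (L2_scale M (complex_of_real (s n)) (basis_class n))" for n
  proof -
    obtain z where z: "(S \<circ>\<^sub>m S) (basis_class n) = Some z" using basis_class_dom_diag_op[of n "\<lambda>n. (s n)\<^sup>2"] sq by auto
    then obtain w where w: "S (basis_class n) = Some w" "S w = Some z" by (auto simp: map_comp_Some_iff)
    have cfz: "class_coeff z m = (if m = n then complex_of_real ((s n)\<^sup>2) else 0)" for m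
      using z unfolding sq by (auto simp: diag_op_eq_Some_iff class_coeff_basis_class)
    \<comment> \<open>\<open>S\<close> sends \<open>w\<close> to \<open>(s n)^2\<close> times the
      basis vector, so applying \<open>S\<close> to this difference multiplies it by
      \<open>- s n\<close>.\<close>
    define v where "v = L2_add M w (L2_scale M (- complex_of_real (s n)) (basis_class n))"
    define v' where "v' = L2_add M z (L2_scale M (- complex_of_real (s n)) w)"
    have Sv: "S v = Some v'" unfolding v_def v'_def by (intro S_add S_scale w)
    have wL: "w \<in> L2 M" "z \<in> L2 M" using S_L2[OF w(2)] by auto
    have vL: "v \<in> L2 M" "v' \<in> L2 M" using S_L2[OF Sv] by auto
    have cfv: "class_coeff v m = class_coeff w m - complex_of_real (s n) * class_coeff (basis_class n) m" for m
      unfolding v_def by (simp add: class_coeff_add class_coeff_scale L2_scale_closed basis_class_L2 wL)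
    have cfv': "class_coeff v' m = - complex_of_real (s n) * class_coeff v m" for m
      unfolding cfv v'_def
      by (simp add: class_coeff_add class_coeff_scale L2_scale_closed basis_class_L2 wL cfz class_coeff_basis_class algebra_simps power2_eq_square)
    have "(\<lambda>m. - complex_of_real (s n) * (class_coeff v m * cnj (class_coeff v m))) sums L2_inner M v' v"
      using inner_sums[OF vL(2,1)] by (simp add: cfv' mult.assoc)
    moreover have "(\<lambda>m. - complex_of_real (s n) * (class_coeff v m * cnj (class_coeff v m))) sums (- complex_of_real (s n) * L2_inner M v v)"
      by (intro sums_mult inner_sums vL)
    ultimately have "L2_inner M v' v = - complex_of_real (s n) * L2_inner M v v" by (rule sums_unique2)
    moreover have "0 \<le> Re (L2_inner M v' v)"
      using pos Sv unfolding L2_positive_def by (metis domI option.sel)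
    ultimately have "s n * Re (L2_inner M v v) \<le> 0" by simp
    then have le0: "Re (L2_inner M v v) \<le> 0" using s[of n] by (simp add: mult_le_0_iff)
    have "class_coeff v m = 0" for m
    proof -
      have "(cmod (class_coeff v m))\<^sup>2 \<le> Re (L2_inner M v v)"
        using inner_self[OF vL(1)] sum_le_suminf[OF class_coeff_summable[OF vL(1)], of "{m}"] by (simp add: sums_iff)
      then show ?thesis using le0 by (smt (verit) norm_eq_zero zero_le_power2 power2_eq_iff zero_power2)
    qed
    then have "class_coeff w m = complex_of_real (s n) * class_coeff (basis_class n) m" for m using cfv[of m] by simp
    then have "w = L2_scale M (complex_of_real (s n)) (basis_class n)"
      by (intro class_coeff_inject wL L2_scale_closed basis_class_L2) (simp add: class_coeff_scale basis_class_L2)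
    then show ?thesis using w by simp
  qed
  have basis_class_dom: "basis_class n \<in> dom S" for n using SE[of n] by blast
  \<comment> \<open>As \<open>S\<close> equals its adjoint, the description of the adjoint becomes a
    membership test for the graph of \<open>S\<close>.\<close>
  note adj_iff = adjoint_eq_Some_iff[OF basis_class_dom, unfolded adj]
  have sub: "diag_op s u = Some w" if uw: "S u = Some w" for u w
  proof -
    have "class_coeff w n = complex_of_real (s n) * class_coeff u n" for n
    proof -
      have "L2_inner M (L2_scale M (complex_of_real (s n)) (basis_class n)) u = L2_inner M (basis_class n) w"
        using uw[unfolded adj_iff] basis_class_dom[of n] SE[of n] by (metis option.sel)
      then have "cnj (class_coeff w n) = cnj (complex_of_real (s n) * class_coeff u n)"
        by (simp add: inner_scale_basis_class inner_basis_class_left S_L2[OF uw])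
      then show ?thesis by (simp only: complex_cnj_cancel_iff)
    qed
    then show ?thesis using S_L2[OF uw] by (simp add: diag_op_eq_Some_iff)
  qed
  show ?thesis
  proof (rule map_eqI)
    fix u w
    \<comment> \<open>Maximality: \<open>u\<close> and \<open>w\<close> satisfy the adjoint relation
      against all of \<open>dom S\<close>, because \<open>diag_op s\<close> is symmetric and extends
      \<open>S\<close>.\<close>
    have "S u = Some w" if D: "diag_op s u = Some w"
      unfolding adj_iff
    proof (intro conjI ballI)
      show "u \<in> L2 M" "w \<in> L2 M" using D by (auto simp: diag_op_eq_Some_iff)
      fix x assume "x \<in> dom S"
      then obtain y where "S x = Some y" by blast
      then show "L2_inner M (the (S x)) u = L2_inner M x w"
        using diag_op_symmetric[OF sub D] by simp
    qed
    then show "S u = Some w \<longleftrightarrow> diag_op s u = Some w" using sub by blast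
  qed
qed

theorem L2_sqrt_diag_op:
  assumes s: "\<And>n. s n > 0"
  shows "L2_sqrt M (diag_op (\<lambda>n. (s n)\<^sup>2)) = diag_op s"
  unfolding L2_sqrt_def
proof (rule the_equality)
  show "L2_self_adjoint M (diag_op s) \<and> L2_positive M (diag_op s) \<and> diag_op s \<circ>\<^sub>m diag_op s = diag_op (\<lambda>n. (s n)\<^sup>2)"
    using diag_op_self_adjoint diag_op_positive[of s] diag_op_square s by (auto simp: less_imp_le)
qed (use positive_sqrt_unique[of s] s in blast)

end

section \<open>The antiperiodic exponentials\<close>

lemma continuous_on_imp_L2_fun:
  assumes "continuous_on {a..b::real} f"
  shows "f \<in> L2_fun (lebesgue_on {a..b})"
proof -
  have "bounded (f ` {a..b})"
    by (intro compact_imp_bounded compact_continuous_image assms) auto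
  then obtain C where "\<forall>y\<in>f ` {a..b}. cmod y \<le> C" unfolding bounded_iff by blast
  then have C: "\<And>x. x \<in> {a..b} \<Longrightarrow> cmod (f x) \<le> C" by blast
  show ?thesis
  proof (rule L2_fun_bounded)
    show "f \<in> borel_measurable (lebesgue_on {a..b})"
      by (rule continuous_imp_measurable_on_sets_lebesgue[OF assms]) auto
    show "integrable (lebesgue_on {a..b}) (\<lambda>x. C\<^sup>2)"
      by (intro finite_measure.integrable_const finite_measure_lebesgue_on) auto
    have "(cmod (f x))\<^sup>2 \<le> C\<^sup>2" if "x \<in> {a..b}" for x
      using C[OF that] by (intro power_mono) auto
    then show "AE x in lebesgue_on {a..b}. (cmod (f x))\<^sup>2 \<le> C\<^sup>2"
      by (intro AE_I2) auto
  qed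
qed

lemma L2_ip_eq_integral:
  assumes "f \<in> L2_fun (lebesgue_on {a..b::real})" "g \<in> L2_fun (lebesgue_on {a..b})"
  shows "L2_ip (lebesgue_on {a..b}) f g = integral {a..b} (\<lambda>x. f x * cnj (g x))"
    "(\<lambda>x. f x * cnj (g x)) integrable_on {a..b}"
proof -
  note i = integrable_L2_ip[OF assms]
  show "L2_ip (lebesgue_on {a..b}) f g = integral {a..b} (\<lambda>x. f x * cnj (g x))"
    unfolding L2_ip_def by (rule lebesgue_integral_eq_integral[OF i]) auto
  show "(\<lambda>x. f x * cnj (g x)) integrable_on {a..b}"
    by (rule integrable_on_lebesgue_on[OF i]) auto
qed

section \<open>Laurent polynomials on the unit circle\<close>

text \<open>Closure under sums of monomials is all that the definition demands, so linear facts such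
  as orthogonality follow by a two-case induction.\<close>

inductive laurent :: "(complex \<Rightarrow> complex) \<Rightarrow> bool" where
  laurent_mono: "laurent (\<lambda>z. c * z powi m)"
| laurent_add: "laurent p \<Longrightarrow> laurent q \<Longrightarrow> laurent (\<lambda>z. p z + q z)"

text \<open>Agreement is claimed off 0 only, because \<open>0 powi m\<close> does not obey the
  addition law for exponents of opposite sign.\<close>

lemma laurent_mult:
  assumes "laurent p" "laurent q"
  shows "\<exists>r. laurent r \<and> (\<forall>z. z \<noteq> 0 \<longrightarrow> r z = p z * q z)"
  using assms(1)
proof induction
  case (laurent_mono c m)
  from assms(2) show ?case
  proof induction
    case (laurent_mono d n)
    have "laurent (\<lambda>z. (c * d) * z powi (m + n))" by (rule laurent.laurent_mono)
    then show ?case by (intro exI[of _ "\<lambda>z. (c * d) * z powi (m + n)"]) (auto simp: power_int_add)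
  next
    case (laurent_add q1 q2)
    then obtain r1 r2 where r: "laurent r1" "laurent r2"
      "\<And>z. z \<noteq> 0 \<Longrightarrow> r1 z = c * z powi m * q1 z" "\<And>z. z \<noteq> 0 \<Longrightarrow> r2 z = c * z powi m * q2 z" by auto
    show ?case
      by (intro exI[of _ "\<lambda>z. r1 z + r2 z"]) (use r laurent.laurent_add[OF r(1,2)] in \<open>auto simp: distrib_left\<close>)
  qed
next
  case (laurent_add p1 p2)
  then obtain r1 r2 where r: "laurent r1" "laurent r2"
    "\<And>z. z \<noteq> 0 \<Longrightarrow> r1 z = p1 z * q z" "\<And>z. z \<noteq> 0 \<Longrightarrow> r2 z = p2 z * q z" by auto
  show ?case
    by (intro exI[of _ "\<lambda>z. r1 z + r2 z"]) (use r laurent.laurent_add[OF r(1,2)] in \<open>auto simp: distrib_right\<close>)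
qed

lemma real_polynomial_function_laurent:
  fixes p :: "complex \<Rightarrow> real"
  assumes "real_polynomial_function p"
  shows "\<exists>q. laurent q \<and> (\<forall>z\<in>sphere 0 1. complex_of_real (p z) = q z)"
  using assms
proof induction
  case (linear h)
  define \<alpha> \<beta> where "\<alpha> = complex_of_real (h 1)" and "\<beta> = complex_of_real (h \<i>)"
  \<comment> \<open>On the circle the conjugate is the inverse, so
    \<open>Re z = (z + 1/z) / 2\<close> and \<open>Im z = (z - 1/z) / (2i)\<close>; these are the
    coefficients of \<open>Re z * \<alpha> + Im z * \<beta>\<close>.\<close>
  let ?q = "\<lambda>z. (\<alpha> / 2 - \<i> * \<beta> / 2) * z powi 1 + (\<alpha> / 2 + \<i> * \<beta> / 2) * z powi (-1)"
  have "laurent ?q" by (intro laurent_add laurent_mono)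
  moreover have "complex_of_real (h z) = ?q z" if z: "z \<in> sphere 0 1" for z
  proof -
    have "z = Re z *\<^sub>R 1 + Im z *\<^sub>R \<i>" by (simp add: complex_eq_iff)
    then have "h z = h (Re z *\<^sub>R 1 + Im z *\<^sub>R \<i>)" by (rule arg_cong)
    also have "\<dots> = Re z * h 1 + Im z * h \<i>"
      using bounded_linear.linear[OF linear] by (simp only: linear_add linear_scale real_scaleR_def)
    finally have "h z = Re z * h 1 + Im z * h \<i>" .
    then have hz: "complex_of_real (h z) = complex_of_real (Re z) * \<alpha> + complex_of_real (Im z) * \<beta>"
      by (simp add: \<alpha>_def \<beta>_def)
    have "z \<noteq> 0" using z by auto
    have "z * cnj z = 1" using z by (simp flip: complex_norm_square)
    then have inv: "z powi (-1) = cnj z"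
      using \<open>z \<noteq> 0\<close> by (simp add: power_int_minus field_simps)
    show ?thesis unfolding hz inv
      by (simp add: complex_eq_iff algebra_simps add_divide_distrib diff_divide_distrib)
  qed
  ultimately show ?case by (intro exI[of _ ?q]) auto
next
  case (const c)
  have "laurent (\<lambda>z. complex_of_real c * z powi 0)" by (rule laurent_mono)
  then show ?case by (intro exI[of _ "\<lambda>z. complex_of_real c * z powi 0"]) auto
next
  case (add f g)
  then obtain p q where "laurent p" "laurent q" "\<And>z. z \<in> sphere 0 1 \<Longrightarrow> complex_of_real (f z) = p z"
     "\<And>z. z \<in> sphere 0 1 \<Longrightarrow> complex_of_real (g z) = q z" by blast
  then show ?case by (intro exI[of _ "\<lambda>z. p z + q z"]) (auto intro: laurent_add)
next
  case (mult f g)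
  then obtain p q where pq: "laurent p" "laurent q" "\<And>z. z \<in> sphere 0 1 \<Longrightarrow> complex_of_real (f z) = p z"
     "\<And>z. z \<in> sphere 0 1 \<Longrightarrow> complex_of_real (g z) = q z" by blast
  obtain r where r: "laurent r" "\<And>z. z \<noteq> 0 \<Longrightarrow> r z = p z * q z" using laurent_mult[OF pq(1,2)] by blast
  have "complex_of_real (f z * g z) = r z" if z: "z \<in> sphere 0 1" for z
  proof -
    have "z \<noteq> 0" using z by auto
    then show ?thesis using pq(3,4)[OF z] r(2) by simp
  qed
  then show ?case using r(1) by blast
qed

lemma laurent_dense_on_circle:
  fixes G :: "complex \<Rightarrow> complex"
  assumes G: "continuous_on (sphere 0 1) G" and \<delta>: "\<delta> > 0"
  obtains q where "laurent q" "\<And>z. z \<in> sphere 0 1 \<Longrightarrow> cmod (G z - q z) < \<delta>"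
proof -
  obtain g where g: "polynomial_function g" "\<And>z. z \<in> sphere 0 1 \<Longrightarrow> cmod (G z - g z) < \<delta>"
    using Stone_Weierstrass_polynomial_function[OF compact_sphere G \<delta>] by blast
  have "real_polynomial_function (Re \<circ> g)" "real_polynomial_function (Im \<circ> g)"
    using g(1) bounded_linear_Re bounded_linear_Im unfolding polynomial_function_def by blast+
  then obtain p q where pq: "laurent p" "laurent q"
     "\<And>z. z \<in> sphere 0 1 \<Longrightarrow> complex_of_real (Re (g z)) = p z"
     "\<And>z. z \<in> sphere 0 1 \<Longrightarrow> complex_of_real (Im (g z)) = q z"
    using real_polynomial_function_laurent[of "Re \<circ> g"] real_polynomial_function_laurent[of "Im \<circ> g"] by auto
  \<comment> \<open>The constant \<open>\<i>\<close> is taken as a monomial of exponent 0, so that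
    recombining real and imaginary parts is a Laurent product.\<close>
  have "laurent (\<lambda>z. \<i> * z powi 0)" by (rule laurent_mono)
  then obtain r where r: "laurent r" "\<And>z. z \<noteq> 0 \<Longrightarrow> r z = \<i> * z powi 0 * q z"
    using laurent_mult[OF _ pq(2)] by blast
  show thesis
  proof (rule that[OF laurent_add[OF pq(1) r(1)]])
    fix z :: complex assume z: "z \<in> sphere 0 1"
    then have "z \<noteq> 0" by auto
    then have "p z + r z = g z"
      using pq(3,4)[OF z] r(2)[of z] by (simp add: complex_eq_iff flip: pq(3)[OF z] pq(4)[OF z])
    then show "cmod (G z - (p z + r z)) < \<delta>" using g(2)[OF z] by simp
  qed
qed

text \<open>Odd multiples of \<open>pi / (b - a)\<close>: over the length of the interval the phase
  advances by an odd multiple of \<open>pi\<close>, which is a change of sign.\<close>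

definition antiper_freq :: "real \<Rightarrow> real \<Rightarrow> int \<Rightarrow> real" where
  "antiper_freq a b m = (2 * of_int m + 1) * pi / (b - a)"

definition antiper_exp :: "real \<Rightarrow> real \<Rightarrow> int \<Rightarrow> real \<Rightarrow> complex" where
  "antiper_exp a b m x = cis (antiper_freq a b m * (x - a)) / complex_of_real (sqrt (b - a))"

lemma antiper_freq_inj: "a < b \<Longrightarrow> antiper_freq a b m = antiper_freq a b n \<longleftrightarrow> m = n"
  by (auto simp: antiper_freq_def)

lemma antiper_freq_nonzero: "a < b \<Longrightarrow> antiper_freq a b m \<noteq> 0"
proof
  assume "a < b" "antiper_freq a b m = 0"
  then have "real_of_int (2 * m + 1) = 0" by (simp add: antiper_freq_def)
  then have "2 * m + 1 = 0" by (simp only: of_int_eq_0_iff)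
  then show False by presburger
qed

lemma antiper_exp_at_a: "antiper_exp a b m a = 1 / complex_of_real (sqrt (b - a))"
  by (simp add: antiper_exp_def)

lemma antiper_exp_at_b: 
  assumes "a < b"
  shows "antiper_exp a b m b = - 1 / complex_of_real (sqrt (b - a))"
proof -
  have "antiper_freq a b m * (b - a) = 2 * pi * of_int m + pi"
    using assms by (simp add: antiper_freq_def field_simps)
  then have "cis (antiper_freq a b m * (b - a)) = cis (2 * pi * of_int m) * cis pi" by (simp only: cis_mult)
  also have "cis (2 * pi * of_int m) = 1" by (rule cis_multiple_2pi) auto
  finally show ?thesis by (simp add: antiper_exp_def)
qed

lemma antiper_exp_has_vector_derivative:
  "(antiper_exp a b m has_vector_derivative (\<i> * complex_of_real (antiper_freq a b m) * antiper_exp a b m x)) (at x within S)"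
proof -
  let ?w = "\<i> * complex_of_real (antiper_freq a b m)"
  define c where "c = 1 / complex_of_real (sqrt (b - a))"
  have eq: "antiper_exp a b m = (\<lambda>x. exp (?w * (complex_of_real x - complex_of_real a)) * c)"
    by (auto simp: antiper_exp_def cis_conv_exp mult.assoc c_def)
  have "((\<lambda>z. exp (?w * (z - complex_of_real a)) * c) has_field_derivative
     ?w * (exp (?w * (complex_of_real x - complex_of_real a)) * c)) (at (complex_of_real x))"
    by (auto intro!: derivative_eq_intros)
  from has_vector_derivative_real_field[OF this]
  show ?thesis unfolding eq by (rule has_vector_derivative_at_within)
qed

lemma cmod_antiper_exp: "a < b \<Longrightarrow> cmod (antiper_exp a b m x) = 1 / sqrt (b - a)"
  by (simp add: antiper_exp_def norm_divide)

lemma continuous_on_antiper_exp [continuous_intros]: "continuous_on S (antiper_exp a b m)"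
  by (rule continuous_on_vector_derivative[OF antiper_exp_has_vector_derivative])

lemma antiper_exp_L2: "antiper_exp a b m \<in> L2_fun (lebesgue_on {a..b})"
  by (intro continuous_on_imp_L2_fun continuous_intros)

lemma antiper_exp_lipschitz:
  assumes "a < b" "x \<le> y"
  shows "cmod (antiper_exp a b m y - antiper_exp a b m x) \<le> \<bar>antiper_freq a b m\<bar> / sqrt (b - a) * (y - x)"
proof -
  have "norm (antiper_exp a b m y - antiper_exp a b m x) \<le> norm (y - x) * (\<bar>antiper_freq a b m\<bar> / sqrt (b - a))"
    unfolding mult.commute[of "norm (y - x)"]
  proof (rule differentiable_bound[where S = UNIV and f' = "\<lambda>t h. h *\<^sub>R (\<i> * complex_of_real (antiper_freq a b m) * antiper_exp a b m t)"])
    show "(antiper_exp a b m has_derivative (\<lambda>h. h *\<^sub>R (\<i> * complex_of_real (antiper_freq a b m) * antiper_exp a b m t))) (at t within UNIV)" for t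
      using antiper_exp_has_vector_derivative by (simp add: has_vector_derivative_def)
    show "onorm (\<lambda>h. h *\<^sub>R (\<i> * complex_of_real (antiper_freq a b m) * antiper_exp a b m t)) \<le> \<bar>antiper_freq a b m\<bar> / sqrt (b - a)" for t
      using assms by (intro onorm_bound) (auto simp: norm_mult cmod_antiper_exp mult.commute)
  qed auto
  then show ?thesis using assms by (simp add: mult.commute)
qed

lemma antiper_exp_AC:
  assumes "a < b"
  shows "antiper_exp a b m \<in> AC a b"
proof -
  have "(\<lambda>x. 1 + integral {a..x} (\<lambda>x. 0)) \<in> AC a b"
    by (rule AC_indefinite_integral_L2) auto
  then have one: "(\<lambda>x. 1) \<in> AC a b" by simp
  show ?thesis
  proof (rule AC_dominated[OF one])
    show "\<bar>antiper_freq a b m\<bar> / sqrt (b - a) + 1 > 0" using assms by (intro add_nonneg_pos) auto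
    fix x y assume xy: "a \<le> x" "x \<le> y" "y \<le> b"
    have "cmod (antiper_exp a b m y - antiper_exp a b m x) \<le> \<bar>antiper_freq a b m\<bar> / sqrt (b - a) * (y - x)"
      by (rule antiper_exp_lipschitz[OF assms xy(2)])
    also have "\<dots> \<le> (\<bar>antiper_freq a b m\<bar> / sqrt (b - a) + 1) * (y - x)"
      using xy by (intro mult_right_mono) auto
    finally show "cmod (antiper_exp a b m y - antiper_exp a b m x) \<le> (\<bar>antiper_freq a b m\<bar> / sqrt (b - a) + 1) * (cmod (1 - 1) + (y - x))"
      by simp
  qed
qed

lemma deriv_on_eqI:
  assumes "a < b" "x \<in> {a..b}" "(f has_vector_derivative D) (at x within {a..b})"
  shows "deriv_on a b f x = D"
  using vector_derivative_within_cbox[of a b x f D] assms by (simp add: deriv_on_def)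

lemma L2_ip_deriv_on_antiper_exp:
  assumes ab: "a < b" and F: "F \<in> AC a b" "F a = - F b" and L2: "deriv_on a b F \<in> L2_fun (lebesgue_on {a..b})"
  shows "L2_ip (lebesgue_on {a..b}) (deriv_on a b F) (antiper_exp a b m) =
    \<i> * complex_of_real (antiper_freq a b m) * L2_ip (lebesgue_on {a..b}) F (antiper_exp a b m)"
proof -
  let ?\<phi> = "\<lambda>x. cnj (antiper_exp a b m x)" and ?\<omega> = "\<i> * complex_of_real (antiper_freq a b m)"
  let ?\<phi>' = "\<lambda>x. cnj (?\<omega> * antiper_exp a b m x)"
  \<comment> \<open>One constant serving both as a bound on the exponential and as a Lipschitz
    constant.\<close>
  define B where "B = 1 / sqrt (b - a) + \<bar>antiper_freq a b m\<bar> / sqrt (b - a)"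
  have FL2: "F \<in> L2_fun (lebesgue_on {a..b})" by (intro continuous_on_imp_L2_fun AC_continuous_on F)
  have "((\<lambda>x. deriv_on a b F x * ?\<phi> x + F x * ?\<phi>' x) has_integral (F b * ?\<phi> b - F a * ?\<phi> a)) {a..b}"
  proof (rule AC_integration_by_parts[OF F(1) ab, of B])
    show "B \<ge> 0" using ab by (simp add: B_def)
    show "cmod (?\<phi> x) \<le> B" for x using ab by (simp add: B_def cmod_antiper_exp)
    show "cmod (?\<phi> y - ?\<phi> x) \<le> B * (y - x)" if "x \<le> y" for x y
    proof -
      have "cmod (?\<phi> y - ?\<phi> x) = cmod (antiper_exp a b m y - antiper_exp a b m x)"
        by (metis complex_cnj_diff complex_mod_cnj)
      also have "\<dots> \<le> \<bar>antiper_freq a b m\<bar> / sqrt (b - a) * (y - x)" by (rule antiper_exp_lipschitz[OF ab that])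
      also have "\<dots> \<le> B * (y - x)" using that ab by (intro mult_right_mono) (auto simp: B_def)
      finally show ?thesis .
    qed
    show "(?\<phi> has_vector_derivative ?\<phi>' x) (at x)" for x
      by (intro has_vector_derivative_cnj antiper_exp_has_vector_derivative)
  qed
  moreover have "F b * ?\<phi> b - F a * ?\<phi> a = 0"
    using ab F(2) by (simp add: antiper_exp_at_a antiper_exp_at_b)
  ultimately have "0 = integral {a..b} (\<lambda>x. deriv_on a b F x * ?\<phi> x + F x * ?\<phi>' x)"
    by (simp add: integral_unique)
  also have "\<dots> = integral {a..b} (\<lambda>x. deriv_on a b F x * ?\<phi> x + cnj ?\<omega> * (F x * ?\<phi> x))"
    by (simp add: mult_ac)
  also have "\<dots> = L2_ip (lebesgue_on {a..b}) (deriv_on a b F) (antiper_exp a b m)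
      + cnj ?\<omega> * L2_ip (lebesgue_on {a..b}) F (antiper_exp a b m)"
    unfolding L2_ip_eq_integral(1)[OF L2 antiper_exp_L2] L2_ip_eq_integral(1)[OF FL2 antiper_exp_L2]
      integral_mult_right[symmetric]
    by (intro integral_add L2_ip_eq_integral(2) integrable_on_mult_right L2 FL2 antiper_exp_L2)
  finally show ?thesis by (simp add: algebra_simps add_eq_0_iff)
qed

text \<open>Off the diagonal, the derivative formula is applied to an exponential itself: the inner
  product is multiplied by the frequency of \<open>m\<close> on one side and by that of
  \<open>n\<close> on the other, so it vanishes.\<close>

lemma antiper_exp_orthonormal:
  assumes ab: "a < b"
  shows "L2_ip (lebesgue_on {a..b}) (antiper_exp a b m) (antiper_exp a b n) = (if m = n then 1 else 0)"
proof (cases "m = n")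
  case True
  have "antiper_exp a b n x * cnj (antiper_exp a b n x) = complex_of_real (1 / (b - a))" for x
    unfolding complex_norm_square[symmetric] cmod_antiper_exp[OF ab] using ab by (simp add: power_divide)
  then show ?thesis
    using ab True by (simp add: L2_ip_eq_integral antiper_exp_L2 scaleR_conv_of_real flip: of_real_diff)
next
  case False
  let ?M = "lebesgue_on {a..b}" and ?w = "\<lambda>m. \<i> * complex_of_real (antiper_freq a b m)"
  have der: "deriv_on a b (antiper_exp a b m) x = ?w m * antiper_exp a b m x" if "x \<in> {a..b}" for x
    by (rule deriv_on_eqI[OF ab that antiper_exp_has_vector_derivative])
  have AE: "AE x in ?M. deriv_on a b (antiper_exp a b m) x = ?w m * antiper_exp a b m x"
    using der by (intro AE_I2) auto
  have wL2: "(\<lambda>x. ?w m * antiper_exp a b m x) \<in> L2_fun ?M" by (intro L2_fun_scale antiper_exp_L2)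
  have meas: "deriv_on a b (antiper_exp a b m) \<in> borel_measurable ?M"
    using measurable_cong[of ?M "deriv_on a b (antiper_exp a b m)" "\<lambda>x. ?w m * antiper_exp a b m x" borel] der L2_funD(1)[OF wL2]
    by auto
  have L2: "deriv_on a b (antiper_exp a b m) \<in> L2_fun ?M"
    by (rule L2_fun_AE_cong[OF wL2 meas AE])
  have "?w m * L2_ip ?M (antiper_exp a b m) (antiper_exp a b n) = L2_ip ?M (\<lambda>x. ?w m * antiper_exp a b m x) (antiper_exp a b n)"
    by (simp add: L2_ip_scale_left)
  also have "\<dots> = L2_ip ?M (deriv_on a b (antiper_exp a b m)) (antiper_exp a b n)"
    using AE by (intro L2_ip_cong_AE meas L2_funD(1) wL2 antiper_exp_L2) auto
  also have "\<dots> = ?w n * L2_ip ?M (antiper_exp a b m) (antiper_exp a b n)"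
    using ab by (intro L2_ip_deriv_on_antiper_exp antiper_exp_AC L2) (auto simp: antiper_exp_at_a antiper_exp_at_b)
  finally have "complex_of_real (antiper_freq a b m - antiper_freq a b n) * L2_ip ?M (antiper_exp a b m) (antiper_exp a b n) = 0"
    by (simp add: algebra_simps)
  then show ?thesis using False antiper_freq_inj[OF ab, of m n] by (simp flip: of_real_diff)
qed

section \<open>Completeness of the antiperiodic exponentials\<close>

text \<open>\<open>Arg2pi\<close> jumps at 1, and closedness of the loop repairs the jump. The
  constant homotopy of \<open>H\<close> delivers continuity through the correspondence between loops
  and maps on the circle.\<close>

lemma continuous_on_circle_of_loop:
  fixes H :: "real \<Rightarrow> complex"
  assumes "continuous_on {0..1} H" "H 0 = H 1"
  shows "continuous_on (sphere 0 1) (\<lambda>z. H (Arg2pi z / (2 * pi)))"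
proof -
  have "homotopic_loops UNIV H H"
    using assms by (simp add: homotopic_loops_refl path_def pathstart_def pathfinish_def)
  from homotopic_loops_imp_homotopic_circlemaps[OF this]
  have "continuous_map (top_of_set (sphere 0 1)) (top_of_set UNIV) (H \<circ> (\<lambda>z. Arg2pi z / (2 * pi)))"
    using homotopic_with_imp_continuous_maps by blast
  then show ?thesis by (simp add: o_def)
qed

lemma L2_ip_add_right:
  assumes "f \<in> L2_fun M" "g \<in> L2_fun M" "h \<in> L2_fun M"
  shows "L2_ip M f (\<lambda>x. g x + h x) = L2_ip M f g + L2_ip M f h"
  by (subst (1 2 3) L2_ip_cnj) (simp add: L2_ip_add_left assms)

lemma L2_ip_scale_right: "L2_ip M f (\<lambda>x. c * g x) = cnj c * L2_ip M f g"
  by (subst (1 2) L2_ip_cnj) (simp add: L2_ip_scale_left)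

text \<open>Removing the factor \<open>\<epsilon>\<close> turns \<open>F\<close> into a periodic function, that is, a continuous function on the
  circle, which Stone-Weierstrass approximates uniformly by Laurent polynomials.\<close>

lemma continuous_antiperiodic_eq_0:
  assumes ab: "a < b" and F: "continuous_on {a..b} F" and anti: "F a = - F b"
    and zero: "\<And>m. L2_ip (lebesgue_on {a..b}) F (antiper_exp a b m) = 0"
    and x: "x \<in> {a..b}"
  shows "F x = 0"
proof -
  let ?M = "lebesgue_on {a..b}"
  \<comment> \<open>\<open>\<zeta>\<close> runs once round the circle while
    \<open>\<epsilon>\<close> runs half round it, so \<open>\<zeta>\<close> to the power
    \<open>m\<close> times \<open>\<epsilon>\<close> has the odd frequency
    \<open>2 * m + 1\<close>.\<close>
  define \<theta> where "\<theta> x = (x - a) / (b - a)" for x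
  define \<zeta> where "\<zeta> x = cis (2 * pi * \<theta> x)" for x
  define \<epsilon> where "\<epsilon> x = cis (pi * \<theta> x)" for x
  have FL2: "F \<in> L2_fun ?M" by (rule continuous_on_imp_L2_fun[OF F])
  have mono_eq: "\<zeta> x powi m * \<epsilon> x = complex_of_real (sqrt (b - a)) * antiper_exp a b m x" for m x
  proof -
    have "\<zeta> x powi m * \<epsilon> x = cis (of_int m * (2 * pi * \<theta> x) + pi * \<theta> x)"
      unfolding \<zeta>_def \<epsilon>_def cis_power_int cis_mult ..
    also have "of_int m * (2 * pi * \<theta> x) + pi * \<theta> x = (2 * of_int m + 1) * pi * \<theta> x"
      by (simp add: algebra_simps)
    also have "\<dots> = antiper_freq a b m * (x - a)" by (simp add: \<theta>_def antiper_freq_def)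
    finally show ?thesis using ab by (simp add: antiper_exp_def)
  qed
  have lau: "continuous_on {a..b} (\<lambda>x. p (\<zeta> x) * \<epsilon> x) \<and> L2_ip ?M F (\<lambda>x. p (\<zeta> x) * \<epsilon> x) = 0"
    if "laurent p" for p
    using that
  proof induction
    case (laurent_mono c m)
    have eq: "(\<lambda>x. c * \<zeta> x powi m * \<epsilon> x) = (\<lambda>x. (c * complex_of_real (sqrt (b - a))) * antiper_exp a b m x)"
      by (simp add: mono_eq mult.assoc)
    show ?case unfolding eq
      by (auto intro!: continuous_intros simp: L2_ip_scale_right zero)
  next
    case (laurent_add p q)
    then have c: "continuous_on {a..b} (\<lambda>x. p (\<zeta> x) * \<epsilon> x)" "continuous_on {a..b} (\<lambda>x. q (\<zeta> x) * \<epsilon> x)" by auto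
    have "L2_ip ?M F (\<lambda>x. p (\<zeta> x) * \<epsilon> x + q (\<zeta> x) * \<epsilon> x) = 0"
      unfolding L2_ip_add_right[OF FL2 continuous_on_imp_L2_fun[OF c(1)] continuous_on_imp_L2_fun[OF c(2)]]
      using laurent_add by simp
    then show ?case using continuous_on_add[OF c] by (simp add: distrib_right)
  qed
  define H where "H t = F (a + (b - a) * t) * cis (- (pi * t))" for t
  have "continuous_on {0..1} (\<lambda>t. F (a + (b - a) * t))"
  proof (rule continuous_on_compose2[OF F])
    show "continuous_on {0..1} (\<lambda>t. a + (b - a) * t)" by (intro continuous_intros)
    show "(\<lambda>t. a + (b - a) * t) ` {0..1} \<subseteq> {a..b}"
    proof (clarsimp)
      fix t :: real assume t: "0 \<le> t" "t \<le> 1"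
      have "(b - a) * t \<le> (b - a) * 1" using t ab by (intro mult_left_mono) auto
      then have "a + (b - a) * t \<le> b" by (simp only: mult_1_right)
      then show "0 \<le> (b - a) * t \<and> a + (b - a) * t \<le> b" using t ab by simp
    qed
  qed
  then have Hc: "continuous_on {0..1} H"
    unfolding H_def by (intro continuous_intros)
  have H01: "H 0 = H 1" using anti by (simp add: H_def flip: cis_inverse)
  define G where "G z = H (Arg2pi z / (2 * pi))" for z
  have Gc: "continuous_on (sphere 0 1) G"
    unfolding G_def by (rule continuous_on_circle_of_loop[OF Hc H01])
  have FG: "F y = G (\<zeta> y) * \<epsilon> y" if y: "y \<in> {a..b}" for y
  proof -
    have th: "0 \<le> \<theta> y" "\<theta> y \<le> 1" using y ab by (auto simp: \<theta>_def)
    have "G (\<zeta> y) = H (\<theta> y)"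
    \<comment> \<open>At the right endpoint \<open>\<zeta>\<close> is back at 1 and
      \<open>Arg2pi\<close> returns 0 instead of a full turn; \<open>H 0 = H 1\<close> bridges
      this.\<close>
    proof (cases "\<theta> y = 1")
      case True
      then have "\<zeta> y = 1" by (simp add: \<zeta>_def)
      moreover have "Arg2pi 1 = 0" by (rule Arg2pi_unique[of 1]) auto
      ultimately show ?thesis using True H01 by (simp add: G_def)
    next
      case False
      then have "2 * pi * \<theta> y < 2 * pi * 1" using th by (intro mult_strict_left_mono) auto
      then have "Arg2pi (\<zeta> y) = 2 * pi * \<theta> y"
        using th by (intro Arg2pi_unique[of 1]) (auto simp: \<zeta>_def cis_conv_exp)
      then show ?thesis by (simp add: G_def)
    qed
    moreover have "a + (b - a) * \<theta> y = y" using ab by (simp add: \<theta>_def)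
    ultimately show ?thesis by (simp add: H_def \<epsilon>_def mult.assoc cis_mult)
  qed
  have small: "L2_sqnorm ?M F \<le> \<delta>\<^sup>2 * (b - a)" if \<delta>: "\<delta> > 0" for \<delta>
  proof -
    obtain q where q: "laurent q" "\<And>z. z \<in> sphere 0 1 \<Longrightarrow> cmod (G z - q z) < \<delta>"
      using laurent_dense_on_circle[OF Gc \<delta>] by blast
    let ?q = "\<lambda>x. q (\<zeta> x) * \<epsilon> x"
    have qc: "continuous_on {a..b} ?q" and q0: "L2_ip ?M F ?q = 0" using lau[OF q(1)] by auto
    have qL2: "?q \<in> L2_fun ?M" by (rule continuous_on_imp_L2_fun[OF qc])
    \<comment> \<open>By orthogonality to all exponentials, subtracting the approximant can only
      increase the norm of \<open>F\<close>, whereas uniform closeness makes the difference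
      small.\<close>
    have "L2_sqnorm ?M (\<lambda>x. F x - 1 * ?q x) = L2_sqnorm ?M F + L2_sqnorm ?M ?q"
      by (subst L2_sqnorm_diff_scale[OF FL2 qL2]) (simp add: q0)
    then have "L2_sqnorm ?M F \<le> L2_sqnorm ?M (\<lambda>x. F x - ?q x)" using L2_sqnorm_nonneg[of ?M ?q] by simp
    also have "\<dots> \<le> (LINT x|?M. \<delta>\<^sup>2)"
      unfolding L2_sqnorm_def
    proof (rule integral_mono)
      show "integrable ?M (\<lambda>x. (cmod (F x - ?q x))\<^sup>2)" by (rule L2_funD(2)[OF L2_fun_diff[OF FL2 qL2]])
      show "integrable ?M (\<lambda>x. \<delta>\<^sup>2)"
        by (intro finite_measure.integrable_const finite_measure_lebesgue_on) auto
      fix y assume "y \<in> space ?M"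
      then have y: "y \<in> {a..b}" by simp
      have "F y - ?q y = (G (\<zeta> y) - q (\<zeta> y)) * \<epsilon> y" by (simp add: FG[OF y] left_diff_distrib)
      then have "cmod (F y - ?q y) = cmod (G (\<zeta> y) - q (\<zeta> y))" by (simp add: norm_mult \<epsilon>_def)
      also have "\<dots> < \<delta>" by (rule q(2)) (simp add: \<zeta>_def)
      finally show "(cmod (F y - ?q y))\<^sup>2 \<le> \<delta>\<^sup>2" by (intro power_mono) auto
    qed
    also have "\<dots> = \<delta>\<^sup>2 * (b - a)"
      using ab by (simp add: measure_restrict_space mult.commute)
    finally show ?thesis .
  qed
  have "L2_sqnorm ?M F = 0"
  proof (rule ccontr)
    assume "L2_sqnorm ?M F \<noteq> 0"
    then have pos: "L2_sqnorm ?M F > 0" using L2_sqnorm_nonneg[of ?M F] by simp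
    define \<delta> where "\<delta> = sqrt (L2_sqnorm ?M F / (2 * (b - a)))"
    have "\<delta> > 0" using pos ab by (simp add: \<delta>_def)
    moreover have "\<delta>\<^sup>2 * (b - a) = L2_sqnorm ?M F / 2" using pos ab by (simp add: \<delta>_def field_simps)
    ultimately show False using small[of \<delta>] pos by simp
  qed
  moreover have "L2_sqnorm ?M F = integral {a..b} (\<lambda>x. (cmod (F x))\<^sup>2)"
    unfolding L2_sqnorm_def by (rule lebesgue_integral_eq_integral[OF L2_funD(2)[OF FL2]]) auto
  \<comment> \<open>Continuity turns a vanishing integral into vanishing at every point, not merely
    almost everywhere.\<close>
  ultimately have "\<forall>y\<in>{a..b}. (cmod (F y))\<^sup>2 = 0"
    using ab F by (subst integral_eq_0_iff[symmetric]) (auto intro!: continuous_intros)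
  then show ?thesis using x by simp
qed

lemma AE_lebesgue_on_of_negligible:
  assumes "negligible N" "\<And>x. x \<in> S - N \<Longrightarrow> P x" "S \<in> sets lebesgue"
  shows "AE x in lebesgue_on S. P x"
proof -
  have "N \<in> null_sets lebesgue" using assms(1) by (simp add: negligible_iff_null_sets)
  then have "AE x in lebesgue. x \<notin> N" by (rule AE_not_in)
  then have "AE x in lebesgue. x \<in> S \<longrightarrow> P x"
    by eventually_elim (use assms(2) in blast)
  then show ?thesis using assms(3) by (subst AE_restrict_space_iff) auto
qed

text \<open>No mean-value condition on \<open>g\<close> arises, unlike for periodic primitives: a
  suitable constant of integration always makes the endpoint values opposite.\<close>

lemma antiperiodic_primitive:
  assumes ab: "a < b" and g: "g \<in> L2_fun (lebesgue_on {a..b})"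
  obtains F where "F \<in> AC a b" "F a = - F b"
    "\<And>x. x \<in> {a..b} \<Longrightarrow> F x = F a + integral {a..x} g"
    "AE x in lebesgue_on {a..b}. deriv_on a b F x = g x" "deriv_on a b F \<in> L2_fun (lebesgue_on {a..b})"
    "\<And>m. L2_ip (lebesgue_on {a..b}) g (antiper_exp a b m) =
        \<i> * complex_of_real (antiper_freq a b m) * L2_ip (lebesgue_on {a..b}) F (antiper_exp a b m)"
proof -
  let ?M = "lebesgue_on {a..b}"
  \<comment> \<open>Then \<open>F a\<close> equals \<open>c\<close>, and \<open>F b\<close> equals
    \<open>c - 2 * c\<close>, that is, \<open>- c\<close>.\<close>
  define c where "c = - integral {a..b} g / 2"
  define F where "F x = c + integral {a..x} g" for x
  have AC: "F \<in> AC a b" unfolding F_def [abs_def] by (rule AC_indefinite_integral_L2[OF g])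
  have anti: "F a = - F b" by (simp add: F_def c_def)
  have prim: "F x = F a + integral {a..x} g" for x by (simp add: F_def)
  obtain N where N: "negligible N" "\<And>x. x \<in> {a..b} - N \<Longrightarrow>
       ((\<lambda>u. integral {a..u} g) has_vector_derivative g x) (at x within {a..b})"
    using indefinite_integral_has_vector_derivative_AE[OF L2_fun_lebesgue_on_integrable(2)[OF g]] by blast
  have der: "deriv_on a b F x = g x" if x: "x \<in> {a..b} - N" for x
    using has_vector_derivative_add[OF has_vector_derivative_const[of c] N(2)[OF x]] x ab
    by (intro deriv_on_eqI) (auto simp: F_def [abs_def])
  then have AE: "AE x in ?M. deriv_on a b F x = g x"
    by (intro AE_lebesgue_on_of_negligible[OF N(1)]) auto
  have "g measurable_on {a..b}"
    using L2_funD(1)[OF g] by (subst measurable_on_iff_borel_measurable) auto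
  \<comment> \<open>\<open>deriv_on\<close> has arbitrary values on the exceptional set, so
    measurability comes from agreement with \<open>g\<close> off a negligible set.\<close>
  then have "deriv_on a b F measurable_on {a..b}"
    using der by (rule measurable_on_spike[OF _ N(1)])
  then have meas: "deriv_on a b F \<in> borel_measurable ?M"
    by (subst measurable_on_iff_borel_measurable[symmetric]) auto
  have L2: "deriv_on a b F \<in> L2_fun ?M" by (rule L2_fun_AE_cong[OF g meas AE])
  have "L2_ip ?M g (antiper_exp a b m) = \<i> * complex_of_real (antiper_freq a b m) * L2_ip ?M F (antiper_exp a b m)" for m
  proof -
    have "L2_ip ?M g (antiper_exp a b m) = L2_ip ?M (deriv_on a b F) (antiper_exp a b m)"
      using AE by (intro L2_ip_cong_AE meas L2_funD(1) g antiper_exp_L2) auto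
    then show ?thesis using L2_ip_deriv_on_antiper_exp[OF ab AC anti L2] by simp
  qed
  then show thesis using that AC anti prim AE L2 by blast
qed

text \<open>The coefficients of a primitive are those of \<open>f\<close> divided by nonzero
  numbers, so they vanish too. The primitive is continuous, hence zero everywhere, and so is its
  derivative, which equals \<open>f\<close> almost everywhere.\<close>

lemma antiper_exp_complete:
  assumes ab: "a < b" and f: "f \<in> L2_fun (lebesgue_on {a..b})"
    and zero: "\<And>m. L2_ip (lebesgue_on {a..b}) f (antiper_exp a b m) = 0"
  shows "AE x in lebesgue_on {a..b}. f x = 0"
proof -
  obtain F where F: "F \<in> AC a b" "F a = - F b" "AE x in lebesgue_on {a..b}. deriv_on a b F x = f x"
    and ip: "\<And>m. L2_ip (lebesgue_on {a..b}) f (antiper_exp a b m) =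
        \<i> * complex_of_real (antiper_freq a b m) * L2_ip (lebesgue_on {a..b}) F (antiper_exp a b m)"
    by (rule antiperiodic_primitive[OF ab f]) blast
  have F0: "F x = 0" if "x \<in> {a..b}" for x
  proof (rule continuous_antiperiodic_eq_0[OF ab AC_continuous_on[OF F(1)] F(2) _ that])
    show "L2_ip (lebesgue_on {a..b}) F (antiper_exp a b m) = 0" for m
      using ip[of m] zero[of m] antiper_freq_nonzero[OF ab, of m] by simp
  qed
  have "deriv_on a b F x = 0" if x: "x \<in> {a..b}" for x
  proof (rule deriv_on_eqI[OF ab x])
    show "(F has_vector_derivative 0) (at x within {a..b})"
      by (rule has_vector_derivative_transform[OF x _ has_vector_derivative_const[of 0]]) (simp add: F0)
  qed
  then have "AE x in lebesgue_on {a..b}. deriv_on a b F x = 0" by (intro AE_I2) auto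
  then show ?thesis using F(3) by eventually_elim simp
qed

text \<open>\<open>int_decode\<close> enumerates the integer indices by naturals, as
  \<open>L2_basis\<close> requires.\<close>

definition antiper_basis :: "real \<Rightarrow> real \<Rightarrow> nat \<Rightarrow> real \<Rightarrow> complex" where
  "antiper_basis a b n = antiper_exp a b (int_decode n)"

lemma L2_basis_antiper_basis:
  assumes "a < b"
  shows "L2_basis (lebesgue_on {a..b}) (antiper_basis a b)"
proof
  show "antiper_basis a b n \<in> L2_fun (lebesgue_on {a..b})" for n
    by (simp add: antiper_basis_def antiper_exp_L2)
  show "L2_ip (lebesgue_on {a..b}) (antiper_basis a b m) (antiper_basis a b n) = (if m = n then 1 else 0)" for m n
    by (simp add: antiper_basis_def antiper_exp_orthonormal[OF assms] inj_eq[OF inj_int_decode])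
  show "AE x in lebesgue_on {a..b}. f x = 0"
    if "f \<in> L2_fun (lebesgue_on {a..b})" "\<And>n. L2_ip (lebesgue_on {a..b}) f (antiper_basis a b n) = 0" for f
  proof (rule antiper_exp_complete[OF assms that(1)])
    show "L2_ip (lebesgue_on {a..b}) f (antiper_exp a b m) = 0" for m
      using that(2)[of "int_encode m"] by (simp add: antiper_basis_def)
  qed
qed

section \<open>The antiperiodic operator\<close>

lemma AC_cong:
  assumes "f \<in> AC a b" "\<And>x. x \<in> {a..b} \<Longrightarrow> g x = f x"
  shows "g \<in> AC a b"
  by (rule AC_dominated[OF assms(1) zero_less_one]) (auto simp: assms(2))

text \<open>Valid even where no derivative exists: both functions satisfy the same derivative
  predicate, so the value chosen from it is the same.\<close>

lemma deriv_on_cong: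
  assumes x: "x \<in> {a..b}" and eq: "\<And>x. x \<in> {a..b} \<Longrightarrow> g x = f x"
  shows "deriv_on a b g x = deriv_on a b f x"
proof -
  have "(g has_vector_derivative D) (at x within {a..b}) \<longleftrightarrow> (f has_vector_derivative D) (at x within {a..b})" for D
    using has_vector_derivative_transform[OF x, of g f D] has_vector_derivative_transform[OF x, of f g D] eq by auto
  then show ?thesis unfolding deriv_on_def vector_derivative_def by simp
qed

lemma L2_fun_cong:
  assumes "f \<in> L2_fun (lebesgue_on {a..b})" "\<And>x. x \<in> {a..b} \<Longrightarrow> g x = f x"
  shows "g \<in> L2_fun (lebesgue_on {a..b})"
proof (rule L2_fun_AE_cong[OF assms(1)])
  show "g \<in> borel_measurable (lebesgue_on {a..b})"
    using measurable_cong[of "lebesgue_on {a..b}" g f borel] assms(2) L2_funD(1)[OF assms(1)] by auto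
  show "AE x in lebesgue_on {a..b}. g x = f x"
    using assms(2) by (intro AE_I2) auto
qed

context
  fixes a b :: real
  assumes ab: "a < b"
begin

interpretation L2_basis "lebesgue_on {a..b}" "antiper_basis a b"
  by (rule L2_basis_antiper_basis[OF ab])

definition basis_freq :: "nat \<Rightarrow> real" where "basis_freq n = antiper_freq a b (int_decode n)"

lemma coeff_deriv_on:
  assumes "F \<in> AC a b" "F a = - F b" "deriv_on a b F \<in> L2_fun (lebesgue_on {a..b})"
  shows "coeff (deriv_on a b F) n = \<i> * complex_of_real (basis_freq n) * coeff F n"
  unfolding coeff_def antiper_basis_def basis_freq_def using assms by (intro L2_ip_deriv_on_antiper_exp ab)

text \<open>Converts a relation between coefficients into regularity. The antiperiodic primitive of
  \<open>g\<close> has the coefficients of \<open>f\<close>, so it is an absolutely continuous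
  representative of \<open>f\<close>.\<close>

lemma antiperiodic_primitive_of_coeff:
  assumes f: "f \<in> L2_fun (lebesgue_on {a..b})" and g: "g \<in> L2_fun (lebesgue_on {a..b})"
    and fg: "\<And>n. coeff g n = \<i> * complex_of_real (basis_freq n) * coeff f n"
  obtains F where "F \<in> AC a b" "F a = - F b"
    "\<And>x. x \<in> {a..b} \<Longrightarrow> F x = F a + integral {a..x} g"
    "deriv_on a b F \<in> L2_fun (lebesgue_on {a..b})" "AE x in (lebesgue_on {a..b}). F x = f x"
proof -
  obtain F where F: "F \<in> AC a b" "F a = - F b"
    "\<And>x. x \<in> {a..b} \<Longrightarrow> F x = F a + integral {a..x} g" "deriv_on a b F \<in> L2_fun (lebesgue_on {a..b})"
    and ip: "\<And>m. L2_ip (lebesgue_on {a..b}) g (antiper_exp a b m) = \<i> * complex_of_real (antiper_freq a b m) * L2_ip (lebesgue_on {a..b}) F (antiper_exp a b m)"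
    by (rule antiperiodic_primitive[OF ab g]) blast
  have "coeff F = coeff f"
  proof
    fix n
    have "\<i> * complex_of_real (basis_freq n) * coeff F n = \<i> * complex_of_real (basis_freq n) * coeff f n"
      unfolding fg[symmetric] unfolding coeff_def antiper_basis_def basis_freq_def ip ..
    then show "coeff F n = coeff f n" using antiper_freq_nonzero[OF ab] by (simp add: basis_freq_def)
  qed
  then have "AE x in (lebesgue_on {a..b}). F x = f x"
    by (intro coeff_eq_imp_AE_eq f continuous_on_imp_L2_fun AC_continuous_on F(1))
  then show thesis using that F by blast
qed

text \<open>Each term of the weighted series is the squared coefficient of the derivative plus
  \<open>k\<close> times that of \<open>f\<close>, so Bessel gives one inclusion. Conversely,
  Riesz-Fischer supplies the derivative, and its primitive is the required representative.\<close>

lemma form_domain_eq: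
  assumes k: "k > 0"
  shows "L2_class (lebesgue_on {a..b}) ` {f. f \<in> AC a b \<and> f a = - f b \<and> deriv_on a b f \<in> L2_fun (lebesgue_on {a..b})} =
    {u \<in> L2 (lebesgue_on {a..b}). summable (\<lambda>n. (cmod (complex_of_real (sqrt ((basis_freq n)\<^sup>2 + k)) * class_coeff u n))\<^sup>2)}"
proof (intro subset_antisym subsetI)
  fix u assume "u \<in> L2_class (lebesgue_on {a..b}) ` {f. f \<in> AC a b \<and> f a = - f b \<and> deriv_on a b f \<in> L2_fun (lebesgue_on {a..b})}"
  then obtain f where f: "f \<in> AC a b" "f a = - f b" "deriv_on a b f \<in> L2_fun (lebesgue_on {a..b})" and u: "u = L2_class (lebesgue_on {a..b}) f"
    by blast
  have fL2: "f \<in> L2_fun (lebesgue_on {a..b})" by (intro continuous_on_imp_L2_fun AC_continuous_on f)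
  have "summable (\<lambda>n. (cmod (coeff (deriv_on a b f) n))\<^sup>2 + k * (cmod (coeff f n))\<^sup>2)"
    by (intro summable_add summable_mult Bessel fL2 f)
  moreover have "(cmod (coeff (deriv_on a b f) n))\<^sup>2 + k * (cmod (coeff f n))\<^sup>2 =
      (cmod (complex_of_real (sqrt ((basis_freq n)\<^sup>2 + k)) * class_coeff u n))\<^sup>2" for n
    unfolding u class_coeff_class[OF fL2] coeff_deriv_on[OF f]
    using k by (simp add: norm_mult power_mult_distrib algebra_simps)
  ultimately show "u \<in> {u \<in> L2 (lebesgue_on {a..b}). summable (\<lambda>n. (cmod (complex_of_real (sqrt ((basis_freq n)\<^sup>2 + k)) * class_coeff u n))\<^sup>2)}"
    using L2_class_in_L2[OF fL2] u by simp
next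
  fix u assume "u \<in> {u \<in> L2 (lebesgue_on {a..b}). summable (\<lambda>n. (cmod (complex_of_real (sqrt ((basis_freq n)\<^sup>2 + k)) * class_coeff u n))\<^sup>2)}"
  then have u: "u \<in> L2 (lebesgue_on {a..b})" and sm: "summable (\<lambda>n. (cmod (complex_of_real (sqrt ((basis_freq n)\<^sup>2 + k)) * class_coeff u n))\<^sup>2)"
    by auto
  have "summable (\<lambda>n. (cmod (\<i> * complex_of_real (basis_freq n) * class_coeff u n))\<^sup>2)"
  proof (rule summable_comparison_test'[OF sm])
    fix n
    have "(basis_freq n)\<^sup>2 * (cmod (class_coeff u n))\<^sup>2 \<le> ((basis_freq n)\<^sup>2 + k) * (cmod (class_coeff u n))\<^sup>2"
      using k by (intro mult_right_mono) auto
    then show "norm ((cmod (\<i> * complex_of_real (basis_freq n) * class_coeff u n))\<^sup>2) \<le> (cmod (complex_of_real (sqrt ((basis_freq n)\<^sup>2 + k)) * class_coeff u n))\<^sup>2"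
      using k by (simp add: norm_mult power_mult_distrib)
  qed
  then obtain g where g: "g \<in> L2_fun (lebesgue_on {a..b})" "coeff g = (\<lambda>n. \<i> * complex_of_real (basis_freq n) * class_coeff u n)"
    by (rule Riesz_Fischer)
  obtain F where F: "F \<in> AC a b" "F a = - F b" "deriv_on a b F \<in> L2_fun (lebesgue_on {a..b})" "AE x in (lebesgue_on {a..b}). F x = L2_rep u x"
    by (rule antiperiodic_primitive_of_coeff[OF L2_rep_L2(1)[OF u] g(1) fun_cong[OF g(2)[unfolded class_coeff_def]]]) blast
  have "L2_class (lebesgue_on {a..b}) F = u" using L2_class_cong[OF F(4)] L2_rep_L2(2)[OF u] by simp
  then show "u \<in> L2_class (lebesgue_on {a..b}) ` {f. f \<in> AC a b \<and> f a = - f b \<and> deriv_on a b f \<in> L2_fun (lebesgue_on {a..b})}"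
    using F by blast
qed

lemma diag_op_class_antiper_domain:
  assumes "f \<in> antiper_domain a b"
  shows "diag_op (\<lambda>n. (basis_freq n)\<^sup>2 + k) (L2_class (lebesgue_on {a..b}) f) =
    Some (L2_class (lebesgue_on {a..b}) (\<lambda>x. - deriv_on a b (deriv_on a b f) x + complex_of_real k * f x))"
proof -
  have f: "f \<in> AC a b" "f a = - f b" and f': "deriv_on a b f \<in> AC a b" "deriv_on a b f a = - deriv_on a b f b"
    and f''L2: "deriv_on a b (deriv_on a b f) \<in> L2_fun (lebesgue_on {a..b})"
    using assms by (auto simp: antiper_domain_def)
  have fL2: "f \<in> L2_fun (lebesgue_on {a..b})" and f'L2: "deriv_on a b f \<in> L2_fun (lebesgue_on {a..b})"
    by (intro continuous_on_imp_L2_fun AC_continuous_on f f')+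
  let ?w = "\<lambda>x. (-1) * deriv_on a b (deriv_on a b f) x + complex_of_real k * f x"
  have wL2: "?w \<in> L2_fun (lebesgue_on {a..b})" by (intro L2_fun_add L2_fun_scale f''L2 fL2)
  have "coeff ?w n = complex_of_real ((basis_freq n)\<^sup>2 + k) * coeff f n" for n
  proof -
    have "coeff ?w n = (-1) * coeff (deriv_on a b (deriv_on a b f)) n + complex_of_real k * coeff f n"
      unfolding coeff_def L2_ip_add_left[OF L2_fun_scale[OF f''L2] L2_fun_scale[OF fL2] e_L2] L2_ip_scale_left ..
    then show ?thesis
      by (simp add: coeff_deriv_on[OF f' f''L2] coeff_deriv_on[OF f f'L2] power2_eq_square algebra_simps)
  qed
  then have "diag_op (\<lambda>n. (basis_freq n)\<^sup>2 + k) (L2_class (lebesgue_on {a..b}) f) = Some (L2_class (lebesgue_on {a..b}) ?w)"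
    unfolding diag_op_eq_Some_iff class_coeff_class[OF fL2] class_coeff_class[OF wL2] using fL2 wL2 by auto
  then show ?thesis by simp
qed

text \<open>The coefficients produce candidates \<open>g\<close> and \<open>h\<close> for the first
  and second derivative. Integrating twice recovers a representative of \<open>u\<close> with the
  boundary conditions built in at each stage.\<close>

lemma dom_diag_op_subset_antiper_domain:
  assumes k: "k > 0" and uw: "diag_op (\<lambda>n. (basis_freq n)\<^sup>2 + k) u = Some w"
  shows "u \<in> L2_class (lebesgue_on {a..b}) ` antiper_domain a b"
proof -
  have u: "u \<in> L2 (lebesgue_on {a..b})" and w: "w \<in> L2 (lebesgue_on {a..b})" and cw: "\<And>n. class_coeff w n = complex_of_real ((basis_freq n)\<^sup>2 + k) * class_coeff u n"
    using uw by (auto simp: diag_op_eq_Some_iff)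
  have norm_cw: "(cmod (class_coeff w n))\<^sup>2 = ((basis_freq n)\<^sup>2 + k)\<^sup>2 * (cmod (class_coeff u n))\<^sup>2" for n
    unfolding cw norm_mult norm_of_real power_mult_distrib by simp
  have "summable (\<lambda>n. (cmod (\<i> * complex_of_real (basis_freq n) * class_coeff u n))\<^sup>2)"
  proof (rule summable_comparison_test')
    show "summable (\<lambda>n. (cmod (class_coeff u n))\<^sup>2 + (cmod (class_coeff w n))\<^sup>2)"
      by (intro summable_add class_coeff_summable u w)
    fix n
    have "t \<le> 1 + t\<^sup>2" for t :: real
    proof -
      have "2 * t \<le> t\<^sup>2 + 1" using zero_le_power2[of "t - 1"] by (simp add: power2_diff)
      moreover have "0 \<le> t\<^sup>2" by simp
      ultimately show ?thesis by linarith
    qed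
    \<comment> \<open>The first derivative is controlled by \<open>u\<close> and \<open>w\<close>
      together, since \<open>t <= 1 + t^2\<close> at the eigenvalue.\<close>
    from this[of "(basis_freq n)\<^sup>2 + k"] have "(basis_freq n)\<^sup>2 * (cmod (class_coeff u n))\<^sup>2 \<le> (1 + ((basis_freq n)\<^sup>2 + k)\<^sup>2) * (cmod (class_coeff u n))\<^sup>2"
      using k by (intro mult_right_mono) auto
    then show "norm ((cmod (\<i> * complex_of_real (basis_freq n) * class_coeff u n))\<^sup>2) \<le> (cmod (class_coeff u n))\<^sup>2 + (cmod (class_coeff w n))\<^sup>2"
      unfolding norm_cw by (simp add: norm_mult power_mult_distrib distrib_right)
  qed
  then obtain g where g: "g \<in> L2_fun (lebesgue_on {a..b})" "coeff g = (\<lambda>n. \<i> * complex_of_real (basis_freq n) * class_coeff u n)"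
    by (rule Riesz_Fischer)
  have "summable (\<lambda>n. (cmod (\<i> * complex_of_real (basis_freq n) * coeff g n))\<^sup>2)"
  proof (rule summable_comparison_test'[OF class_coeff_summable[OF w]])
    fix n
    have "((basis_freq n)\<^sup>2)\<^sup>2 * (cmod (class_coeff u n))\<^sup>2 \<le> ((basis_freq n)\<^sup>2 + k)\<^sup>2 * (cmod (class_coeff u n))\<^sup>2"
      using k by (intro mult_right_mono power_mono) auto
    then show "norm ((cmod (\<i> * complex_of_real (basis_freq n) * coeff g n))\<^sup>2) \<le> (cmod (class_coeff w n))\<^sup>2"
      unfolding norm_cw by (simp add: g(2) norm_mult power_mult_distrib power2_eq_square mult_ac)
  qed
  then obtain h where h: "h \<in> L2_fun (lebesgue_on {a..b})" "coeff h = (\<lambda>n. \<i> * complex_of_real (basis_freq n) * coeff g n)"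
    by (rule Riesz_Fischer)
  \<comment> \<open>The class of \<open>g\<close> is represented by a continuous \<open>G\<close>.
    Integrating \<open>G\<close> rather than \<open>g\<close> makes \<open>F\<close> differentiable
    at every point, as \<open>antiper_domain\<close> demands.\<close>
  obtain G where G: "G \<in> AC a b" "G a = - G b" "deriv_on a b G \<in> L2_fun (lebesgue_on {a..b})" "AE x in (lebesgue_on {a..b}). G x = g x"
    by (rule antiperiodic_primitive_of_coeff[OF g(1) h(1) fun_cong[OF h(2)]]) blast
  have Gc: "continuous_on {a..b} G" by (rule AC_continuous_on[OF G(1)])
  have GL2: "G \<in> L2_fun (lebesgue_on {a..b})" by (rule continuous_on_imp_L2_fun[OF Gc])
  have cG: "coeff G = coeff g" by (rule coeff_cong_AE[OF G(4) L2_funD(1)[OF GL2] L2_funD(1)[OF g(1)]])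
  have cGu: "coeff G n = \<i> * complex_of_real (basis_freq n) * coeff (L2_rep u) n" for n
    unfolding cG g(2) class_coeff_def ..
  obtain F where F: "F \<in> AC a b" "F a = - F b" "\<And>x. x \<in> {a..b} \<Longrightarrow> F x = F a + integral {a..x} G"
      "AE x in (lebesgue_on {a..b}). F x = L2_rep u x"
    by (rule antiperiodic_primitive_of_coeff[OF L2_rep_L2(1)[OF u] GL2 cGu]) blast
  have der: "(F has_vector_derivative G x) (at x within {a..b})" if x: "x \<in> {a..b}" for x
  proof (rule has_vector_derivative_transform[OF x])
    show "((\<lambda>x. F a + integral {a..x} G) has_vector_derivative G x) (at x within {a..b})"
      using has_vector_derivative_add[OF has_vector_derivative_const[of "F a"] integral_has_vector_derivative[OF Gc x]] by simp
  qed (rule F(3))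
  have F': "deriv_on a b F x = G x" if "x \<in> {a..b}" for x
    by (rule deriv_on_eqI[OF ab that der[OF that]])
  have F'': "deriv_on a b (deriv_on a b F) x = deriv_on a b G x" if "x \<in> {a..b}" for x
    by (rule deriv_on_cong[OF that F'])
  have "F \<in> antiper_domain a b"
    unfolding antiper_domain_def
  proof (intro CollectI conjI ballI F(1,2))
    show "F differentiable (at x within {a..b})" if "x \<in> {a..b}" for x
      using der[OF that] by (rule differentiableI_vector)
    show "deriv_on a b F \<in> AC a b" by (rule AC_cong[OF G(1) F'])
    show "deriv_on a b (deriv_on a b F) \<in> L2_fun (lebesgue_on {a..b})" by (rule L2_fun_cong[OF G(3) F''])
    show "deriv_on a b F a = - deriv_on a b F b" using G(2) F' ab by simp
  qed
  moreover have "L2_class (lebesgue_on {a..b}) F = u" using L2_class_cong[OF F(4)] L2_rep_L2(2)[OF u] by simp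
  ultimately show ?thesis by blast
qed

lemma antiper_op_eq_diag_op:
  assumes k: "k > 0"
  shows "antiper_op a b k = diag_op (\<lambda>n. (basis_freq n)\<^sup>2 + k)"
proof
  fix u
  show "antiper_op a b k u = diag_op (\<lambda>n. (basis_freq n)\<^sup>2 + k) u"
  proof (cases "u \<in> L2_class (lebesgue_on {a..b}) ` antiper_domain a b")
    case True
    \<comment> \<open>The preceding computation holds for every admissible \<open>f\<close>, so
      whichever one \<open>SOME\<close> picks gives the value of the diagonal operator.\<close>
    define f where "f = (SOME f. f \<in> antiper_domain a b \<and> L2_class (lebesgue_on {a..b}) f = u)"
    obtain f0 where "f0 \<in> antiper_domain a b \<and> L2_class (lebesgue_on {a..b}) f0 = u" using True by blast
    then have "f \<in> antiper_domain a b \<and> L2_class (lebesgue_on {a..b}) f = u" unfolding f_def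
      by (rule someI[where P = "\<lambda>f. f \<in> antiper_domain a b \<and> L2_class (lebesgue_on {a..b}) f = u"])
    then show ?thesis
      using diag_op_class_antiper_domain[of f k] True unfolding antiper_op_def f_def[symmetric] by (simp add: Let_def)
  next
    case False
    then have "diag_op (\<lambda>n. (basis_freq n)\<^sup>2 + k) u = None"
      using dom_diag_op_subset_antiper_domain[OF k] by (metis not_None_eq)
    then show ?thesis using False by (simp add: antiper_op_def)
  qed
qed

lemma dom_sqrt_antiper_op:
  assumes k: "k > 0"
  shows "dom (L2_sqrt (lebesgue_on {a..b}) (antiper_op a b k)) =
    L2_class (lebesgue_on {a..b}) ` {f. f \<in> AC a b \<and> f a = - f b \<and> deriv_on a b f \<in> L2_fun (lebesgue_on {a..b})}"
proof -
  have pos: "(basis_freq n)\<^sup>2 + k > 0" for n using k by (simp add: add_nonneg_pos)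
  \<comment> \<open>Positivity of the eigenvalues lets them be written as squares of positive
    numbers, the form in which the diagonal root was computed.\<close>
  have "antiper_op a b k = diag_op (\<lambda>n. (sqrt ((basis_freq n)\<^sup>2 + k))\<^sup>2)"
    using antiper_op_eq_diag_op[OF k] pos by (simp add: less_imp_le)
  then have "L2_sqrt (lebesgue_on {a..b}) (antiper_op a b k) = diag_op (\<lambda>n. sqrt ((basis_freq n)\<^sup>2 + k))"
    using L2_sqrt_diag_op[of "\<lambda>n. sqrt ((basis_freq n)\<^sup>2 + k)"] pos by simp
  then show ?thesis using dom_diag_op form_domain_eq[OF k] by simp
qed

end

theorem mainTheorem4:
  fixes a b k :: real
  assumes "a < b" and "k > 0"
  shows "dom (L2_sqrt (lebesgue_on {a..b}) (antiper_op a b k)) =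
    L2_class (lebesgue_on {a..b}) `
      {f. f \<in> AC a b \<and> f a = - f b \<and> deriv_on a b f \<in> L2_fun (lebesgue_on {a..b})}"
  using assms by (rule dom_sqrt_antiper_op)

end
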